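(* Let $W\subset\mathbb{R}^2$ be open, let $f:W\to\mathbb{R}$ be a random $\mathcal{C}^2$ field, and let $u_0\in\mathbb{R}$. Assume that $\{f\geqslant u_0\}$ is a.s. compact and that $f$ is a.s. Morse above $u_0$. If $$\int_{W}\mathbf{E}\left[\mathbf{1}_{\{f(x)\geqslant u_0\}}\left(\|\nabla f(x)\|^2+|\partial^2_{11}f(x)|+|\partial^2_{22}f(x)|\right)\right]dx<\infty,$$ then for every $\mathcal{C}^1$ function $h:\mathbb{R}\to\mathbb{R}$ with support in $[u_0,\infty)$, we have $\mathbf{E}\left[|\chi_f(h)|\right]<\infty$ and $$\mathbf{E}\,\chi_f(h)=\mathbf{E}\,I_f(h)=-\int_{W}\mathbf{E}\,\gamma(x,f,h)\,dx .$$
   Context: A random $\mathcal{C}^2$ field on $W$, defined on a complete probability space, is a collection of random variables $\{f(x):x\in W\}$ with $\mathcal{C}^2$ sample paths on $W$. $\{f\geqslant u\}=\{x\in W:f(x)\geqslant u\}$. $f$ is Morse above $u$ if the Hessian of $f$ is non-singular at every critical point $x$ ($\nabla f(x)=0$) with $f(x)\geqslant u$. $Q_1=\{(s,t)\in\mathbb{R}^2:t<s<0\}$, $Q_2=\{(s,t)\in\mathbb{R}^2:s<t<0\}$. For $i=1,2$, $$\gamma_i(x,f,h)=\mathbf{1}_{\{\nabla f(x)\in Q_i\}}\left[\partial_i f(x)^2h'(f(x))+\partial^2_{ii}f(x)h(f(x))\right],$$ $\gamma=\gamma_1+\gamma_2$, and $I_f(h)=-\int_W\gamma(x,f,h)\,dx$.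 $\chi_f(h)=\int_{\mathbb{R}}h(u)\chi(\{f\geqslant u\})\,du$, where, for $u$ not a critical value of $f$ with $\{f\geqslant u\}$ compact, $\chi(\{f\geqslant u\})$ is the number of bounded connected components of $\{f\geqslant u\}$ minus the number of bounded connected components of its complement in $\mathbb{R}^2$. At critical values (a Lebesgue-null set) it is set to $0$.
   Formalization: Two assumptions are added, as the claim fails without them: h and h' are bounded, and a.s. the set of x with f(x) ≥ u_0 and ∂_1 f(x) = ∂_2 f(x) < 0 (a half-line missed by both Q_1 and Q_2) has Lebesgue measure zero. *)

theory Defs
  imports "HOL-Probability.Probability"
begin

text \<open>Differential calculus for real functions of two variables.  All derivatives are used only at
  points of the open domain \<open>W\<close>; the values of the function outside \<open>W\<close> are irrelevant.\<close>

definition partial_deriv :: "2 \<Rightarrow> (real^2 \<Rightarrow> real) \<Rightarrow> real^2 \<Rightarrow> real" where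
  "partial_deriv i g x = frechet_derivative g (at x) (axis i 1)"

definition C1_on :: "(real^2) set \<Rightarrow> (real^2 \<Rightarrow> real) \<Rightarrow> bool" where
  "C1_on W g \<longleftrightarrow>
     (\<forall>x\<in>W. g differentiable (at x)) \<and> (\<forall>i. continuous_on W (partial_deriv i g))"

definition C2_on :: "(real^2) set \<Rightarrow> (real^2 \<Rightarrow> real) \<Rightarrow> bool" where
  "C2_on W g \<longleftrightarrow> C1_on W g \<and> (\<forall>i. C1_on W (partial_deriv i g))"

definition grad :: "(real^2 \<Rightarrow> real) \<Rightarrow> real^2 \<Rightarrow> real^2" where
  "grad g x = (\<chi> i. partial_deriv i g x)"

definition hessian :: "(real^2 \<Rightarrow> real) \<Rightarrow> real^2 \<Rightarrow> real^2^2" where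
  "hessian g x = (\<chi> i j. partial_deriv i (partial_deriv j g) x)"

definition random_C2_field :: "'a measure \<Rightarrow> (real^2) set \<Rightarrow> ('a \<Rightarrow> real^2 \<Rightarrow> real) \<Rightarrow> bool" where
  "random_C2_field M W f \<longleftrightarrow>
     prob_space M \<and> complete_measure M \<and>
     (\<forall>x\<in>W. (\<lambda>\<omega>. f \<omega> x) \<in> borel_measurable M) \<and>
     (\<forall>\<omega>\<in>space M. C2_on W (f \<omega>))"

definition excursion :: "(real^2) set \<Rightarrow> (real^2 \<Rightarrow> real) \<Rightarrow> real \<Rightarrow> (real^2) set" where
  "excursion W g u = {x \<in> W. g x \<ge> u}"

definition morse_above :: "(real^2) set \<Rightarrow> (real^2 \<Rightarrow> real) \<Rightarrow> real \<Rightarrow> bool" where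
  "morse_above W g u \<longleftrightarrow>
     (\<forall>x\<in>W. grad g x = 0 \<longrightarrow> g x \<ge> u \<longrightarrow> invertible (hessian g x))"

definition critical_value :: "(real^2) set \<Rightarrow> (real^2 \<Rightarrow> real) \<Rightarrow> real \<Rightarrow> bool" where
  "critical_value W g u \<longleftrightarrow> (\<exists>x\<in>W. grad g x = 0 \<and> g x = u)"

definition euler_char :: "(real^2) set \<Rightarrow> int" where
  "euler_char A =
     int (card {C \<in> components A. bounded C}) - int (card {C \<in> components (- A). bounded C})"

text \<open>The value \<open>0\<close> at non-compact excursion sets is a dummy.  It has no effect below, where
  \<open>excursion W g u\<^sub>0\<close> is compact and the level function is multiplied by some \<open>h\<close> vanishing
  below \<open>u\<^sub>0\<close>.\<close>

definition excursion_euler :: "(real^2) set \<Rightarrow> (real^2 \<Rightarrow> real) \<Rightarrow> real \<Rightarrow> real" where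
  "excursion_euler W g u =
     (if compact (excursion W g u) \<and> \<not> critical_value W g u
      then of_int (euler_char (excursion W g u)) else 0)"

definition chi :: "(real^2) set \<Rightarrow> (real^2 \<Rightarrow> real) \<Rightarrow> (real \<Rightarrow> real) \<Rightarrow> real" where
  "chi W g h = (LINT u|lborel. h u * excursion_euler W g u)"

definition Q :: "2 \<Rightarrow> (real^2) set" where
  "Q i = (if i = 1 then {v. v$2 < v$1 \<and> v$1 < 0} else {v. v$1 < v$2 \<and> v$2 < 0})"

definition gamma_dir :: "2 \<Rightarrow> real^2 \<Rightarrow> (real^2 \<Rightarrow> real) \<Rightarrow> (real \<Rightarrow> real) \<Rightarrow> real" where
  "gamma_dir i x g h =
     indicator (Q i) (grad g x) *
       ((partial_deriv i g x)\<^sup>2 * deriv h (g x)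
        + partial_deriv i (partial_deriv i g) x * h (g x))"

definition gamma :: "real^2 \<Rightarrow> (real^2 \<Rightarrow> real) \<Rightarrow> (real \<Rightarrow> real) \<Rightarrow> real" where
  "gamma x g h = gamma_dir 1 x g h + gamma_dir 2 x g h"

definition I_functional :: "(real^2) set \<Rightarrow> (real^2 \<Rightarrow> real) \<Rightarrow> (real \<Rightarrow> real) \<Rightarrow> real" where
  "I_functional W g h = - (LINT x:W|lborel. gamma x g h)"

end

theory Submission
  imports Defs "HOL-Library.Z2" "HOL-Library.Function_Algebras"
begin

text \<open>For a regular level \<open>u\<close> and a fine enough grid, sampling \<open>{g \<ge> u}\<close> on any translate of the grid preserves
  connected components and holes, because the set is locally a subgraph along a coordinate axis.
  For a finite set of grid points without diagonal contacts, the number of components minus the number of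
  holes equals the number of upper right convex corners minus the number of lower left concave ones; this is
  Euler's formula, obtained by counting cochains with coefficients in the field with two elements.

  Averaging the corner count over all translates of the grid and integrating it against \<open>h\<close> turns it into an
  integral of second differences of \<open>H \<circ> g\<close>, where \<open>H' = h\<close>.  As the mesh tends to \<open>0\<close>, dominated
  convergence yields \<open>-\<gamma>\<close>: the direction of the difference is the one in which \<open>g\<close> decreases more slowly,
  which is how the regions \<open>Q\<^sub>1\<close> and \<open>Q\<^sub>2\<close> arise.  This settles the case of \<open>h\<close> supported
  away from critical values.  In general, \<open>\<bar>I(h)\<bar> \<le> C \<integral> \<bar>h \<circ> g\<bar>\<close>, since the term with \<open>h'\<close> can be
  integrated by parts against a Lipschitz function of the gradient; hence cutting \<open>h\<close> off near the finitely many
  critical values changes \<open>I(h)\<close> arbitrarily little.  The statement for random fields follows by Fubini.\<close>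

section \<open>Euler's formula for finite sets of grid points\<close>

text \<open>The formula for components and holes contains a discrete Alexander duality. With
  two-element coefficients no orientation signs occur and dimensions are exponents of cardinalities,
  so the duality reduces to counting kernels and images. The admissible mesh depends on a lower
  bound for the gradient on the levels in question and degenerates at critical values. The corner
  integrals tend to \<open>I_functional\<close> for every test function, but equal
  \<open>e^2 * chi\<close> only when the support of \<open>h\<close> avoids critical values. Cutting
  \<open>h\<close> off closes this gap, because the error is bounded without \<open>h'\<close>, over
  which a cut-off gives no control. A second obstacle sits where both partial derivatives coincide
  and are negative. If s is the common slope and a, b are the second derivatives along the axes,
  then the corner limit there is \<open>-(s^2 * h' + (a + b) / 2 * h)\<close>, while
  \<open>gamma\<close> is 0, as \<open>Q 1\<close> and \<open>Q 2\<close> miss the diagonal. Such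
  points can fill an open set, for instance where g depends on the sum of the coordinates only;
  \<open>diagonal_null\<close> excludes this.\<close>

lemma card_additive_image:
  fixes T :: "'g::ab_group_add \<Rightarrow> 'h::ab_group_add"
  assumes fin: "finite G"
    and clos: "\<And>x y. x \<in> G \<Longrightarrow> y \<in> G \<Longrightarrow> x - y \<in> G"
    and add: "\<And>x y. x \<in> G \<Longrightarrow> y \<in> G \<Longrightarrow> T (x - y) = T x - T y"
  shows "card G = card (T ` G) * card {x \<in> G. T x = 0}"
proof -
  \<comment> \<open>Each fibre is a coset of the kernel. This count replaces rank and nullity, since
    all groups below are elementary abelian 2-groups.\<close>
  have fib: "card {x \<in> G. T x = y} = card {x \<in> G. T x = 0}" if y: "y \<in> T ` G" for y
  proof -
    from y obtain z where z: "z \<in> G" "y = T z" by auto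
    have zero: "0 \<in> G" using clos[OF z(1) z(1)] by simp
    have T0: "T 0 = 0" using add[OF zero zero] by simp
    have neg: "- x \<in> G" if "x \<in> G" for x using clos[OF zero that] by simp
    have Tneg: "T (- x) = - T x" if "x \<in> G" for x using add[OF zero that] T0 by simp
    have "bij_betw (\<lambda>x. x - z) {x \<in> G. T x = y} {x \<in> G. T x = 0}"
    proof (rule bij_betwI[where g = "\<lambda>x. x - (- z)"])
      show "(\<lambda>x. x - z) \<in> {x \<in> G. T x = y} \<rightarrow> {x \<in> G. T x = 0}"
        using z clos add by auto
      show "(\<lambda>x. x - - z) \<in> {x \<in> G. T x = 0} \<rightarrow> {x \<in> G. T x = y}"
        using z clos[OF _ neg[OF z(1)]] add[OF _ neg[OF z(1)]] Tneg by auto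
    qed auto
    then show ?thesis by (rule bij_betw_same_card)
  qed
  have "card G = (\<Sum>y\<in>T ` G. card {x \<in> G. T x = y})"
  proof -
    have "G = (\<Union>y\<in>T ` G. {x \<in> G. T x = y})" by auto
    also have "card \<dots> = (\<Sum>y\<in>T ` G. card {x \<in> G. T x = y})"
      using fin by (intro card_UN_disjoint) auto
    finally show ?thesis .
  qed
  also have "\<dots> = (\<Sum>y\<in>T ` G. card {x \<in> G. T x = 0})"
    by (rule sum.cong) (auto simp: fib)
  finally show ?thesis by simp
qed

text \<open>A cochain is a total function vanishing off its carrier, so the spaces for different
  carriers share one type, and a cochain on some edges is at once its extension by zero to the whole
  grid.\<close>

definition chains :: "'a set \<Rightarrow> ('a \<Rightarrow> bit) set" where
  "chains X = {f. \<forall>x. x \<notin> X \<longrightarrow> f x = 0}"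

definition restr :: "'a set \<Rightarrow> ('a \<Rightarrow> bit) \<Rightarrow> 'a \<Rightarrow> bit" where
  "restr X f = (\<lambda>x. if x \<in> X then f x else 0)"

lemma bij_betw_chains_Pow: "bij_betw (\<lambda>f. {x. f x = 1}) (chains X) (Pow X)"
proof (rule bij_betwI[where g = "\<lambda>A x. if x \<in> A then 1 else 0"])
  show "(\<lambda>f. {x. f x = 1}) \<in> chains X \<rightarrow> Pow X"
    by (auto simp: chains_def)
  show "(\<lambda>A x. if x \<in> A then 1 else 0) \<in> Pow X \<rightarrow> chains X"
    by (auto simp: chains_def)
qed auto

lemma finite_chains: "finite X \<Longrightarrow> finite (chains X)"
  using bij_betw_finite[OF bij_betw_chains_Pow] by blast

lemma card_chains: "finite X \<Longrightarrow> card (chains X) = 2 ^ card X"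
  using bij_betw_same_card[OF bij_betw_chains_Pow, of X] by (simp add: card_Pow)

lemma chains_diff: "f \<in> chains X \<Longrightarrow> g \<in> chains X \<Longrightarrow> f - g \<in> chains X"
  by (simp add: chains_def)

lemma restr_in_chains [simp]: "restr X f \<in> chains X"
  by (simp add: restr_def chains_def)

lemma restr_diff: "restr X (f - g) = restr X f - restr X g"
  by (auto simp: restr_def fun_eq_iff)

declare add_bit_eq_xor [simp del] mult_bit_eq_and [simp del]

lemma bit_eq_if_add_eq_0: "a + b = 0 \<Longrightarrow> a = (b::bit)"
  by (cases a; cases b; simp)

lemma bit_add_self [simp]: "a + a = (0::bit)" "a + (a + b) = (b::bit)"
  by (cases a; cases b; simp)+

section \<open>Edges, squares and coboundary maps of the square grid\<close>

type_synonym pix = "int \<times> int"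

definition pixR :: "pix \<Rightarrow> pix" where "pixR p = (fst p + 1, snd p)"
definition pixU :: "pix \<Rightarrow> pix" where "pixU p = (fst p, snd p + 1)"
definition pixL :: "pix \<Rightarrow> pix" where "pixL p = (fst p - 1, snd p)"
definition pixD :: "pix \<Rightarrow> pix" where "pixD p = (fst p, snd p - 1)"

lemmas moves = pixR_def pixU_def pixL_def pixD_def

lemma moves_inv [simp]: "pixR (pixL p) = p" "pixL (pixR p) = p" "pixU (pixD p) = p" "pixD (pixU p) = p"
  by (auto simp: moves)

lemma moves_comm: "pixU (pixR p) = pixR (pixU p)" "pixU (pixL p) = pixL (pixU p)" "pixD (pixR p) = pixR (pixD p)" "pixD (pixL p) = pixL (pixD p)"
  by (auto simp: moves)

definition adj4 :: "pix set \<Rightarrow> (pix \<times> pix) set" where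
  "adj4 P = {(p, q). p \<in> P \<and> q \<in> P \<and> \<bar>fst p - fst q\<bar> + \<bar>snd p - snd q\<bar> = 1}"

definition adj8 :: "pix set \<Rightarrow> (pix \<times> pix) set" where
  "adj8 P = {(p, q). p \<in> P \<and> q \<in> P \<and> \<bar>fst p - fst q\<bar> \<le> 1 \<and> \<bar>snd p - snd q\<bar> \<le> 1}"

text \<open>The edge joining \<open>p\<close> to \<open>pixR p\<close> is encoded as \<open>Inl p\<close>, the one joining \<open>p\<close> to \<open>pixU p\<close> as
  \<open>Inr p\<close>, and a unit square by its lower left corner.\<close>

definition edges :: "pix set \<Rightarrow> (pix + pix) set" where
  "edges P = Inl ` {p. p \<in> P \<and> pixR p \<in> P} \<union> Inr ` {p. p \<in> P \<and> pixU p \<in> P}"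

definition squares :: "pix set \<Rightarrow> pix set" where
  "squares P = {p. p \<in> P \<and> pixR p \<in> P \<and> pixU p \<in> P \<and> pixU (pixR p) \<in> P}"

definition d0 :: "(pix \<Rightarrow> bit) \<Rightarrow> pix + pix \<Rightarrow> bit" where
  "d0 \<phi> e = (case e of Inl p \<Rightarrow> \<phi> p + \<phi> (pixR p) | Inr p \<Rightarrow> \<phi> p + \<phi> (pixU p))"

definition d1 :: "(pix + pix \<Rightarrow> bit) \<Rightarrow> pix \<Rightarrow> bit" where
  "d1 w p = w (Inl p) + w (Inr (pixR p)) + w (Inl (pixU p)) + w (Inr p)"

lemma d0_simps [simp]: "d0 \<phi> (Inl p) = \<phi> p + \<phi> (pixR p)" "d0 \<phi> (Inr p) = \<phi> p + \<phi> (pixU p)"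
  by (simp_all add: d0_def)

lemma d0_diff: "d0 (f - g) = d0 f - d0 g"
  by (auto simp: fun_eq_iff d0_def add_ac split: sum.split)

lemma d1_diff: "d1 (f - g) = d1 f - d1 g"
  by (auto simp: fun_eq_iff d1_def add_ac)

lemma d1_d0: "d1 (d0 \<phi>) = 0"
  by (auto simp: fun_eq_iff d1_def moves_comm add_ac)

text \<open>Every square t of the carrier sends out an upward ray. The edge \<open>Inl p\<close>
  separates p from the square below it and counts t when the ray from t crosses it. Of t itself only
  the upper side is crossed, while each higher square in the column is entered and left, whence
  \<open>d1_ray\<close>.\<close>

definition ray :: "pix set \<Rightarrow> (pix \<Rightarrow> bit) \<Rightarrow> pix + pix \<Rightarrow> bit" where
  "ray T f e = (case e of Inl p \<Rightarrow> (\<Sum>t\<in>{t\<in>T. fst t = fst p \<and> snd t < snd p}. f t) | Inr p \<Rightarrow> 0)"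

lemma d1_ray:
  assumes "finite T" "f \<in> chains T"
  shows "d1 (ray T f) = f"
proof
  fix p
  let ?A = "{t \<in> T. fst t = fst p \<and> snd t < snd p}"
  let ?B = "{t \<in> T. fst t = fst (pixU p) \<and> snd t < snd (pixU p)}"
  have B: "?B = ?A \<union> (T \<inter> {p})" by (cases p) (force simp: pixU_def)
  have "sum f ?B = sum f ?A + sum f (T \<inter> {p})"
    unfolding B using assms(1) by (intro sum.union_disjoint) auto
  moreover have "sum f (T \<inter> {p}) = f p"
    using assms(2) unfolding chains_def by (cases "p \<in> T") (auto simp del: split_paired_All)
  ultimately show "d1 (ray T f) p = f p"
    by (simp add: d1_def ray_def)
qed

text \<open>A discrete antiderivative on all integers. For negative x the sum should carry a minus
  sign, which is invisible modulo two.\<close>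

definition isum :: "(int \<Rightarrow> bit) \<Rightarrow> int \<Rightarrow> bit" where
  "isum g x = (\<Sum>i\<in>{min 0 x..<max 0 x}. g i)"

lemma isum_step: "isum g (x + 1) = isum g x + g x"
proof (cases "x \<ge> 0")
  case True
  then have "{min 0 (x+1)..<max 0 (x+1)} = insert x {min 0 x..<max 0 x}" by auto
  moreover have "x \<notin> {min 0 x..<max 0 x}" using True by auto
  ultimately show ?thesis unfolding isum_def by (simp only: sum.insert finite_atLeastLessThan_int add.commute not_False_eq_True)
next
  case False
  then have *: "{min 0 x..<max 0 x} = insert x {min 0 (x+1)..<max 0 (x+1)}" by auto
  have "x \<notin> {min 0 (x+1)..<max 0 (x+1)}" using False by auto
  then show ?thesis unfolding isum_def * by (simp add: add_ac)
qed

text \<open>Poincare lemma of the grid: the potential integrates w along row 0 and then vertically.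
  Vertical edges come out right by construction; closedness carries the horizontal ones from row 0
  to every other row.\<close>

lemma d1_zero_imp_exact:
  assumes "d1 w = 0"
  obtains \<phi> where "w = d0 \<phi>"
proof -
  define \<phi> where "\<phi> p = isum (\<lambda>i. w (Inl (i, 0))) (fst p) + isum (\<lambda>j. w (Inr (fst p, j))) (snd p)" for p
  have r: "w (Inr p) = \<phi> p + \<phi> (pixU p)" for p
    unfolding \<phi>_def pixU_def fst_conv snd_conv isum_step by (simp add: add_ac)
  have sq: "w (Inl (x,y)) + w (Inr (x+1,y)) + w (Inl (x,y+1)) + w (Inr (x,y)) = 0" for x y
    using fun_cong[OF assms, of "(x,y)"] by (simp add: d1_def moves)
  \<comment> \<open>The defect of the potential on the horizontal edge at (x, y), with the common
    part along row 0 cancelled.\<close>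
  define F where "F x y = w (Inl (x,y)) + w (Inl (x,0)) + isum (\<lambda>j. w (Inr (x,j))) y + isum (\<lambda>j. w (Inr (x+1,j))) y" for x y
  have step: "F x (y+1) = F x y" for x y
  proof -
    have "F x (y+1) + F x y = w (Inl (x,y)) + w (Inr (x+1,y)) + w (Inl (x,y+1)) + w (Inr (x,y))"
      unfolding F_def isum_step by (simp only: add_ac bit_add_self add_0)
    then show ?thesis using sq[of x y] by (simp add: bit_eq_if_add_eq_0)
  qed
  have F0: "F x y = 0" for x y
  proof (induction y rule: int_induct[where k=0])
    case base then show ?case by (simp add: F_def isum_def)
  next
    case (step1 i) then show ?case using step by simp
  next
    case (step2 i) then show ?case using step[of x "i-1"] by simp
  qed
  have l: "w (Inl p) = \<phi> p + \<phi> (pixR p)" for p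
  proof -
    have "w (Inl p) + (\<phi> p + \<phi> (pixR p)) = F (fst p) (snd p)"
      unfolding \<phi>_def F_def pixR_def fst_conv snd_conv isum_step prod.collapse by (simp only: add_ac bit_add_self)
    then show ?thesis using F0 by (simp add: bit_eq_if_add_eq_0)
  qed
  have "w = d0 \<phi>"
  proof
    fix e show "w e = d0 \<phi> e" by (cases e) (auto simp: l r)
  qed
  then show ?thesis using that by blast
qed


section \<open>Holes and the squares touching them\<close>

definition corners :: "pix \<Rightarrow> pix set" where "corners s = {s, pixR s, pixU s, pixU (pixR s)}"

text \<open>8-adjacency of the complement is dual to 4-adjacency of the set: a diagonal contact
  joins the complement and not the set.\<close>

definition holes :: "pix set \<Rightarrow> pix set set" where
  "holes P = {B \<in> (- P) // (adj8 (- P))\<^sup>*. finite B}"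

definition touching :: "pix set \<Rightarrow> pix set" where
  "touching B = {s. corners s \<inter> B \<noteq> {}}"

lemma touching_eq: "touching B = B \<union> pixL ` B \<union> pixD ` B \<union> pixL ` pixD ` B"
proof
  show "touching B \<subseteq> B \<union> pixL ` B \<union> pixD ` B \<union> pixL ` pixD ` B"
  proof
    fix s assume "s \<in> touching B"
    then consider "s \<in> B" | "pixR s \<in> B" | "pixU s \<in> B" | "pixU (pixR s) \<in> B"
      by (auto simp: touching_def corners_def)
    then show "s \<in> B \<union> pixL ` B \<union> pixD ` B \<union> pixL ` pixD ` B"
    proof cases
      case 2 then have "pixL (pixR s) \<in> pixL ` B" by blast
      then show ?thesis by simp
    next
      case 3 then have "pixD (pixU s) \<in> pixD ` B" by blast
      then show ?thesis by simp
    next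
      case 4 then have "pixL (pixD (pixU (pixR s))) \<in> pixL ` pixD ` B" by blast
      then show ?thesis by simp
    qed auto
  qed
  show "B \<union> pixL ` B \<union> pixD ` B \<union> pixL ` pixD ` B \<subseteq> touching B"
    by (auto simp: touching_def corners_def moves_comm)
qed

lemma finite_touching: "finite B \<Longrightarrow> finite (touching B)"
  by (simp add: touching_eq)

lemma sym_adj8: "sym (adj8 N)" by (auto simp: sym_def adj8_def)
lemma sym_adj4: "sym (adj4 N)" by (auto simp: sym_def adj4_def)

lemma adj8_rtrancl_sym: "(p, q) \<in> (adj8 N)\<^sup>* \<Longrightarrow> (q, p) \<in> (adj8 N)\<^sup>*"
  using sym_rtrancl[OF sym_adj8] by (auto dest: symD)

lemma adj4_rtrancl_sym: "(p, q) \<in> (adj4 N)\<^sup>* \<Longrightarrow> (q, p) \<in> (adj4 N)\<^sup>*"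
  using sym_rtrancl[OF sym_adj4] by (auto dest: symD)

lemma adj8_rtrancl_mem: "(p, q) \<in> (adj8 N)\<^sup>* \<Longrightarrow> p \<in> N \<Longrightarrow> q \<in> N"
  by (induction rule: rtrancl_induct) (auto simp: adj8_def)

lemma adj4_rtrancl_mem: "(p, q) \<in> (adj4 N)\<^sup>* \<Longrightarrow> p \<in> N \<Longrightarrow> q \<in> N"
  by (induction rule: rtrancl_induct) (auto simp: adj4_def)

lemma corners_adj8: "x \<in> corners s \<Longrightarrow> y \<in> corners s \<Longrightarrow> x \<in> N \<Longrightarrow> y \<in> N \<Longrightarrow> (x, y) \<in> adj8 N"
  by (auto simp: corners_def adj8_def moves)

lemma adj8_corners:
  assumes "(x, y) \<in> adj8 N"
  obtains s where "x \<in> corners s" "y \<in> corners s"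
proof -
  have "x \<in> corners (min (fst x) (fst y), min (snd x) (snd y))" "y \<in> corners (min (fst x) (fst y), min (snd x) (snd y))"
    using assms by (cases x; cases y; auto simp: corners_def adj8_def moves min_def)+
  then show ?thesis using that by blast
qed

text \<open>Any two corners of a square are 8-adjacent, so its corners in N all lie in one class.
  Hence no square touches two classes.\<close>

lemma touching_class_iff:
  assumes B: "B \<in> N // (adj8 N)\<^sup>*" and x: "x \<in> N" "x \<in> corners s"
  shows "s \<in> touching B \<longleftrightarrow> x \<in> B"
proof
  assume "s \<in> touching B"
  then obtain y where y: "y \<in> corners s" "y \<in> B" by (auto simp: touching_def)
  obtain b where b: "b \<in> N" "B = (adj8 N)\<^sup>* `` {b}" using B by (auto simp: quotient_def)
  have "y \<in> N" using y b adj8_rtrancl_mem by blast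
  then have "(y, x) \<in> adj8 N" using corners_adj8 x y by blast
  then show "x \<in> B" using y b by (auto intro: rtrancl_into_rtrancl)
next
  assume "x \<in> B" then show "s \<in> touching B" using x by (auto simp: touching_def)
qed

lemma edges_iff [simp]: "Inl p \<in> edges P \<longleftrightarrow> p \<in> P \<and> pixR p \<in> P" "Inr p \<in> edges P \<longleftrightarrow> p \<in> P \<and> pixU p \<in> P"
  by (auto simp: edges_def)

text \<open>The two squares beside an edge share its end points, and an edge is missing only because
  an end point is.\<close>

lemma edge_notin_corner:
  "Inl p \<notin> edges P \<Longrightarrow> \<exists>x\<in>-P. x \<in> corners p \<and> x \<in> corners (pixD p)"
  "Inr p \<notin> edges P \<Longrightarrow> \<exists>x\<in>-P. x \<in> corners p \<and> x \<in> corners (pixL p)"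
  by (auto simp: edges_def corners_def moves)

lemma sum_shift_invariant:
  fixes v :: "'a \<Rightarrow> bit"
  assumes "finite S" and inv: "\<And>p. f (g p) = p" "\<And>p. g (f p) = p"
    and v: "\<And>p. v p \<noteq> 0 \<Longrightarrow> p \<in> S \<longleftrightarrow> g p \<in> S"
  shows "(\<Sum>s\<in>S. v (f s)) = (\<Sum>s\<in>S. v s)"
proof -
  have "(\<Sum>s\<in>S. v (f s)) = sum v (f ` S)"
    by (rule sum.reindex[symmetric, unfolded o_def]) (metis inj_onI inv(2))
  also have "\<dots> = sum v (f ` S \<union> S)"
    using assms(1) v inv by (intro sum.mono_neutral_left) (auto simp: image_iff, metis bit_not_one_iff inv)
  also have "\<dots> = sum v S"
    using assms(1) v inv by (intro sum.mono_neutral_right) (auto, metis bit_not_one_iff inv(2))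
  finally show ?thesis .
qed

text \<open>The two squares beside a missing edge touch the same classes, so the edge enters the sum
  twice or not at all.\<close>

lemma sum_d1_hole:
  assumes B: "B \<in> holes P" and v: "\<And>e. e \<in> edges P \<Longrightarrow> v e = 0"
  shows "(\<Sum>s\<in>touching B. d1 v s) = 0"
proof -
  have B': "B \<in> (- P) // (adj8 (- P))\<^sup>*" "finite B" using B by (auto simp: holes_def)
  note fin = finite_touching[OF B'(2)]
  have "(\<Sum>s\<in>touching B. v (Inl (pixU s))) = (\<Sum>s\<in>touching B. v (Inl s))"
  proof (rule sum_shift_invariant[OF fin, where g = pixD])
    fix p assume "v (Inl p) \<noteq> 0"
    then have "Inl p \<notin> edges P" using v by auto
    then show "p \<in> touching B \<longleftrightarrow> pixD p \<in> touching B"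
      using edge_notin_corner(1)[of p P] touching_class_iff[OF B'(1)] by blast
  qed auto
  moreover have "(\<Sum>s\<in>touching B. v (Inr (pixR s))) = (\<Sum>s\<in>touching B. v (Inr s))"
  proof (rule sum_shift_invariant[OF fin, where g = pixL])
    fix p assume "v (Inr p) \<noteq> 0"
    then have "Inr p \<notin> edges P" using v by auto
    then show "p \<in> touching B \<longleftrightarrow> pixL p \<in> touching B"
      using edge_notin_corner(2)[of p P] touching_class_iff[OF B'(1)] by blast
  qed auto
  ultimately show ?thesis by (simp add: d1_def sum.distrib add_ac)
qed

definition delta :: "pix \<Rightarrow> pix \<Rightarrow> bit" where "delta p q = (if q = p then 1 else 0)"

text \<open>The functions on squares that can be cancelled without changing a cochain on the edges of \<open>P\<close>.\<close>

definition off_bdry :: "pix set \<Rightarrow> (pix \<Rightarrow> bit) set" where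
  "off_bdry P = d1 ` {v. \<forall>e\<in>edges P. v e = 0}"

lemma off_bdryI: "(\<And>e. e \<in> edges P \<Longrightarrow> v e = 0) \<Longrightarrow> d1 v \<in> off_bdry P"
  by (auto simp: off_bdry_def)

lemma off_bdry_diff: "f \<in> off_bdry P \<Longrightarrow> g \<in> off_bdry P \<Longrightarrow> f - g \<in> off_bdry P"
proof -
  assume "f \<in> off_bdry P" "g \<in> off_bdry P"
  then obtain v w where "f = d1 v" "g = d1 w" "\<forall>e\<in>edges P. v e = 0" "\<forall>e\<in>edges P. w e = 0"
    by (auto simp: off_bdry_def)
  then show ?thesis using off_bdryI[of P "v - w"] by (simp add: d1_diff)
qed

lemma fun_bit_minus [simp]: "- f = (f :: 'a \<Rightarrow> bit)" "f - g = f + (g :: 'a \<Rightarrow> bit)"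
  by (auto simp: fun_eq_iff)

lemma off_bdry_add: "f \<in> off_bdry P \<Longrightarrow> g \<in> off_bdry P \<Longrightarrow> f + g \<in> off_bdry P"
  using off_bdry_diff by force

text \<open>A unit mass can pass through a missing edge from one adjacent square to the
  other.\<close>

lemma off_bdry_edge:
  "Inl p \<notin> edges P \<Longrightarrow> delta p + delta (pixD p) \<in> off_bdry P"
  "Inr p \<notin> edges P \<Longrightarrow> delta p + delta (pixL p) \<in> off_bdry P"
proof -
  have *: "d1 (\<lambda>e. if e = Inl p then 1 else 0) = delta p + delta (pixD p)"
    "d1 (\<lambda>e. if e = Inr p then 1 else 0) = delta p + delta (pixL p)"
    by (auto simp: fun_eq_iff d1_def delta_def moves)
  show "Inl p \<notin> edges P \<Longrightarrow> delta p + delta (pixD p) \<in> off_bdry P"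
    unfolding *(1)[symmetric] by (rule off_bdryI) auto
  show "Inr p \<notin> edges P \<Longrightarrow> delta p + delta (pixL p) \<in> off_bdry P"
    unfolding *(2)[symmetric] by (rule off_bdryI) auto
qed

lemma delta_trans: "delta a + delta b \<in> off_bdry P \<Longrightarrow> delta b + delta c \<in> off_bdry P \<Longrightarrow> delta a + delta c \<in> off_bdry P"
proof -
  assume "delta a + delta b \<in> off_bdry P" "delta b + delta c \<in> off_bdry P"
  then have "(delta a + delta b) + (delta b + delta c) \<in> off_bdry P" by (rule off_bdry_add)
  moreover have "(delta a + delta b) + (delta b + delta c) = delta a + delta c"
    by (auto simp: fun_eq_iff add_ac)
  ultimately show ?thesis by simp
qed

text \<open>The four squares around a missing grid point are linked by the edges at that point, all
  of them missing.\<close>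

lemma delta_corner:
  assumes "x \<in> - P" "x \<in> corners s"
  shows "delta s + delta x \<in> off_bdry P"
proof -
  have e: "Inl x \<notin> edges P" "Inr x \<notin> edges P" "Inr (pixD x) \<notin> edges P"
    using assms(1) by auto
  have 1: "delta (pixD x) + delta x \<in> off_bdry P" using off_bdry_edge(1)[OF e(1)] by (simp add: add.commute)
  have 2: "delta (pixL x) + delta x \<in> off_bdry P" using off_bdry_edge(2)[OF e(2)] by (simp add: add.commute)
  have "delta (pixL (pixD x)) + delta (pixD x) \<in> off_bdry P" using off_bdry_edge(2)[OF e(3)] by (simp add: add.commute)
  then have 3: "delta (pixL (pixD x)) + delta x \<in> off_bdry P" using 1 delta_trans by blast
  have "delta x + delta x = d1 0" by (auto simp: fun_eq_iff d1_def)
  then have 0: "delta x + delta x \<in> off_bdry P" by (simp only: off_bdryI zero_fun_apply)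
  have "s = x \<or> s = pixL x \<or> s = pixD x \<or> s = pixL (pixD x)"
    using assms(2) by (auto simp: corners_def moves)
  then show ?thesis using 0 1 2 3 by (elim disjE) (simp_all only:)
qed

lemma delta_path:
  assumes "(x, y) \<in> (adj8 (- P))\<^sup>*" "x \<in> - P"
  shows "delta x + delta y \<in> off_bdry P"
  using assms
proof (induction rule: rtrancl_induct)
  case base
  show ?case by (rule delta_corner) (use base in \<open>auto simp: corners_def\<close>)
next
  case (step y z)
  obtain s where s: "y \<in> corners s" "z \<in> corners s" using adj8_corners[OF step(2)] by blast
  have yz: "y \<in> -P" "z \<in> -P" using step(2) by (auto simp: adj8_def)
  have "delta y + delta s \<in> off_bdry P" "delta s + delta z \<in> off_bdry P"
    using delta_corner[OF yz(1) s(1)] delta_corner[OF yz(2) s(2)] by (simp_all add: add.commute)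
  then show ?case using step delta_trans by blast
qed

text \<open>The upward ray from a square lying above all of P meets no edge of P.\<close>

lemma delta_far:
  assumes "\<forall>p\<in>P. snd p \<le> n" "n < snd s"
  shows "delta s \<in> off_bdry P"
proof -
  have "d1 (ray {s} (delta s)) = delta s"
    by (rule d1_ray) (auto simp: chains_def delta_def)
  moreover have "ray {s} (delta s) e = 0" if "e \<in> edges P" for e
  proof (cases e)
    case (Inl p)
    then have "{t \<in> {s}. fst t = fst p \<and> snd t < snd p} = {}" using that assms by auto
    then show ?thesis unfolding ray_def Inl sum.case by (simp only: sum.empty)
  qed (simp add: ray_def)
  ultimately show ?thesis using off_bdryI[of P "ray {s} (delta s)"] by simp
qed


lemma adj4_subset_adj8: "adj4 N \<subseteq> adj8 N"
  by (auto simp: adj4_def adj8_def)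

lemma adj8_class_eq: "(a, b) \<in> (adj8 N)\<^sup>* \<Longrightarrow> (adj8 N)\<^sup>* `` {a} = (adj8 N)\<^sup>* `` {b}"
  using adj8_rtrancl_sym rtrancl_trans[of _ _ "adj8 N"] by (intro equalityI subsetI) (blast dest: Image_singleton_iff[THEN iffD1] intro: Image_singleton_iff[THEN iffD2])+

lemma adj4_segment_v:
  assumes "a \<le> b" "\<And>k. a \<le> k \<Longrightarrow> k \<le> b \<Longrightarrow> (x, k) \<in> N"
  shows "((x, a), (x, b)) \<in> (adj4 N)\<^sup>*"
  using assms
proof (induction b rule: int_ge_induct)
  case (step i)
  then have "((x, a), (x, i)) \<in> (adj4 N)\<^sup>*" "((x, i), (x, i + 1)) \<in> adj4 N"
    by (auto simp: adj4_def)
  then show ?case by (rule rtrancl_into_rtrancl)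
qed auto

lemma adj4_segment_h:
  assumes "a \<le> b" "\<And>k. a \<le> k \<Longrightarrow> k \<le> b \<Longrightarrow> (k, y) \<in> N"
  shows "((a, y), (b, y)) \<in> (adj4 N)\<^sup>*"
  using assms
proof (induction b rule: int_ge_induct)
  case (step i)
  then have "((a, y), (i, y)) \<in> (adj4 N)\<^sup>*" "((i, y), (i + 1, y)) \<in> adj4 N"
    by (auto simp: adj4_def)
  then show ?case by (rule rtrancl_into_rtrancl)
qed auto

lemma adj4_line_v:
  assumes "\<And>k. min a b \<le> k \<Longrightarrow> k \<le> max a b \<Longrightarrow> (x, k) \<in> N"
  shows "((x, a), (x, b)) \<in> (adj4 N)\<^sup>*"
proof (cases "a \<le> b")
  case True then show ?thesis using assms by (intro adj4_segment_v) auto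
next
  case False then show ?thesis using assms by (intro adj4_rtrancl_sym[OF adj4_segment_v]) auto
qed

lemma adj4_line_h:
  assumes "\<And>k. min a b \<le> k \<Longrightarrow> k \<le> max a b \<Longrightarrow> (k, y) \<in> N"
  shows "((a, y), (b, y)) \<in> (adj4 N)\<^sup>*"
proof (cases "a \<le> b")
  case True then show ?thesis using assms by (intro adj4_segment_h) auto
next
  case False then show ?thesis using assms by (intro adj4_rtrancl_sym[OF adj4_segment_h]) auto
qed

lemma outside_connected:
  assumes P: "\<forall>p\<in>P. \<bar>fst p\<bar> \<le> n \<and> \<bar>snd p\<bar> \<le> n" and y: "\<bar>fst y\<bar> > n \<or> \<bar>snd y\<bar> > n"
  shows "(y, (n + 1, n + 1)) \<in> (adj8 (- P))\<^sup>*"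
proof -
  have N: "q \<in> - P" if "\<bar>fst q\<bar> > n \<or> \<bar>snd q\<bar> > n" for q using P that by force
  note up = subsetD[OF rtrancl_mono[OF adj4_subset_adj8] adj4_line_v]
  note right = subsetD[OF rtrancl_mono[OF adj4_subset_adj8] adj4_line_h]
  obtain a b where ab: "y = (a, b)" by (cases y)
  have corner: "((a, b), (n + 1, n + 1)) \<in> (adj8 (- P))\<^sup>*" if "\<bar>a\<bar> > n"
  proof -
    have "((a, b), (a, n + 1)) \<in> (adj8 (- P))\<^sup>*" by (rule up, rule N) (use that in auto)
    also have "((a, n + 1), (n + 1, n + 1)) \<in> (adj8 (- P))\<^sup>*" by (rule right, rule N) auto
    finally show ?thesis .
  qed
  show ?thesis
  proof (cases "\<bar>a\<bar> > n")
    case True then show ?thesis using corner ab by simp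
  next
    case False
    then have b: "\<bar>b\<bar> > n" using y ab by simp
    have "((a, b), (n + 1, b)) \<in> (adj8 (- P))\<^sup>*" by (rule right, rule N) (use b in auto)
    also have "((n + 1, b), (n + 1, n + 1)) \<in> (adj8 (- P))\<^sup>*" by (rule up, rule N) auto
    finally show ?thesis using ab by simp
  qed
qed

lemma finite_pix_bounded:
  assumes "finite (P :: pix set)"
  obtains n where "\<forall>p\<in>P. \<bar>fst p\<bar> \<le> n \<and> \<bar>snd p\<bar> \<le> n"
proof
  show "\<forall>p\<in>P. \<bar>fst p\<bar> \<le> (\<Sum>q\<in>P. \<bar>fst q\<bar> + \<bar>snd q\<bar>) \<and> \<bar>snd p\<bar> \<le> (\<Sum>q\<in>P. \<bar>fst q\<bar> + \<bar>snd q\<bar>)"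
  proof
    fix p assume "p \<in> P"
    then have "\<bar>fst p\<bar> + \<bar>snd p\<bar> \<le> (\<Sum>q\<in>P. \<bar>fst q\<bar> + \<bar>snd q\<bar>)"
      using assms by (intro member_le_sum) auto
    then show "\<bar>fst p\<bar> \<le> (\<Sum>q\<in>P. \<bar>fst q\<bar> + \<bar>snd q\<bar>) \<and> \<bar>snd p\<bar> \<le> (\<Sum>q\<in>P. \<bar>fst q\<bar> + \<bar>snd q\<bar>)" by linarith
  qed
qed

lemma finite_box: "finite {p :: pix. \<bar>fst p\<bar> \<le> n \<and> \<bar>snd p\<bar> \<le> n}"
  by (rule finite_subset[of _ "{-n..n} \<times> {-n..n}"]) auto

lemma infinite_outside: "infinite {p :: pix. \<bar>fst p\<bar> > n \<or> \<bar>snd p\<bar> > n}"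
proof
  assume "finite {p :: pix. \<bar>fst p\<bar> > n \<or> \<bar>snd p\<bar> > n}"
  then have "finite ({p :: pix. \<bar>fst p\<bar> > n \<or> \<bar>snd p\<bar> > n} \<union> {p. \<bar>fst p\<bar> \<le> n \<and> \<bar>snd p\<bar> \<le> n})"
    using finite_box by blast
  moreover have "{p :: pix. \<bar>fst p\<bar> > n \<or> \<bar>snd p\<bar> > n} \<union> {p. \<bar>fst p\<bar> \<le> n \<and> \<bar>snd p\<bar> \<le> n} = UNIV" by auto
  ultimately have "finite (UNIV :: pix set)" by simp
  then show False by (simp add: finite_prod)
qed

lemma finite_class_subset_box:
  assumes P: "\<forall>p\<in>P. \<bar>fst p\<bar> \<le> n \<and> \<bar>snd p\<bar> \<le> n" and B: "B \<in> holes P"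
  shows "B \<subseteq> {p. \<bar>fst p\<bar> \<le> n \<and> \<bar>snd p\<bar> \<le> n}"
proof
  fix x assume "x \<in> B"
  obtain b where b: "B = (adj8 (- P))\<^sup>* `` {b}" "finite B" using B by (auto simp: holes_def quotient_def)
  show "x \<in> {p. \<bar>fst p\<bar> \<le> n \<and> \<bar>snd p\<bar> \<le> n}"
  proof (rule ccontr)
    assume "x \<notin> {p. \<bar>fst p\<bar> \<le> n \<and> \<bar>snd p\<bar> \<le> n}"
    then have x: "\<bar>fst x\<bar> > n \<or> \<bar>snd x\<bar> > n" by auto
    have "{p. \<bar>fst p\<bar> > n \<or> \<bar>snd p\<bar> > n} \<subseteq> B"
    proof
      fix y :: pix assume "y \<in> {p. \<bar>fst p\<bar> > n \<or> \<bar>snd p\<bar> > n}"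
      then have "(x, y) \<in> (adj8 (- P))\<^sup>*"
        using outside_connected[OF P x] adj8_rtrancl_sym[OF outside_connected[OF P, of y]] by (auto intro: rtrancl_trans)
      then show "y \<in> B" using \<open>x \<in> B\<close> b by (auto intro: rtrancl_trans)
    qed
    then show False using b(2) infinite_outside finite_subset by blast
  qed
qed

lemma finite_holes: "finite P \<Longrightarrow> finite (holes P)"
proof -
  assume "finite P"
  then obtain n where n: "\<forall>p\<in>P. \<bar>fst p\<bar> \<le> n \<and> \<bar>snd p\<bar> \<le> n" by (rule finite_pix_bounded)
  have "holes P \<subseteq> Pow {p. \<bar>fst p\<bar> \<le> n \<and> \<bar>snd p\<bar> \<le> n}"
    using finite_class_subset_box[OF n] by blast
  then show ?thesis using finite_box finite_subset by blast
qed

text \<open>Mass in the unbounded region escapes: an infinite class leaves every box, so an 8-path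
  leads to the square at (n + 1, n + 1), and a ray from there to infinity.\<close>

lemma delta_infinite_class:
  assumes "finite P" "x \<in> - P" "infinite ((adj8 (- P))\<^sup>* `` {x})"
  shows "delta x \<in> off_bdry P"
proof -
  obtain n where n: "\<forall>p\<in>P. \<bar>fst p\<bar> \<le> n \<and> \<bar>snd p\<bar> \<le> n" using assms(1) by (rule finite_pix_bounded)
  have "\<not> (adj8 (- P))\<^sup>* `` {x} \<subseteq> {p. \<bar>fst p\<bar> \<le> n \<and> \<bar>snd p\<bar> \<le> n}"
    using assms(3) finite_box finite_subset by blast
  then obtain y where "y \<in> (adj8 (- P))\<^sup>* `` {x}" "y \<notin> {p. \<bar>fst p\<bar> \<le> n \<and> \<bar>snd p\<bar> \<le> n}" by blast
  then have y: "(x, y) \<in> (adj8 (- P))\<^sup>*" "\<bar>fst y\<bar> > n \<or> \<bar>snd y\<bar> > n" by (simp_all add: not_le)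
  then have "(x, (n + 1, n + 1)) \<in> (adj8 (- P))\<^sup>*"
    using outside_connected[OF n] by (blast intro: rtrancl_trans)
  then have "delta x + delta (n + 1, n + 1) \<in> off_bdry P" using delta_path assms(2) by blast
  moreover have "delta (n + 1, n + 1) \<in> off_bdry P" using n by (intro delta_far[of P n]) auto
  ultimately have "(delta x + delta (n + 1, n + 1)) + delta (n + 1, n + 1) \<in> off_bdry P" by (rule off_bdry_add)
  moreover have "(delta x + delta (n + 1, n + 1)) + delta (n + 1, n + 1) = delta x"
    by (auto simp: fun_eq_iff add_ac)
  ultimately show ?thesis by simp
qed

text \<open>Converse of \<open>sum_d1_hole\<close>, by shrinking the support of c. A support square
  touching an infinite class is removed alone. One touching a hole has a partner in the support at
  the same hole, because the total there is even, and the two cancel along a path of missing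
  points.\<close>

lemma off_bdry_criterion:
  assumes P: "finite P"
  shows "finite {s. c s \<noteq> 0} \<Longrightarrow> (\<And>s. s \<in> squares P \<Longrightarrow> c s = 0) \<Longrightarrow>
    (\<And>B. B \<in> holes P \<Longrightarrow> (\<Sum>s\<in>touching B. c s) = 0) \<Longrightarrow> c \<in> off_bdry P"
proof (induction "card {s. c s \<noteq> 0}" arbitrary: c rule: less_induct)
  case less
  have sum_delta: "(\<Sum>s\<in>touching B. delta t s) = (if t \<in> touching B then 1 else 0)" if "B \<in> holes P" for B t
    using finite_touching[of B] that by (simp add: delta_def holes_def)
  show ?case
  proof (cases "{s. c s \<noteq> 0} = {}")
    case True
    then have "c = d1 0" by (auto simp: fun_eq_iff d1_def)
    then show ?thesis using off_bdryI[of P 0] by simp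
  next
    case False
    then obtain s where s: "c s \<noteq> 0" by auto
    then have "s \<notin> squares P" using less.prems(2)[of s] by auto
    then obtain x where x: "x \<in> - P" "x \<in> corners s" unfolding squares_def corners_def by blast
    let ?B = "(adj8 (- P))\<^sup>* `` {x}"
    have q: "?B \<in> (- P) // (adj8 (- P))\<^sup>*" using x(1) by (rule quotientI)
    have sB: "s \<in> touching ?B" using touching_class_iff[OF q x] by simp
    have dsx: "delta s + delta x \<in> off_bdry P" using delta_corner x by blast
    have touch: "t \<in> touching B' \<longleftrightarrow> ?B = B'" if t: "t \<in> touching ?B" and B': "B' \<in> holes P" for t B'
    proof -
      obtain y where y: "y \<in> corners t" "y \<in> ?B" using t by (auto simp: touching_def)
      have yP: "y \<in> - P" using y(2) adj8_rtrancl_mem x(1) by blast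
      have B'q: "B' \<in> (- P) // (adj8 (- P))\<^sup>*" using B' by (simp add: holes_def)
      then obtain b where b: "b \<in> -P" "B' = (adj8 (- P))\<^sup>* `` {b}" by (rule quotientE)
      have "t \<in> touching B' \<longleftrightarrow> y \<in> B'" using touching_class_iff[OF B'q yP y(1)] .
      also have "\<dots> \<longleftrightarrow> ?B = B'"
      proof
        assume "y \<in> B'"
        then have "(b, y) \<in> (adj8 (- P))\<^sup>*" "(x, y) \<in> (adj8 (- P))\<^sup>*" using y(2) b by simp_all
        then show "?B = B'" using b adj8_class_eq by metis
      next
        assume "?B = B'" then show "y \<in> B'" using y(2) by simp
      qed
      finally show ?thesis .
    qed
    show ?thesis
    proof (cases "finite ?B")
      case False
      have dx: "delta x \<in> off_bdry P" using delta_infinite_class P x(1) False by blast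
      have "(delta s + delta x) + delta x \<in> off_bdry P" using off_bdry_add dsx dx by blast
      moreover have "(delta s + delta x) + delta x = delta s" by (auto simp: fun_eq_iff add_ac)
      ultimately have ds: "delta s \<in> off_bdry P" by simp
      have sub: "{t. (c + delta s) t \<noteq> 0} \<subset> {t. c t \<noteq> 0}"
        using s by (auto simp: delta_def)
      have "c + delta s \<in> off_bdry P"
      proof (rule less.hyps)
        show "card {t. (c + delta s) t \<noteq> 0} < card {t. c t \<noteq> 0}"
          using sub less.prems(1) by (rule psubset_card_mono[rotated])
        show "finite {t. (c + delta s) t \<noteq> 0}" using sub less.prems(1) finite_subset by blast
        show "(c + delta s) t = 0" if "t \<in> squares P" for t
          using less.prems(2)[OF that] \<open>s \<notin> squares P\<close> that by (auto simp: delta_def)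
        show "(\<Sum>t\<in>touching B'. (c + delta s) t) = 0" if B': "B' \<in> holes P" for B'
        proof -
          have "s \<notin> touching B'" using touch[OF sB B'] False B' by (auto simp: holes_def)
          then show ?thesis using less.prems(3)[OF B'] sum_delta[OF B'] by (simp add: sum.distrib)
        qed
      qed
      then have "(c + delta s) + delta s \<in> off_bdry P" using ds off_bdry_add by blast
      moreover have "(c + delta s) + delta s = c" by (auto simp: fun_eq_iff add_ac)
      ultimately show ?thesis by simp
    next
      case True
      then have hB: "?B \<in> holes P" using q by (simp add: holes_def)
      have fin: "finite (touching ?B)" using finite_touching True by blast
      have "(\<Sum>t\<in>touching ?B. c t) = c s + (\<Sum>t\<in>touching ?B - {s}. c t)"
        by (rule sum.remove[OF fin sB])
      then have "(\<Sum>t\<in>touching ?B - {s}. c t) \<noteq> 0"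
        using less.prems(3)[OF hB] s by (metis add.right_neutral)
      then obtain t where t: "t \<in> touching ?B" "t \<noteq> s" "c t \<noteq> 0" using sum.neutral by (metis Diff_iff singletonI)
      obtain y where y: "y \<in> corners t" "y \<in> ?B" using t(1) by (auto simp: touching_def)
      have yP: "y \<in> - P" using y(2) adj8_rtrancl_mem x(1) by blast
      have "delta t + delta y \<in> off_bdry P" using delta_corner yP y(1) by blast
      moreover have "delta x + delta y \<in> off_bdry P" using delta_path x(1) y(2) by blast
      ultimately have dst: "delta s + delta t \<in> off_bdry P"
        using dsx delta_trans[of s x P y] delta_trans[of s y P t] by (simp add: add.commute)
      let ?c = "c + (delta s + delta t)"
      have sub: "{t. ?c t \<noteq> 0} \<subset> {t. c t \<noteq> 0}"
        using s t by (auto simp: delta_def)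
      have "?c \<in> off_bdry P"
      proof (rule less.hyps)
        show "card {t. ?c t \<noteq> 0} < card {t. c t \<noteq> 0}"
          using sub less.prems(1) by (rule psubset_card_mono[rotated])
        show "finite {t. ?c t \<noteq> 0}" using sub less.prems(1) finite_subset by blast
        have "t \<notin> squares P" using t less.prems(2)[of t] by auto
        then show "?c t' = 0" if "t' \<in> squares P" for t'
          using less.prems(2)[OF that] \<open>s \<notin> squares P\<close> that by (auto simp: delta_def)
        show "(\<Sum>t\<in>touching B'. ?c t) = 0" if B': "B' \<in> holes P" for B'
          using touch[OF sB B'] touch[OF t(1) B'] less.prems(3)[OF B'] sum_delta[OF B'] by (simp add: sum.distrib)
      qed
      then have "?c + (delta s + delta t) \<in> off_bdry P" using dst off_bdry_add by blast
      moreover have "?c + (delta s + delta t) = c" by (auto simp: fun_eq_iff add_ac)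
      ultimately show ?thesis by simp
    qed
  qed
qed


section \<open>Counting exact and closed cochains\<close>

lemma finite_edges: "finite P \<Longrightarrow> finite (edges P)"
  by (simp add: edges_def)

lemma finite_squares: "finite P \<Longrightarrow> finite (squares P)"
  by (simp add: squares_def)

lemma adj4_class_eq: "(a, b) \<in> (adj4 N)\<^sup>* \<Longrightarrow> (adj4 N)\<^sup>* `` {a} = (adj4 N)\<^sup>* `` {b}"
  using adj4_rtrancl_sym rtrancl_trans[of _ _ "adj4 N"] by (intro equalityI subsetI) (blast dest: Image_singleton_iff[THEN iffD1] intro: Image_singleton_iff[THEN iffD2])+

definition exact_cochains :: "pix set \<Rightarrow> (pix + pix \<Rightarrow> bit) set" where
  "exact_cochains P = (\<lambda>\<phi>. restr (edges P) (d0 \<phi>)) ` chains P"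

definition closed_cochains :: "pix set \<Rightarrow> (pix + pix \<Rightarrow> bit) set" where
  "closed_cochains P = {w \<in> chains (edges P). restr (squares P) (d1 w) = 0}"

lemma zero_in_chains [simp]: "0 \<in> chains X"
  by (simp add: chains_def)

lemma closed_cochains_diff: "w \<in> closed_cochains P \<Longrightarrow> v \<in> closed_cochains P \<Longrightarrow> w - v \<in> closed_cochains P"
  unfolding closed_cochains_def mem_Collect_eq d1_diff restr_diff using chains_diff by force

lemma adj4_cases:
  assumes "(p, q) \<in> adj4 P"
  shows "q = pixR p \<or> q = pixU p \<or> p = pixR q \<or> p = pixU q"
  using assms by (cases p; cases q) (auto simp: adj4_def moves abs_if split: if_splits)

lemma d0_kernel:
  "{\<phi> \<in> chains P. restr (edges P) (d0 \<phi>) = 0} = {\<phi> \<in> chains P. \<forall>(p, q)\<in>adj4 P. \<phi> p = \<phi> q}"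
proof -
  have "restr (edges P) (d0 \<phi>) = 0 \<longleftrightarrow> (\<forall>(p, q)\<in>adj4 P. \<phi> p = \<phi> q)" (is "?l \<longleftrightarrow> ?r") for \<phi>
  proof
    assume ?l
    then have e: "d0 \<phi> e = 0" if "e \<in> edges P" for e
      using that by (metis restr_def zero_fun_apply)
    have *: "\<phi> p = \<phi> (pixR p)" if "p \<in> P" "pixR p \<in> P" for p using e[of "Inl p"] that by (simp add: bit_eq_if_add_eq_0)
    have **: "\<phi> p = \<phi> (pixU p)" if "p \<in> P" "pixU p \<in> P" for p using e[of "Inr p"] that by (simp add: bit_eq_if_add_eq_0)
    have "\<phi> p = \<phi> q" if "(p, q) \<in> adj4 P" for p q
      using adj4_cases[OF that] *[of p] **[of p] *[of q] **[of q] that by (auto simp: adj4_def)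
    then show ?r by auto
  next
    assume r: ?r
    have "d0 \<phi> e = 0" if e: "e \<in> edges P" for e
    proof (cases e)
      case (Inl p)
      then have "(p, pixR p) \<in> adj4 P" using e by (auto simp: adj4_def pixR_def)
      then show ?thesis using r Inl by fastforce
    next
      case (Inr p)
      then have "(p, pixU p) \<in> adj4 P" using e by (auto simp: adj4_def pixU_def)
      then show ?thesis using r Inr by fastforce
    qed
    then show ?l by (auto simp: restr_def fun_eq_iff)
  qed
  then show ?thesis by auto
qed

text \<open>The kernel of the coboundary consists of the functions constant on 4-components: one
  free bit for each component.\<close>

lemma card_d0_kernel:
  assumes "finite P"
  shows "card {\<phi> \<in> chains P. \<forall>(p, q)\<in>adj4 P. \<phi> p = \<phi> q} = 2 ^ card (P // (adj4 P)\<^sup>*)"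
proof -
  let ?r = "(adj4 P)\<^sup>*"
  let ?K = "{\<phi> \<in> chains P. \<forall>(p, q)\<in>adj4 P. \<phi> p = \<phi> q}"
  have const: "\<phi> p = \<phi> q" if "\<phi> \<in> ?K" "(p, q) \<in> ?r" for \<phi> p q
    using that(2) by (induction rule: rtrancl_induct) (use that(1) in auto)
  have cls: "?r `` {p} = ?r `` {q}" if "(p, q) \<in> ?r" for p q
    using that adj4_class_eq by blast
  have some: "(p, SOME q. q \<in> ?r `` {p}) \<in> ?r" for p
    using someI[of "\<lambda>q. q \<in> ?r `` {p}" p] by auto
  have inP: "p \<in> P" if "C \<in> P // ?r" "p \<in> C" for C p
  proof -
    obtain x where "x \<in> P" "C = ?r `` {x}" using \<open>C \<in> P // ?r\<close> by (rule quotientE)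
    then show ?thesis using adj4_rtrancl_mem[of x p P] \<open>p \<in> C\<close> by blast
  qed
  have bij: "bij_betw (\<lambda>f p. if p \<in> P then f (?r `` {p}) else 0) (chains (P // ?r)) ?K"
  proof (rule bij_betwI[where g = "\<lambda>\<phi>. restr (P // ?r) (\<lambda>C. \<phi> (SOME q. q \<in> C))"])
    show "(\<lambda>f p. if p \<in> P then f (?r `` {p}) else 0) \<in> chains (P // ?r) \<rightarrow> ?K"
    proof
      fix f :: "pix set \<Rightarrow> bit"
      have "?r `` {p} = ?r `` {q}" if "(p, q) \<in> adj4 P" for p q using cls that by blast
      then show "(\<lambda>p. if p \<in> P then f (?r `` {p}) else 0) \<in> ?K"
        by (auto simp: chains_def adj4_def)
    qed
    show "(\<lambda>\<phi>. restr (P // ?r) (\<lambda>C. \<phi> (SOME q. q \<in> C))) \<in> ?K \<rightarrow> chains (P // ?r)" by auto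
    show "restr (P // ?r) (\<lambda>C. if (SOME q. q \<in> C) \<in> P then f (?r `` {SOME q. q \<in> C}) else 0) = f"
      if f: "f \<in> chains (P // ?r)" for f
    proof
      fix C
      show "restr (P // ?r) (\<lambda>C. if (SOME q. q \<in> C) \<in> P then f (?r `` {SOME q. q \<in> C}) else 0) C = f C"
      proof (cases "C \<in> P // ?r")
        case True
        then obtain p where p: "p \<in> P" "C = ?r `` {p}" by (auto simp: quotient_def)
        have "(SOME q. q \<in> C) \<in> C" using some[of p] p by auto
        then have "(SOME q. q \<in> C) \<in> P" using inP True by blast
        moreover have "?r `` {SOME q. q \<in> C} = C" using cls[OF some[of p]] unfolding p(2) by (rule sym)
        ultimately show ?thesis using True by (simp add: restr_def)
      qed (use f in \<open>auto simp: restr_def chains_def\<close>)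
    qed
    show "(\<lambda>p. if p \<in> P then restr (P // ?r) (\<lambda>C. \<phi> (SOME q. q \<in> C)) (?r `` {p}) else 0) = \<phi>"
      if \<phi>: "\<phi> \<in> ?K" for \<phi>
    proof
      fix p
      show "(if p \<in> P then restr (P // ?r) (\<lambda>C. \<phi> (SOME q. q \<in> C)) (?r `` {p}) else 0) = \<phi> p"
      proof (cases "p \<in> P")
        case True
        then have "?r `` {p} \<in> P // ?r" by (rule quotientI)
        then show ?thesis using True const[OF \<phi> some[of p]] by (simp add: restr_def)
      next
        case False
        then show ?thesis using \<phi> by (auto simp: chains_def simp del: split_paired_All)
      qed
    qed
  qed
  have "finite (P // ?r)" using assms unfolding quotient_def by blast
  then show ?thesis using bij_betw_same_card[OF bij] card_chains[of "P // ?r"] by (simp only:)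
qed

lemma card_exact_cochains:
  assumes "finite P"
  shows "2 ^ card P = card (exact_cochains P) * 2 ^ card (P // (adj4 P)\<^sup>*)"
proof -
  have "card (chains P) = card ((\<lambda>\<phi>. restr (edges P) (d0 \<phi>)) ` chains P) *
      card {\<phi> \<in> chains P. restr (edges P) (d0 \<phi>) = 0}"
    by (rule card_additive_image)
      (use assms finite_chains chains_diff in \<open>auto simp only: d0_diff restr_diff\<close>)
  then show ?thesis
    unfolding d0_kernel card_d0_kernel[OF assms] card_chains[OF assms] exact_cochains_def .
qed

lemma d1_restr_edges: "s \<in> squares P \<Longrightarrow> d1 (restr (edges P) w) s = d1 w s"
  by (auto simp: squares_def d1_def restr_def moves_comm)

text \<open>By \<open>ray\<close> the coboundary maps onto all functions on the squares of P; the
  closed cochains are its kernel.\<close>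

lemma card_closed_cochains:
  assumes "finite P"
  shows "2 ^ card (edges P) = 2 ^ card (squares P) * card (closed_cochains P)"
proof -
  have "card (chains (edges P)) = card ((\<lambda>w. restr (squares P) (d1 w)) ` chains (edges P)) *
      card {w \<in> chains (edges P). restr (squares P) (d1 w) = 0}"
    by (rule card_additive_image)
      (use assms finite_chains finite_edges chains_diff in \<open>auto simp only: d1_diff restr_diff\<close>)
  moreover have "(\<lambda>w. restr (squares P) (d1 w)) ` chains (edges P) = chains (squares P)"
  proof
    show "chains (squares P) \<subseteq> (\<lambda>w. restr (squares P) (d1 w)) ` chains (edges P)"
    proof
      fix f assume f: "f \<in> chains (squares P)"
      let ?w = "restr (edges P) (ray (squares P) f)"
      have "restr (squares P) (d1 ?w) = f"
      proof
        fix s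
        show "restr (squares P) (d1 ?w) s = f s"
          using f d1_restr_edges[of s P] d1_ray[OF finite_squares[OF assms] f]
          by (cases "s \<in> squares P") (auto simp: restr_def chains_def simp del: split_paired_All)
      qed
      then show "f \<in> (\<lambda>w. restr (squares P) (d1 w)) ` chains (edges P)" using restr_in_chains by (metis imageI)
    qed
  qed auto
  ultimately show ?thesis
    using assms by (simp add: card_chains finite_edges finite_squares closed_cochains_def)
qed

text \<open>A closed cochain pairs with a hole by summing the coboundary of its extension by zero over the
  squares touching the hole.  The cochains pairing to zero with every hole are the exact ones.\<close>

lemma card_closed_cochains_holes:
  assumes "finite P"
  shows "card (closed_cochains P) = 2 ^ card (holes P) * card (exact_cochains P)"
proof -
  define \<tau> where "\<tau> w = restr (holes P) (\<lambda>B. \<Sum>s\<in>touching B. d1 w s)" for w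
  have \<tau>_diff: "\<tau> (w - v) = \<tau> w - \<tau> v" for w v
    unfolding \<tau>_def d1_diff by (auto simp: fun_eq_iff restr_def sum.distrib)
  have fin: "finite (closed_cochains P)"
    using finite_chains[OF finite_edges[OF assms]] by (auto simp: closed_cochains_def intro: finite_subset)
  have c: "card (closed_cochains P) = card (\<tau> ` closed_cochains P) * card {w \<in> closed_cochains P. \<tau> w = 0}"
    by (rule card_additive_image) (use fin closed_cochains_diff \<tau>_diff in auto)
  \<comment> \<open>The pairing with a hole does not see values on missing edges, so it is well
    defined on cochains of P.\<close>
  have off: "(\<Sum>s\<in>touching B. d1 (restr (edges P) w) s) = (\<Sum>s\<in>touching B. d1 w s)" if "B \<in> holes P" for B w
  proof -
    have "(\<Sum>s\<in>touching B. d1 (restr (edges P) w - w) s) = 0"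
      by (rule sum_d1_hole[OF that]) (auto simp: restr_def)
    then show ?thesis unfolding d1_diff by (simp add: sum.distrib bit_eq_if_add_eq_0)
  qed
  have "\<tau> ` closed_cochains P = chains (holes P)"
  proof
    show "chains (holes P) \<subseteq> \<tau> ` closed_cochains P"
    proof
      fix f assume f: "f \<in> chains (holes P)"
      \<comment> \<open>One grid point from each hole. The square with this lower left corner is not
        a square of P and touches this hole only, so a mass placed on it changes a single
        pairing.\<close>
      define b where "b B = (SOME x. x \<in> B)" for B :: "pix set"
      have ne: "B \<noteq> {}" "B \<subseteq> - P" if "B \<in> holes P" for B
      proof -
        have "B \<in> (- P) // (adj8 (- P))\<^sup>*" using that by (simp add: holes_def)
        then obtain x where x: "x \<in> - P" "B = (adj8 (- P))\<^sup>* `` {x}" by (rule quotientE)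
        then show "B \<noteq> {}" by auto
        show "B \<subseteq> - P" using x adj8_rtrancl_mem[of x _ "- P"] by blast
      qed
      have b: "b B \<in> B" if "B \<in> holes P" for B
        unfolding b_def using ne[OF that] some_in_eq by blast
      have bi: "b B \<in> touching B' \<longleftrightarrow> B = B'" if B: "B \<in> holes P" "B' \<in> holes P" for B B'
      proof -
        have "b B \<in> touching B' \<longleftrightarrow> b B \<in> B'"
          by (rule touching_class_iff[of B' "- P"]) (use B b ne in \<open>auto simp: holes_def corners_def\<close>)
        also have "\<dots> \<longleftrightarrow> B = B'"
        proof
          assume "b B \<in> B'"
          moreover obtain x where "B = (adj8 (- P))\<^sup>* `` {x}" using B(1) by (auto simp: holes_def elim!: quotientE)
          moreover obtain y where "B' = (adj8 (- P))\<^sup>* `` {y}" using B(2) by (auto simp: holes_def elim!: quotientE)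
          ultimately show "B = B'" using b[OF B(1)] adj8_class_eq by (metis Image_singleton_iff)
        next
          assume "B = B'" then show "b B \<in> B'" using b B by simp
        qed
        finally show ?thesis .
      qed
      have inj: "inj_on b (holes P)" using bi b by (metis inj_onI)
      define c where "c s = (if s \<in> b ` holes P then f (the_inv_into (holes P) b s) else 0)" for s
      have cb: "c (b B) = f B" if "B \<in> holes P" for B
        using that inj by (simp add: c_def the_inv_into_f_f)
      have c: "c \<in> chains (b ` holes P)" by (simp add: c_def chains_def)
      have finb: "finite (b ` holes P)" using finite_holes[OF assms] by simp
      let ?w = "restr (edges P) (ray (b ` holes P) c)"
      have "c s = 0" if "s \<in> squares P" for s
        using that b ne by (force simp: c_def squares_def)
      then have "?w \<in> closed_cochains P"
        using d1_restr_edges[of _ P] d1_ray[OF finb c] by (auto simp: closed_cochains_def restr_def[of "squares P"] fun_eq_iff simp del: split_paired_All)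
      moreover have "\<tau> ?w = f"
      proof
        fix B
        show "\<tau> ?w B = f B"
        proof (cases "B \<in> holes P")
          case True
          have ft: "finite (touching B)" using True finite_touching by (auto simp: holes_def)
          have "(\<Sum>s\<in>touching B. c s) = (\<Sum>s\<in>{b B}. c s)"
          proof (rule sum.mono_neutral_right[OF ft])
            show "{b B} \<subseteq> touching B" using bi True by simp
            show "\<forall>i\<in>touching B - {b B}. c i = 0" using bi True by (auto simp: c_def)
          qed
          then show ?thesis using True off[OF True] d1_ray[OF finb c] cb by (simp add: \<tau>_def restr_def)
        qed (use f in \<open>auto simp: \<tau>_def restr_def chains_def\<close>)
      qed
      ultimately show "f \<in> \<tau> ` closed_cochains P" by blast
    qed
  qed (auto simp: \<tau>_def)
  moreover have "{w \<in> closed_cochains P. \<tau> w = 0} = exact_cochains P"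
  proof
    show "exact_cochains P \<subseteq> {w \<in> closed_cochains P. \<tau> w = 0}"
    proof
      fix w assume "w \<in> exact_cochains P"
      then obtain \<phi> where w: "w = restr (edges P) (d0 \<phi>)" by (auto simp: exact_cochains_def)
      have "w \<in> closed_cochains P"
        using d1_restr_edges[of _ P "d0 \<phi>"] d1_d0[of \<phi>] by (auto simp: w closed_cochains_def restr_def[of "squares P"] fun_eq_iff simp del: split_paired_All)
      moreover have "\<tau> w = 0"
        using off d1_d0[of \<phi>] by (auto simp: w \<tau>_def restr_def[of "holes P"] fun_eq_iff simp del: split_paired_All)
      ultimately show "w \<in> {w \<in> closed_cochains P. \<tau> w = 0}" by simp
    qed
    show "{w \<in> closed_cochains P. \<tau> w = 0} \<subseteq> exact_cochains P"
    proof
      fix w assume "w \<in> {w \<in> closed_cochains P. \<tau> w = 0}"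
      then have w: "w \<in> chains (edges P)" "restr (squares P) (d1 w) = 0" "\<tau> w = 0" by (auto simp: closed_cochains_def)
      have "d1 w \<in> off_bdry P"
      proof (rule off_bdry_criterion[OF assms])
        have "{s. d1 w s \<noteq> 0} \<subseteq> (\<Union>e\<in>edges P. case e of Inl p \<Rightarrow> {p, pixD p} | Inr p \<Rightarrow> {p, pixL p})"
        proof
          fix s assume "s \<in> {s. d1 w s \<noteq> 0}"
          then have "w (Inl s) \<noteq> 0 \<or> w (Inr (pixR s)) \<noteq> 0 \<or> w (Inl (pixU s)) \<noteq> 0 \<or> w (Inr s) \<noteq> 0"
            by (auto simp: d1_def)
          then have "Inl s \<in> edges P \<or> Inr (pixR s) \<in> edges P \<or> Inl (pixU s) \<in> edges P \<or> Inr s \<in> edges P"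
            using w(1) unfolding chains_def by blast
          then show "s \<in> (\<Union>e\<in>edges P. case e of Inl p \<Rightarrow> {p, pixD p} | Inr p \<Rightarrow> {p, pixL p})"
            by - (elim disjE; (rule UN_I, assumption, simp))
        qed
        then show "finite {s. d1 w s \<noteq> 0}"
          by (rule finite_subset) (use finite_edges[OF assms] in \<open>auto split: sum.split\<close>)
        show "d1 w s = 0" if "s \<in> squares P" for s
          using fun_cong[OF w(2), of s] that by (simp add: restr_def)
        show "(\<Sum>s\<in>touching B. d1 w s) = 0" if "B \<in> holes P" for B
          using fun_cong[OF w(3), of B] that by (simp add: \<tau>_def restr_def)
      qed
      \<comment> \<open>Since v vanishes on the edges of P, a potential of the globally closed
        cochain w - v is a potential of w on P.\<close>
      then obtain v where v: "d1 w = d1 v" "\<forall>e\<in>edges P. v e = 0" by (auto simp: off_bdry_def)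
      then have "d1 (w - v) = 0" unfolding d1_diff by (auto simp: fun_eq_iff)
      then obtain \<phi> where \<phi>: "w - v = d0 \<phi>" using d1_zero_imp_exact by blast
      have "restr (edges P) (d0 (restr P \<phi>)) = w"
      proof
        fix e
        show "restr (edges P) (d0 (restr P \<phi>)) e = w e"
        proof (cases "e \<in> edges P")
          case True
          then have "d0 (restr P \<phi>) e = d0 \<phi> e" by (cases e) (auto simp: restr_def)
          also have "\<dots> = w e" using v True by (simp flip: \<phi>)
          finally show ?thesis using True by (simp add: restr_def[of "edges P"])
        qed (use w(1) in \<open>auto simp: restr_def[of "edges P"] chains_def\<close>)
      qed
      then show "w \<in> exact_cochains P" unfolding exact_cochains_def by (metis imageI restr_in_chains)
    qed
  qed
  ultimately show ?thesis using c by (simp add: card_chains finite_holes assms)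
qed

text \<open>With X exact and Z closed cochains, V points, E edges, S squares, c components and h
  holes, the three counts read 2^V = X * 2^c, 2^E = 2^S * Z and Z = 2^h * X. Comparing exponents
  gives c - h = V - E + S.\<close>

theorem euler_formula:
  assumes "finite P"
  shows "int (card (P // (adj4 P)\<^sup>*)) - int (card (holes P)) =
    int (card P) - int (card (edges P)) + int (card (squares P))"
proof -
  let ?x = "card (exact_cochains P)" and ?c = "card (P // (adj4 P)\<^sup>*)"
  have "?x > 0"
    using finite_chains[OF assms] by (auto simp: exact_cochains_def card_gt_0_iff intro: zero_in_chains)
  have "?x * 2 ^ card (edges P) * 2 ^ ?c = 2 ^ card (squares P) * 2 ^ card (holes P) * ?x * (?x * 2 ^ ?c)"
    unfolding card_closed_cochains[OF assms] card_closed_cochains_holes[OF assms] by simp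
  then have "2 ^ card (edges P) * 2 ^ ?c = (2 ^ card (squares P) * 2 ^ card (holes P) * 2 ^ card P :: nat)"
    using \<open>?x > 0\<close> unfolding card_exact_cochains[OF assms, symmetric] by simp
  then have "(2::nat) ^ (card (edges P) + ?c) = 2 ^ (card (squares P) + card (holes P) + card P)"
    by (simp add: power_add)
  then have e: "card (edges P) + ?c = card (squares P) + card (holes P) + card P"
    by (rule power_inject_exp[THEN iffD1, rotated]) simp
  have "int c - int h = int p - int e + int s" if "e + c = s + h + p" for c h p e s :: nat
    using that by linarith
  from this[OF e] show ?thesis .
qed

lemma card_edges:
  assumes "finite P"
  shows "card (edges P) = card {p\<in>P. pixR p \<in> P} + card {p\<in>P. pixU p \<in> P}"
  unfolding edges_def using assms by (subst card_Un_disjoint) (auto simp: card_image)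

text \<open>Each edge is charged to its left or lower end point. By inclusion and exclusion a point
  keeps a surplus only if it is an upper right convex corner. The correction for points with both
  edges, less the squares, counts the q whose right and upper neighbours are present but whose
  opposite corner is not; \<open>no_diag\<close> enters in this step.\<close>

theorem euler_corner_count:
  assumes P: "finite P"
    and no_diag: "\<And>q. pixR q \<in> P \<Longrightarrow> pixU q \<in> P \<Longrightarrow> q \<in> P \<or> pixU (pixR q) \<in> P"
  shows "int (card (P // (adj4 P)\<^sup>*)) - int (card (holes P)) =
    int (card {p\<in>P. pixR p \<notin> P \<and> pixU p \<notin> P}) - int (card {p. p \<notin> P \<and> pixL p \<in> P \<and> pixD p \<in> P})"
proof -
  let ?H = "{p\<in>P. pixR p \<in> P}" and ?V = "{p\<in>P. pixU p \<in> P}"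
  let ?E = "{q. pixR q \<in> P \<and> pixU q \<in> P}"
  have "?E \<subseteq> pixL ` P"
  proof
    fix q assume "q \<in> ?E"
    then have "pixL (pixR q) \<in> pixL ` P" by blast
    then show "q \<in> pixL ` P" by simp
  qed
  then have finE: "finite ?E" using P finite_subset by blast
  let ?A = "{p \<in> ?E. p \<in> P}" and ?B = "{p \<in> ?E. pixU (pixR p) \<in> P}"
  have 1: "int (card {p\<in>P. pixR p \<notin> P \<and> pixU p \<notin> P}) = int (card P) - int (card (?H \<union> ?V))"
  proof -
    have "{p\<in>P. pixR p \<notin> P \<and> pixU p \<notin> P} = P - (?H \<union> ?V)" by auto
    moreover have "card (?H \<union> ?V) \<le> card P" using P by (intro card_mono) auto
    ultimately show ?thesis using P by (simp add: card_Diff_subset)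
  qed
  have 2: "card (?H \<union> ?V) + card ?A = card ?H + card ?V"
  proof -
    have "?H \<inter> ?V = ?A" by auto
    then show ?thesis using card_Un_Int[of ?H ?V] P by simp
  qed
  have 3: "card ?A + card ?B = card ?E + card (squares P)"
  proof -
    have "?A \<union> ?B = ?E" using no_diag by blast
    moreover have "?A \<inter> ?B = squares P" by (auto simp: squares_def)
    moreover have "finite ?A" "finite ?B" using finE finite_subset[of ?A ?E] finite_subset[of ?B ?E] by blast+
    ultimately show ?thesis using card_Un_Int[of ?A ?B] by simp
  qed
  have 4: "card {p. p \<notin> P \<and> pixL p \<in> P \<and> pixD p \<in> P} + card ?B = card ?E"
  proof -
    have "bij_betw (\<lambda>p. pixL (pixD p)) {p. p \<notin> P \<and> pixL p \<in> P \<and> pixD p \<in> P} (?E - ?B)"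
      by (rule bij_betwI[where g = "\<lambda>p. pixU (pixR p)"]) (auto simp: moves)
    then have "card {p. p \<notin> P \<and> pixL p \<in> P \<and> pixD p \<in> P} = card (?E - ?B)" by (rule bij_betw_same_card)
    also have "\<dots> = card ?E - card ?B"
      using finE finite_subset[of ?B ?E] by (intro card_Diff_subset) blast+
    finally have "card {p. p \<notin> P \<and> pixL p \<in> P \<and> pixD p \<in> P} = card ?E - card ?B" .
    moreover have "card ?B \<le> card ?E" by (rule card_mono[OF finE]) blast
    ultimately show ?thesis by linarith
  qed
  have "x = c - int d" if "x = int p - int e + int s" "e = h + v" "c = int p - int u"
    "u + a = h + v" "a + b = q + s" "d + b = q" for x c and p e s h v u a b q d :: nat
    using that by linarith
  from this[OF euler_formula[OF P] card_edges[OF P] 1 2 3 4] show ?thesis .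
qed


section \<open>Components of planar sets and of their grid points\<close>

definition pv :: "pix \<Rightarrow> real^2" where
  "pv d = vector [of_int (fst d), of_int (snd d)]"

lemma pv_nth [simp]: "pv d $ 1 = of_int (fst d)" "pv d $ 2 = of_int (snd d)"
  by (simp_all add: pv_def)

definition gpt :: "real^2 \<Rightarrow> real \<Rightarrow> pix \<Rightarrow> real^2" where
  "gpt z e p = z + e *\<^sub>R pv p"

lemma gpt_nth [simp]: "gpt z e p $ 1 = z$1 + e * of_int (fst p)" "gpt z e p $ 2 = z$2 + e * of_int (snd p)"
  by (simp_all add: gpt_def)

lemma vec2_eq_iff: "x = y \<longleftrightarrow> x$1 = y$1 \<and> x$2 = (y :: real^2)$2"
  by (simp add: vec_eq_iff forall_2)

definition box_at :: "real^2 \<Rightarrow> real \<Rightarrow> (real^2) set" where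
  "box_at x r = {y. \<bar>y$1 - x$1\<bar> \<le> r \<and> \<bar>y$2 - x$2\<bar> \<le> r}"

lemma mem_box_at: "y \<in> box_at x r \<longleftrightarrow> \<bar>y$1 - x$1\<bar> \<le> r \<and> \<bar>y$2 - x$2\<bar> \<le> r"
  by (simp add: box_at_def)

lemma convex_box_at: "convex (box_at x r)"
proof -
  have "box_at x r = cbox (\<chi> i. x$i - r) (\<chi> i. x$i + r)"
    by (auto simp: mem_box_at mem_box_cart forall_2)
  then show ?thesis by simp
qed

lemma bounded_box_at: "bounded (box_at x r)"
proof -
  have "box_at x r = cbox (\<chi> i. x$i - r) (\<chi> i. x$i + r)"
    by (auto simp: mem_box_at mem_box_cart forall_2)
  then show ?thesis by (simp add: bounded_cbox)
qed

text \<open>At scale \<open>e\<close>, near each of its points the set is a thickened subgraph along a coordinate axis.\<close>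

definition tame :: "(real^2) set \<Rightarrow> real \<Rightarrow> bool" where
  "tame X e \<longleftrightarrow> (\<forall>x\<in>X. \<exists>d. \<bar>fst d\<bar> + \<bar>snd d\<bar> = 1 \<and>
     (\<forall>y\<in>X \<inter> box_at x (6 * e). \<forall>t\<in>{0..16 * e}. y + t *\<^sub>R pv d \<in> X) \<and>
     (\<forall>y\<in>box_at x e. y + (4 * e) *\<^sub>R pv d \<in> X) \<and>
     (\<forall>y\<in>box_at x (6 * e). y + (16 * e) *\<^sub>R pv d \<in> X))"

lemma unit_pix_cases:
  fixes d :: pix
  assumes "\<bar>fst d\<bar> + \<bar>snd d\<bar> = 1"
  obtains "d = (1, 0)" | "d = (-1, 0)" | "d = (0, 1)" | "d = (0, -1)"
  using assms by (cases d) (fastforce simp: abs_if split: if_splits)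

lemma unit_pix_le:
  fixes d :: pix
  assumes "\<bar>fst d\<bar> + \<bar>snd d\<bar> = 1"
  shows "\<bar>real_of_int (fst d)\<bar> \<le> 1" "\<bar>real_of_int (snd d)\<bar> \<le> 1"
  using assms by (cases rule: unit_pix_cases; simp)+

definition gset :: "real^2 \<Rightarrow> real \<Rightarrow> (real^2) set \<Rightarrow> pix set" where
  "gset z e X = {p. gpt z e p \<in> X}"

lemma gpt_floor_near:
  assumes "e > 0"
  shows "gpt z e (\<lfloor>(y$1 - z$1) / e\<rfloor>, \<lfloor>(y$2 - z$2) / e\<rfloor>) \<in> box_at y e"
proof -
  have "\<bar>z$i + e * of_int \<lfloor>(y$i - z$i) / e\<rfloor> - y$i\<bar> \<le> e" for i
  proof -
    let ?t = "(y$i - z$i) / e"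
    have "z$i + e * of_int \<lfloor>?t\<rfloor> - y$i = e * (of_int \<lfloor>?t\<rfloor> - ?t)" using assms by (simp add: field_simps)
    also have "\<bar>\<dots>\<bar> = e * \<bar>of_int \<lfloor>?t\<rfloor> - ?t\<bar>" using assms by (simp add: abs_mult)
    also have "\<dots> \<le> e * 1" using assms by (intro mult_left_mono) linarith+
    finally show ?thesis by simp
  qed
  then show ?thesis by (simp add: mem_box_at)
qed

lemma connected_component_subset_I:
  assumes "connected C" "C \<subseteq> X" "x \<in> C" "y \<in> C"
  shows "connected_component X x y"
  using assms by (auto simp: connected_component_def)

lemma connected_component_segment:
  fixes x y :: "real^2"
  assumes "closed_segment x y \<subseteq> X"
  shows "connected_component X x y"
  using assms by (intro connected_component_subset_I[of "closed_segment x y"]) auto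

lemma connected_component_translate:
  fixes x d :: "real^2"
  assumes "\<And>t. 0 \<le> t \<Longrightarrow> t \<le> s \<Longrightarrow> x + t *\<^sub>R d \<in> X" "0 \<le> s"
  shows "connected_component X x (x + s *\<^sub>R d)"
proof (rule connected_component_segment)
  show "closed_segment x (x + s *\<^sub>R d) \<subseteq> X"
  proof
    fix y assume "y \<in> closed_segment x (x + s *\<^sub>R d)"
    then obtain u where u: "0 \<le> u" "u \<le> 1" "y = (1 - u) *\<^sub>R x + u *\<^sub>R (x + s *\<^sub>R d)"
      by (auto simp: closed_segment_def)
    have "y = x + (u * s) *\<^sub>R d" by (simp add: u(3) algebra_simps)
    then show "y \<in> X" using assms u mult_left_le_one_le[of s u] by simp
  qed
qed

text \<open>Moving x by 4 e leads to the centre of a box of radius e inside X, and such a box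
  contains a grid point. Hence the distance 5 e = 4 e + e.\<close>

lemma tame_near_grid:
  assumes T: "tame X e" and e: "e > 0" and x: "x \<in> X"
  shows "\<exists>k\<in>gset z e X. gpt z e k \<in> box_at x (5 * e) \<and> connected_component X x (gpt z e k)"
proof -
  obtain d where d: "\<bar>fst d\<bar> + \<bar>snd d\<bar> = 1"
    and m: "\<And>y t. y \<in> X \<Longrightarrow> y \<in> box_at x (6 * e) \<Longrightarrow> t \<in> {0..16 * e} \<Longrightarrow> y + t *\<^sub>R pv d \<in> X"
    and d1: "\<And>y. y \<in> box_at x e \<Longrightarrow> y + (4 * e) *\<^sub>R pv d \<in> X"
    using T x unfolding tame_def by blast
  obtain k where k: "gpt z e k \<in> box_at (x + (4 * e) *\<^sub>R pv d) e" using gpt_floor_near[OF e] by blast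
  have sub: "box_at (x + (4 * e) *\<^sub>R pv d) e \<subseteq> X"
  proof
    fix y assume y: "y \<in> box_at (x + (4 * e) *\<^sub>R pv d) e"
    then have "y - (4 * e) *\<^sub>R pv d \<in> box_at x e" by (auto simp: mem_box_at algebra_simps)
    from d1[OF this] show "y \<in> X" by simp
  qed
  have "connected_component X x (x + (4 * e) *\<^sub>R pv d)"
    by (rule connected_component_translate) (use m[OF x] e in \<open>auto simp: mem_box_at\<close>)
  moreover have "connected_component X (x + (4 * e) *\<^sub>R pv d) (gpt z e k)"
    by (rule connected_component_subset_I[OF convex_connected[OF convex_box_at] sub _ k]) (use e in \<open>auto simp: mem_box_at\<close>)
  ultimately have "connected_component X x (gpt z e k)" by (rule connected_component_trans)
  moreover have "gpt z e k \<in> box_at x (5 * e)"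
  proof -
    have "\<bar>4 * e * of_int (fst d)\<bar> \<le> 4 * e" "\<bar>4 * e * of_int (snd d)\<bar> \<le> 4 * e"
      using unit_pix_le[OF d] e by (simp_all add: abs_mult mult_left_le)
    then show ?thesis using k by (auto simp: mem_box_at)
  qed
  ultimately show ?thesis using k sub unfolding gset_def by blast
qed

lemma adj4_rectangle:
  assumes "\<And>r. \<lbrakk>min (fst p) (fst q) \<le> fst r; fst r \<le> max (fst p) (fst q);
      min (snd p) (snd q) \<le> snd r; snd r \<le> max (snd p) (snd q)\<rbrakk> \<Longrightarrow> r \<in> N"
  shows "(p, q) \<in> (adj4 N)\<^sup>*"
proof -
  have "((fst p, snd p), (fst q, snd p)) \<in> (adj4 N)\<^sup>*" by (rule adj4_line_h, rule assms) auto
  also have "((fst q, snd p), (fst q, snd q)) \<in> (adj4 N)\<^sup>*" by (rule adj4_line_v, rule assms) auto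
  finally show ?thesis by simp
qed

lemma gpt_shift: "gpt z e (fst p + j * fst d, snd p + j * snd d) = gpt z e p + (e * of_int j) *\<^sub>R pv d"
  by (simp add: vec2_eq_iff algebra_simps)

text \<open>Both points are pushed by 16 mesh steps, which stays on the grid because the direction
  is a coordinate axis and 16 e is a multiple of the mesh. After the push, the whole rectangle
  spanned by them lies in X.\<close>

lemma tame_grid_connected:
  assumes T: "tame X e" and e: "e > 0" and x: "x \<in> X"
    and k: "k \<in> gset z e X" "gpt z e k \<in> box_at x (6 * e)"
    and l: "l \<in> gset z e X" "gpt z e l \<in> box_at x (6 * e)"
  shows "(k, l) \<in> (adj4 (gset z e X))\<^sup>*"
proof -
  let ?P = "gset z e X"
  obtain d where d: "\<bar>fst d\<bar> + \<bar>snd d\<bar> = 1"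
    and m: "\<And>y t. y \<in> X \<Longrightarrow> y \<in> box_at x (6 * e) \<Longrightarrow> t \<in> {0..16 * e} \<Longrightarrow> y + t *\<^sub>R pv d \<in> X"
    and d2: "\<And>y. y \<in> box_at x (6 * e) \<Longrightarrow> y + (16 * e) *\<^sub>R pv d \<in> X"
    using T x unfolding tame_def by blast
  define sh where "sh p j = (fst p + j * fst d, snd p + j * snd d)" for p :: pix and j :: int
  have gsh: "gpt z e (sh p j) = gpt z e p + (e * of_int j) *\<^sub>R pv d" for p j
    unfolding sh_def by (rule gpt_shift)
  have line: "(p, sh p 16) \<in> (adj4 ?P)\<^sup>*" if p: "p \<in> ?P" "gpt z e p \<in> box_at x (6 * e)" for p
  proof -
    have "(p, sh p (int j)) \<in> (adj4 ?P)\<^sup>*" if "j \<le> 16" for j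
      using that
    proof (induction j)
      case 0 then show ?case by (simp add: sh_def)
    next
      case (Suc j)
      have mem: "sh p (int i) \<in> ?P" if "i \<le> 16" for i
      proof -
        have "gpt z e p + (e * real i) *\<^sub>R pv d \<in> X"
          by (rule m) (use p that e in \<open>auto simp: gset_def mult.commute\<close>)
        then show ?thesis using gsh[of p "int i"] by (simp add: gset_def)
      qed
      have "(sh p (int j), sh p (int (Suc j))) \<in> adj4 ?P"
        using mem[of j] mem[of "Suc j"] Suc.prems d by (auto simp: adj4_def sh_def algebra_simps)
      then show ?case using Suc by (meson Suc_leD rtrancl_into_rtrancl)
    qed
    from this[of 16] show ?thesis by simp
  qed
  have "(sh k 16, sh l 16) \<in> (adj4 ?P)\<^sup>*"
  proof (rule adj4_rectangle)
    fix r assume r: "min (fst (sh k 16)) (fst (sh l 16)) \<le> fst r" "fst r \<le> max (fst (sh k 16)) (fst (sh l 16))"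
      "min (snd (sh k 16)) (snd (sh l 16)) \<le> snd r" "snd r \<le> max (snd (sh k 16)) (snd (sh l 16))"
    define r' where "r' = sh r (-16)"
    have r'b: "min (fst k) (fst l) \<le> fst r'" "fst r' \<le> max (fst k) (fst l)"
      "min (snd k) (snd l) \<le> snd r'" "snd r' \<le> max (snd k) (snd l)"
      using r by (auto simp: r'_def sh_def)
    have mono: "e * of_int a \<le> e * of_int b" if "a \<le> b" for a b :: int
      using that e by (intro mult_left_mono) auto
    have "gpt z e r' \<in> box_at x (6 * e)"
    proof -
      have "min (e * of_int (fst k)) (e * of_int (fst l)) \<le> e * of_int (fst r')"
        "e * of_int (fst r') \<le> max (e * of_int (fst k)) (e * of_int (fst l))"
        "min (e * of_int (snd k)) (e * of_int (snd l)) \<le> e * of_int (snd r')"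
        "e * of_int (snd r') \<le> max (e * of_int (snd k)) (e * of_int (snd l))"
        using r'b mono unfolding min_le_iff_disj le_max_iff_disj by blast+
      moreover have "\<bar>w + c - y\<bar> \<le> s" if "min a b \<le> c" "c \<le> max a b" "\<bar>w + a - y\<bar> \<le> s" "\<bar>w + b - y\<bar> \<le> s"
        for a b c w y s :: real
        using that by linarith
      ultimately show ?thesis using k(2) l(2) unfolding mem_box_at gpt_nth by blast
    qed
    from d2[OF this] have "gpt z e (sh r' 16) \<in> X" using gsh[of r' 16] by (simp add: mult.commute)
    moreover have "sh r' 16 = r" by (simp add: r'_def sh_def)
    ultimately show "r \<in> ?P" by (simp add: gset_def)
  qed
  from rtrancl_trans[OF line[OF k] rtrancl_trans[OF this adj4_rtrancl_sym[OF line[OF l]]]] show ?thesis .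
qed

text \<open>The continuous counterpart of \<open>tame_grid_connected\<close>: after the push by 16 e
  even the segment between the two points lies in X.\<close>

lemma tame_adj8_connected:
  assumes T: "tame X e" and e: "e > 0" and kl: "(k, l) \<in> adj8 (gset z e X)"
  shows "connected_component X (gpt z e k) (gpt z e l)"
proof -
  have k: "gpt z e k \<in> X" and l: "gpt z e l \<in> X" using kl by (auto simp: adj8_def gset_def)
  obtain d where m: "\<And>y t. y \<in> X \<Longrightarrow> y \<in> box_at (gpt z e k) (6 * e) \<Longrightarrow> t \<in> {0..16 * e} \<Longrightarrow> y + t *\<^sub>R pv d \<in> X"
    and d2: "\<And>y. y \<in> box_at (gpt z e k) (6 * e) \<Longrightarrow> y + (16 * e) *\<^sub>R pv d \<in> X"
    using T k unfolding tame_def by blast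
  have lb: "gpt z e l \<in> box_at (gpt z e k) e"
  proof -
    have "\<bar>e * of_int a - e * of_int b\<bar> \<le> e" if "\<bar>b - a\<bar> \<le> 1" for a b :: int
    proof -
      have "\<bar>e * of_int a - e * of_int b\<bar> = e * of_int \<bar>b - a\<bar>"
        using e by (simp flip: right_diff_distrib add: abs_mult abs_minus_commute)
      also have "\<dots> \<le> e * 1" using that e by (intro mult_left_mono) auto
      finally show ?thesis by simp
    qed
    then show ?thesis using kl by (auto simp: adj8_def mem_box_at)
  qed
  then have lb6: "gpt z e l \<in> box_at (gpt z e k) (6 * e)" using e by (auto simp: mem_box_at)
  have kb6: "gpt z e k \<in> box_at (gpt z e k) (6 * e)" using e by (auto simp: mem_box_at)
  let ?s = "(16 * e) *\<^sub>R pv d"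
  have 1: "connected_component X (gpt z e k) (gpt z e k + ?s)"
    by (rule connected_component_translate) (use m[OF k kb6] e in auto)
  have 2: "connected_component X (gpt z e l) (gpt z e l + ?s)"
    by (rule connected_component_translate) (use m[OF l lb6] e in auto)
  have "closed_segment (gpt z e k + ?s) (gpt z e l + ?s) \<subseteq> X"
  proof
    fix y assume "y \<in> closed_segment (gpt z e k + ?s) (gpt z e l + ?s)"
    then have "y - ?s \<in> closed_segment (gpt z e k) (gpt z e l)"
      using closed_segment_translation_eq[of ?s "y - ?s" "gpt z e k" "gpt z e l"] by (simp add: add.commute)
    moreover have "closed_segment (gpt z e k) (gpt z e l) \<subseteq> box_at (gpt z e k) (6 * e)"
      using kb6 lb6 convex_box_at by (rule closed_segment_subset)
    ultimately show "y \<in> X" using d2 by force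
  qed
  then have 3: "connected_component X (gpt z e k + ?s) (gpt z e l + ?s)" by (rule connected_component_segment)
  show ?thesis
    by (rule connected_component_trans[OF 1 connected_component_trans[OF 3 connected_component_sym[OF 2]]])
qed

text \<open>4-paths and 8-paths of samples detect the same connectivity, so the components of a set
  may be sampled with \<open>adj4\<close> and those of its complement with \<open>adj8\<close>, as
  \<open>euler_formula\<close> requires.\<close>

lemma tame_grid_connected_iff:
  assumes T: "tame X e" and e: "e > 0" and r: "adj4 (gset z e X) \<subseteq> r" "r \<subseteq> adj8 (gset z e X)"
    and k: "k \<in> gset z e X" and l: "l \<in> gset z e X"
  shows "connected_component X (gpt z e k) (gpt z e l) \<longleftrightarrow> (k, l) \<in> r\<^sup>*"
proof
  assume "(k, l) \<in> r\<^sup>*"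
  then show "connected_component X (gpt z e k) (gpt z e l)"
  proof (induction rule: rtrancl_induct)
    case base then show ?case using k by (simp add: gset_def)
  next
    case (step p q)
    then show ?case using tame_adj8_connected[OF T e, of p q z] r(2) connected_component_trans by blast
  qed
next
  let ?P = "gset z e X"
  assume "connected_component X (gpt z e k) (gpt z e l)"
  then obtain S where S: "connected S" "S \<subseteq> X" "gpt z e k \<in> S" "gpt z e l \<in> S"
    by (auto simp: connected_component_def)
  define near where "near x p \<longleftrightarrow> p \<in> ?P \<and> gpt z e p \<in> box_at x (6 * e)" for x p
  \<comment> \<open>Transitivity rests on \<open>near\<close>: all samples around one point of X are
    4-connected. By connectedness of S it then suffices to relate each point to those close
    by.\<close>
  define rel where "rel x y \<longleftrightarrow> (\<exists>p q. near x p \<and> near y q \<and> (p, q) \<in> (adj4 ?P)\<^sup>*)" for x y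
  have near: "(p, q) \<in> (adj4 ?P)\<^sup>*" if "near x p" "near x q" "x \<in> X" for x p q
    using tame_grid_connected[OF T e that(3)] that unfolding near_def by blast
  have "rel (gpt z e k) (gpt z e l)"
  proof (rule connected_equivalence_relation[OF S(1,3,4)])
    show "rel y x" if "rel x y" for x y using that adj4_rtrancl_sym unfolding rel_def by blast
    show "rel x w" if h: "rel x y" "rel y w" "y \<in> S" for x y w
    proof -
      obtain p q p' q' where *: "near x p" "near y q" "(p, q) \<in> (adj4 ?P)\<^sup>*"
        "near y p'" "near w q'" "(p', q') \<in> (adj4 ?P)\<^sup>*"
        using h(1,2) unfolding rel_def by blast
      have "(q, p') \<in> (adj4 ?P)\<^sup>*" using near[OF *(2,4)] h(3) S(2) by blast
      from rtrancl_trans[OF *(3) rtrancl_trans[OF this *(6)]] show ?thesis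
        using *(1,5) unfolding rel_def by blast
    qed
    fix a assume a: "a \<in> S"
    \<comment> \<open>A sample within 5 e of y is within 6 e of a, which explains the radius 6 e in
      \<open>tame\<close>.\<close>
    have "rel a y" if y: "y \<in> S \<inter> ball a e" for y
    proof -
      obtain p where p: "p \<in> ?P" "gpt z e p \<in> box_at y (5 * e)"
        using tame_near_grid[OF T e] y S(2) by blast
      have "\<bar>y$i - a$i\<bar> \<le> e" for i
        using component_le_norm_cart[of "y - a" i] y by (auto simp: dist_norm norm_minus_commute)
      from this[of 1] this[of 2] have "near a p" "near y p"
        using p e by (auto simp: near_def mem_box_at)
      then show ?thesis unfolding rel_def by blast
    qed
    then show "\<exists>T. openin (top_of_set S) T \<and> a \<in> T \<and> (\<forall>x\<in>T. rel a x)"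
      using a e by (intro exI[of _ "S \<inter> ball a e"]) auto
  qed
  then obtain p q where pq: "near (gpt z e k) p" "near (gpt z e l) q" "(p, q) \<in> (adj4 ?P)\<^sup>*" by (auto simp: rel_def)
  have "near (gpt z e k) k" "near (gpt z e l) l" using k l e by (auto simp: near_def mem_box_at)
  then have "(k, p) \<in> (adj4 ?P)\<^sup>*" "(q, l) \<in> (adj4 ?P)\<^sup>*"
    using near pq k l by (auto simp: gset_def)
  from rtrancl_trans[OF this(1) rtrancl_trans[OF pq(3) this(2)]] have "(k, l) \<in> (adj4 ?P)\<^sup>*" .
  then show "(k, l) \<in> r\<^sup>*" using rtrancl_mono[OF r(1)] by blast
qed

lemma finite_grid_bounded:
  assumes "bounded S" "e > 0"
  shows "finite {p. gpt z e p \<in> S}"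
proof -
  obtain B where B: "\<And>x. x \<in> S \<Longrightarrow> norm x \<le> B" using assms(1) by (auto simp: bounded_iff)
  let ?n = "\<lceil>(B + norm z) / e\<rceil>"
  have "{p. gpt z e p \<in> S} \<subseteq> {p. \<bar>fst p\<bar> \<le> ?n \<and> \<bar>snd p\<bar> \<le> ?n}"
  proof
    fix p assume "p \<in> {p. gpt z e p \<in> S}"
    then have n: "norm (gpt z e p) \<le> B" using B by simp
    have *: "\<bar>k\<bar> \<le> ?n" if k: "\<bar>z$i + e * of_int k\<bar> \<le> norm (gpt z e p)" for k :: int and i
    proof -
      have "e * \<bar>of_int k\<bar> = \<bar>e * of_int k\<bar>" using assms(2) by (simp add: abs_mult)
      also have "\<dots> \<le> B + norm z" using k n component_le_norm_cart[of z i] by linarith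
      finally have "\<bar>of_int k\<bar> \<le> (B + norm z) / e" using assms(2) by (simp add: field_simps)
      then have "of_int \<bar>k\<bar> \<le> (B + norm z) / e" by simp
      then show ?thesis by linarith
    qed
    show "p \<in> {p. \<bar>fst p\<bar> \<le> ?n \<and> \<bar>snd p\<bar> \<le> ?n}"
      using *[of 1 "fst p"] *[of 2 "snd p"] component_le_norm_cart[of "gpt z e p" 1] component_le_norm_cart[of "gpt z e p" 2] by simp
  qed
  then show ?thesis using finite_box finite_subset by blast
qed

lemma tame_components_bij:
  assumes T: "tame X e" and e: "e > 0" and r: "adj4 (gset z e X) \<subseteq> r" "r \<subseteq> adj8 (gset z e X)" "sym r"
  defines "h \<equiv> \<lambda>C. {p. gpt z e p \<in> C}"
  shows "bij_betw h (components X) (gset z e X // r\<^sup>*)"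
    and "C \<in> components X \<Longrightarrow> finite (h C) \<longleftrightarrow> bounded C"
proof -
  let ?P = "gset z e X"
  have mem: "q \<in> ?P" if "(p, q) \<in> r\<^sup>*" "p \<in> ?P" for p q
    using that r(2) by (induction rule: rtrancl_induct) (auto simp: adj8_def)
  note iff = tame_grid_connected_iff[OF T e r(1,2)]
  have cls: "h (connected_component_set X (gpt z e k)) = r\<^sup>* `` {k}" if "k \<in> ?P" for k
  proof (rule set_eqI)
    fix p
    show "p \<in> h (connected_component_set X (gpt z e k)) \<longleftrightarrow> p \<in> r\<^sup>* `` {k}"
    proof (cases "p \<in> ?P")
      case True
      then show ?thesis using iff[OF that True] by (simp add: h_def)
    next
      case False
      then show ?thesis
        using mem[OF _ that, of p] connected_component_in[of X "gpt z e k" "gpt z e p"] unfolding h_def gset_def by blast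
    qed
  qed
  have rep: "\<exists>k\<in>?P. C = connected_component_set X (gpt z e k)" if C: "C \<in> components X" for C
  proof -
    obtain x where x: "x \<in> X" "C = connected_component_set X x" using C by (auto simp: components_def)
    obtain k where "k \<in> ?P" "connected_component X x (gpt z e k)" using tame_near_grid[OF T e x(1)] by blast
    then show ?thesis using x(2) connected_component_eq by (metis mem_Collect_eq)
  qed
  show "bij_betw h (components X) (?P // r\<^sup>*)"
    unfolding bij_betw_def
  proof
    show "inj_on h (components X)"
    proof (rule inj_onI)
      fix C C' assume C: "C \<in> components X" "C' \<in> components X" "h C = h C'"
      obtain k where k: "k \<in> ?P" "C = connected_component_set X (gpt z e k)" using rep C by blast
      then have "gpt z e k \<in> C" by (auto simp: gset_def)
      moreover from this have "gpt z e k \<in> C'" using C(3) by (auto simp: h_def)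
      ultimately show "C = C'" using components_nonoverlap[OF C(1,2)] by blast
    qed
    show "h ` components X = ?P // r\<^sup>*"
    proof
      show "h ` components X \<subseteq> ?P // r\<^sup>*"
      proof
        fix B assume "B \<in> h ` components X"
        then obtain C where C: "C \<in> components X" "B = h C" by blast
        obtain k where k: "k \<in> ?P" "C = connected_component_set X (gpt z e k)" using rep[OF C(1)] by blast
        show "B \<in> ?P // r\<^sup>*" unfolding C(2) k(2) cls[OF k(1)] by (rule quotientI[OF k(1)])
      qed
      show "?P // r\<^sup>* \<subseteq> h ` components X"
      proof
        fix B assume "B \<in> ?P // r\<^sup>*"
        then obtain k where k: "k \<in> ?P" "B = r\<^sup>* `` {k}" by (rule quotientE)
        then show "B \<in> h ` components X"
          using cls[OF k(1)] by (auto simp: gset_def intro!: image_eqI[of _ _ "connected_component_set X (gpt z e k)"] componentsI)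
      qed
    qed
  qed
  assume C: "C \<in> components X"
  show "finite (h C) \<longleftrightarrow> bounded C"
  proof
    assume "bounded C" then show "finite (h C)" unfolding h_def by (rule finite_grid_bounded[OF _ e])
  next
    assume fin: "finite (h C)"
    \<comment> \<open>Each point of C lies within 5 e of a sample in its own component, so finitely
      many samples confine C.\<close>
    have "C \<subseteq> (\<Union>k\<in>h C. box_at (gpt z e k) (5 * e))"
    proof
      fix x assume x: "x \<in> C"
      then have "x \<in> X" using C in_components_subset by blast
      then obtain k where k: "gpt z e k \<in> box_at x (5 * e)" "connected_component X x (gpt z e k)"
        using tame_near_grid[OF T e] by blast
      have "C = connected_component_set X x"
        using C x by (metis components_iff connected_component_eq)
      then have "k \<in> h C" using k(2) by (simp add: h_def)
      moreover have "x \<in> box_at (gpt z e k) (5 * e)" using k(1) by (auto simp: mem_box_at)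
      ultimately show "x \<in> (\<Union>k\<in>h C. box_at (gpt z e k) (5 * e))" by blast
    qed
    moreover have "bounded (\<Union>k\<in>h C. box_at (gpt z e k) (5 * e))" using fin bounded_box_at by blast
    ultimately show "bounded C" by (rule bounded_subset[rotated])
  qed
qed

text \<open>One mesh step along the axis d, applied to both points of an antidiagonal contact,
  carries one of them onto a remaining corner of the square.\<close>

lemma tame_no_diagonal:
  assumes T: "tame X e" and e: "e > 0" and q: "pixR q \<in> gset z e X" "pixU q \<in> gset z e X"
  shows "q \<in> gset z e X \<or> pixU (pixR q) \<in> gset z e X"
proof -
  let ?x = "gpt z e (pixR q)" and ?y = "gpt z e (pixU q)"
  obtain d where d: "\<bar>fst d\<bar> + \<bar>snd d\<bar> = 1"
    and m: "\<And>y t. y \<in> X \<Longrightarrow> y \<in> box_at ?x (6 * e) \<Longrightarrow> t \<in> {0..16 * e} \<Longrightarrow> y + t *\<^sub>R pv d \<in> X"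
    using T q(1) unfolding tame_def gset_def by blast
  have xy: "?x \<in> X" "?y \<in> X" using q by (auto simp: gset_def)
  have "?x \<in> box_at ?x (6 * e)" "?y \<in> box_at ?x (6 * e)" using e by (auto simp: mem_box_at moves algebra_simps)
  then have "?x + e *\<^sub>R pv d \<in> X" "?y + e *\<^sub>R pv d \<in> X" using m xy e by auto
  then have "(fst (pixR q) + 1 * fst d, snd (pixR q) + 1 * snd d) \<in> gset z e X"
    "(fst (pixU q) + 1 * fst d, snd (pixU q) + 1 * snd d) \<in> gset z e X"
    unfolding gset_def mem_Collect_eq gpt_shift by simp_all
  with d show ?thesis by (cases rule: unit_pix_cases) (auto simp: moves)
qed

theorem euler_char_grid:
  assumes A: "tame A e" "tame (- A) e" "bounded A" and e: "e > 0"
  shows "euler_char A = int (card {p \<in> gset z e A. pixR p \<notin> gset z e A \<and> pixU p \<notin> gset z e A})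
    - int (card {p. p \<notin> gset z e A \<and> pixL p \<in> gset z e A \<and> pixD p \<in> gset z e A})"
proof -
  let ?P = "gset z e A"
  have fin: "finite ?P" unfolding gset_def by (rule finite_grid_bounded[OF A(3) e])
  have neg: "gset z e (- A) = - ?P" by (auto simp: gset_def)
  have "{C \<in> components A. bounded C} = components A"
    using A(3) in_components_subset bounded_subset by blast
  moreover have "card (components A) = card (?P // (adj4 ?P)\<^sup>*)"
    using tame_components_bij(1)[OF A(1) e subset_refl adj4_subset_adj8 sym_adj4] by (rule bij_betw_same_card)
  ultimately have 1: "card {C \<in> components A. bounded C} = card (?P // (adj4 ?P)\<^sup>*)" by simp
  note b = tame_components_bij[where z = z, OF A(2) e adj4_subset_adj8 subset_refl sym_adj8]
  let ?h = "\<lambda>C. {p. gpt z e p \<in> C}"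
  have "bij_betw ?h {C \<in> components (- A). bounded C} (holes ?P)"
  proof (rule bij_betw_subset[OF b(1)])
    show "{C \<in> components (- A). bounded C} \<subseteq> components (- A)" by blast
    have "?h ` components (- A) = (- ?P) // (adj8 (- ?P))\<^sup>*"
      using b(1) unfolding neg by (simp add: bij_betw_def)
    then have "holes ?P = {B \<in> ?h ` components (- A). finite B}" by (simp add: holes_def)
    also have "\<dots> = ?h ` {C \<in> components (- A). bounded C}" using b(2) by blast
    finally show "?h ` {C \<in> components (- A). bounded C} = holes ?P" by (rule sym)
  qed
  then have 2: "card {C \<in> components (- A). bounded C} = card (holes ?P)" by (rule bij_betw_same_card)
  show ?thesis
    unfolding euler_char_def 1 2 by (rule euler_corner_count[OF fin tame_no_diagonal[OF A(1) e]])
qed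


section \<open>Excursion sets sampled on a fine grid\<close>

lemma vec2_decomp: "(v :: real^2) = v$1 *\<^sub>R axis 1 1 + v$2 *\<^sub>R axis 2 1"
  by (simp add: vec2_eq_iff axis_def)

lemma has_derivative_partials:
  assumes "g differentiable (at x)"
  shows "(g has_derivative (\<lambda>v. v$1 * partial_deriv 1 g x + v$2 * partial_deriv 2 g x)) (at x)"
proof -
  let ?f = "frechet_derivative g (at x)"
  have d: "(g has_derivative ?f) (at x)" using assms frechet_derivative_works by blast
  then interpret linear ?f by (rule has_derivative_linear)
  have "?f v = v$1 * partial_deriv 1 g x + v$2 * partial_deriv 2 g x" for v
    by (subst vec2_decomp) (simp add: add scale partial_deriv_def)
  then have "?f = (\<lambda>v. v$1 * partial_deriv 1 g x + v$2 * partial_deriv 2 g x)" by blast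
  then show ?thesis using d by simp
qed

lemma line_has_real_derivative:
  fixes g :: "real^2 \<Rightarrow> real"
  assumes "g differentiable (at (x + t *\<^sub>R v))"
  shows "((\<lambda>t. g (x + t *\<^sub>R v)) has_real_derivative
    v$1 * partial_deriv 1 g (x + t *\<^sub>R v) + v$2 * partial_deriv 2 g (x + t *\<^sub>R v)) (at t)"
proof -
  have "((\<lambda>t. x + t *\<^sub>R v) has_derivative (\<lambda>t. t *\<^sub>R v)) (at t)"
    by (auto intro!: derivative_eq_intros)
  from diff_chain_at[OF this has_derivative_partials[OF assms]]
  have "((\<lambda>t. g (x + t *\<^sub>R v)) has_derivative
      (\<lambda>s. (s *\<^sub>R v)$1 * partial_deriv 1 g (x + t *\<^sub>R v) + (s *\<^sub>R v)$2 * partial_deriv 2 g (x + t *\<^sub>R v))) (at t)"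
    by (simp add: o_def)
  then show ?thesis
    by (rule has_derivative_imp_has_field_derivative) (simp add: algebra_simps)
qed

lemma axis_line_has_real_derivative:
  fixes g :: "real^2 \<Rightarrow> real"
  assumes "g differentiable (at (x + t *\<^sub>R axis i 1))"
  shows "((\<lambda>t. g (x + t *\<^sub>R axis i 1)) has_real_derivative partial_deriv i g (x + t *\<^sub>R axis i 1)) (at t)"
  using line_has_real_derivative[OF assms] exhaust_2[of i] by (auto simp: axis_def)

lemma mean_value_segment:
  fixes g :: "real^2 \<Rightarrow> real"
  assumes "\<And>w. w \<in> closed_segment x y \<Longrightarrow> g differentiable (at w)"
  obtains w where "w \<in> closed_segment x y"
    "g y - g x = (y$1 - x$1) * partial_deriv 1 g w + (y$2 - x$2) * partial_deriv 2 g w"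
proof -
  let ?p = "\<lambda>t. x + t *\<^sub>R (y - x)"
  have seg: "?p t \<in> closed_segment x y" if "0 \<le> t" "t \<le> 1" for t
    using that by (auto simp: closed_segment_def algebra_simps intro!: exI[of _ t])
  have "\<exists>t>0. t < 1 \<and> g (?p 1) - g (?p 0) = (1 - 0) *
      ((y - x)$1 * partial_deriv 1 g (?p t) + (y - x)$2 * partial_deriv 2 g (?p t))"
    by (rule MVT2, simp, rule line_has_real_derivative, rule assms, rule seg)
  then obtain t where t: "0 < t" "t < 1" "g y - g x = (y - x)$1 * partial_deriv 1 g (?p t) + (y - x)$2 * partial_deriv 2 g (?p t)"
    by auto
  show ?thesis using that[OF seg[of t]] t by simp
qed

lemma C1_on_imp:
  assumes "C1_on W g"
  shows "x \<in> W \<Longrightarrow> g differentiable (at x)" "continuous_on W (partial_deriv i g)" "continuous_on W g"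
proof -
  show *: "x \<in> W \<Longrightarrow> g differentiable (at x)" "continuous_on W (partial_deriv i g)" for x
    using assms by (auto simp: C1_on_def)
  show "continuous_on W g"
    using * by (meson continuous_at_imp_continuous_on differentiable_imp_continuous_within)
qed

lemma box_at_subset_cball: "box_at x r \<subseteq> cball x (2 * r)"
proof
  fix y assume "y \<in> box_at x r"
  then have "norm (y - x) \<le> 2 * r"
    using norm_le_l1_cart[of "y - x"] by (auto simp: mem_box_at sum_2)
  then show "y \<in> cball x (2 * r)" by (simp add: dist_norm norm_minus_commute)
qed

text \<open>Along the axis of the larger partial derivative the slope is the maximum norm of the
  gradient. The sign \<sigma> is 1 for excursion sets and -1 for their complements.\<close>

lemma dominant_axis:
  fixes a b \<sigma> :: real
  assumes "\<bar>\<sigma>\<bar> = 1"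
  obtains d :: pix where "\<bar>fst d\<bar> + \<bar>snd d\<bar> = 1"
    "\<sigma> * (of_int (fst d) * a + of_int (snd d) * b) = max \<bar>a\<bar> \<bar>b\<bar>"
proof -
  have s: "\<sigma> = 1 \<or> \<sigma> = -1" using assms by linarith
  define d :: pix where "d = (if \<bar>b\<bar> \<le> \<bar>a\<bar> then (if 0 \<le> \<sigma> * a then 1 else -1, 0) else (0, if 0 \<le> \<sigma> * b then 1 else -1))"
  have "\<bar>fst d\<bar> + \<bar>snd d\<bar> = 1" by (simp add: d_def)
  moreover have "\<sigma> * (of_int (fst d) * a + of_int (snd d) * b) = max \<bar>a\<bar> \<bar>b\<bar>"
    using s by (elim disjE) (simp_all add: d_def)
  ultimately show ?thesis using that by blast
qed

text \<open>The gradient is nearly constant around w, so a move along the dominant axis changes g at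
  a rate of about s and outweighs small sideways errors. All points involved lie within 40 e + 6 e +
  16 e of w, safely below 100 e.\<close>

lemma tame_at_level:
  fixes g :: "real^2 \<Rightarrow> real"
  assumes e: "e > 0" and \<sigma>: "\<bar>\<sigma>\<bar> = 1"
    and diff: "\<And>y. y \<in> box_at w (100 * e) \<Longrightarrow> g differentiable (at y)"
    and s: "s = max \<bar>partial_deriv 1 g w\<bar> \<bar>partial_deriv 2 g w\<bar>" "s > 0"
    and close: "\<And>y i. y \<in> box_at w (100 * e) \<Longrightarrow> \<bar>partial_deriv i g y - partial_deriv i g w\<bar> \<le> s / 10"
    and up: "\<And>y y'. y \<in> X \<Longrightarrow> y \<in> box_at w (100 * e) \<Longrightarrow> y' \<in> box_at w (100 * e) \<Longrightarrow> \<sigma> * g y \<le> \<sigma> * g y' \<Longrightarrow> y' \<in> X"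
    and x: "x \<in> X" "x \<in> box_at w (40 * e)"
  shows "\<exists>d. \<bar>fst d\<bar> + \<bar>snd d\<bar> = 1 \<and>
     (\<forall>y\<in>X \<inter> box_at x (6 * e). \<forall>t\<in>{0..16 * e}. y + t *\<^sub>R pv d \<in> X) \<and>
     (\<forall>y\<in>box_at x e. y + (4 * e) *\<^sub>R pv d \<in> X) \<and>
     (\<forall>y\<in>box_at x (6 * e). y + (16 * e) *\<^sub>R pv d \<in> X)"
proof -
  let ?B = "box_at w (100 * e)" and ?a = "partial_deriv 1 g w" and ?b = "partial_deriv 2 g w"
  obtain d :: pix where d: "\<bar>fst d\<bar> + \<bar>snd d\<bar> = 1"
    and ds: "\<sigma> * (of_int (fst d) * ?a + of_int (snd d) * ?b) = s"
    using dominant_axis[OF \<sigma>, of ?a ?b] s(1) by metis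
  have d1: "\<bar>real_of_int (fst d)\<bar> + \<bar>real_of_int (snd d)\<bar> = 1"
    using d by (simp flip: of_int_abs of_int_add)
  \<comment> \<open>The move gains t s. An error of size c in each coordinate costs at most 2 c s,
    the variation of the gradient at most (t + 2 c) s / 10. The balance is positive for (t, c) = (4
    e, e) and (16 e, 6 e), the constants of \<open>tame\<close>, and nonnegative for c = 0.\<close>
  have inc: "\<sigma> * g y' \<ge> \<sigma> * g y"
    if y: "y \<in> ?B" "y' \<in> ?B" and t: "0 \<le> t"
      and v: "\<bar>y'$1 - y$1 - t * of_int (fst d)\<bar> \<le> c" "\<bar>y'$2 - y$2 - t * of_int (snd d)\<bar> \<le> c"
      and c: "t - 2 * c - (t + 2 * c) / 10 \<ge> 0" for y y' t c
  proof -
    have "closed_segment y y' \<subseteq> ?B" using y convex_box_at by (rule closed_segment_subset)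
    then obtain z where z: "z \<in> ?B"
      and eq: "g y' - g y = (y'$1 - y$1) * partial_deriv 1 g z + (y'$2 - y$2) * partial_deriv 2 g z"
      using mean_value_segment[of y y' g] diff by (metis subsetD)
    define v1 v2 where "v1 = y'$1 - y$1 - t * of_int (fst d)" and "v2 = y'$2 - y$2 - t * of_int (snd d)"
    define q1 q2 where "q1 = partial_deriv 1 g z - ?a" and "q2 = partial_deriv 2 g z - ?b"
    have q: "\<bar>q1\<bar> \<le> s / 10" "\<bar>q2\<bar> \<le> s / 10" using close[OF z] by (auto simp: q1_def q2_def)
    have vv: "\<bar>v1\<bar> \<le> c" "\<bar>v2\<bar> \<le> c" using v by (simp_all add: v1_def v2_def)
    have ab: "\<bar>?a\<bar> \<le> s" "\<bar>?b\<bar> \<le> s" using s(1) by auto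
    have "\<bar>v1 * ?a\<bar> \<le> c * s" "\<bar>v2 * ?b\<bar> \<le> c * s"
      unfolding abs_mult using vv ab by (auto intro!: mult_mono)
    moreover have "\<bar>(v1 + t * of_int (fst d)) * q1\<bar> \<le> (c + t * \<bar>of_int (fst d)\<bar>) * (s / 10)"
      "\<bar>(v2 + t * of_int (snd d)) * q2\<bar> \<le> (c + t * \<bar>of_int (snd d)\<bar>) * (s / 10)"
    proof -
      have "\<bar>(v + t * k) * q\<bar> \<le> (c + t * \<bar>k\<bar>) * (s / 10)" if "\<bar>v\<bar> \<le> c" "\<bar>q\<bar> \<le> s / 10" for v q k :: real
      proof -
        have "\<bar>v + t * k\<bar> \<le> c + t * \<bar>k\<bar>"
          using abs_triangle_ineq[of v "t * k"] that(1) t by (simp add: abs_mult)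
        then show ?thesis unfolding abs_mult using that(2) by (intro mult_mono) auto
      qed
      then show "\<bar>(v1 + t * of_int (fst d)) * q1\<bar> \<le> (c + t * \<bar>of_int (fst d)\<bar>) * (s / 10)"
        "\<bar>(v2 + t * of_int (snd d)) * q2\<bar> \<le> (c + t * \<bar>of_int (snd d)\<bar>) * (s / 10)"
        using vv q by blast+
    qed
    moreover have "(c + t * \<bar>of_int (fst d)\<bar>) * (s / 10) + (c + t * \<bar>of_int (snd d)\<bar>) * (s / 10)
        = (t + 2 * c) / 10 * s"
    proof -
      have "(c + t * \<bar>of_int (fst d)\<bar>) * (s / 10) + (c + t * \<bar>of_int (snd d)\<bar>) * (s / 10)
        = (2 * c + t * (\<bar>of_int (fst d)\<bar> + \<bar>of_int (snd d)\<bar>)) * (s / 10)" by (simp add: algebra_simps)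
      then show ?thesis unfolding d1 by simp
    qed
    moreover have "\<sigma> * (g y' - g y) = t * s + \<sigma> * (v1 * ?a + v2 * ?b
        + ((v1 + t * of_int (fst d)) * q1 + (v2 + t * of_int (snd d)) * q2))"
      unfolding eq ds[symmetric] v1_def v2_def q1_def q2_def by (simp add: algebra_simps)
    moreover have "\<sigma> * r \<ge> - \<bar>r\<bar>" for r using abs_mult[of \<sigma> r] \<sigma> by simp
    note this[of "v1 * ?a + v2 * ?b + ((v1 + t * of_int (fst d)) * q1 + (v2 + t * of_int (snd d)) * q2)"]
    moreover have "\<bar>A + B + (C + E)\<bar> \<le> \<bar>A\<bar> + \<bar>B\<bar> + \<bar>C\<bar> + \<bar>E\<bar>" for A B C E :: real by linarith
    note this[of "v1 * ?a" "v2 * ?b" "(v1 + t * of_int (fst d)) * q1" "(v2 + t * of_int (snd d)) * q2"]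
    ultimately have "\<sigma> * (g y' - g y) \<ge> t * s - 2 * (c * s) - (t + 2 * c) / 10 * s"
      by linarith
    moreover have "t * s - 2 * (c * s) - (t + 2 * c) / 10 * s = (t - 2 * c - (t + 2 * c) / 10) * s"
      by (simp add: algebra_simps)
    moreover have "\<dots> \<ge> 0" using c s(2) by simp
    ultimately show ?thesis by (simp add: algebra_simps)
  qed
  have shift: "y + t *\<^sub>R pv d \<in> ?B" if "y \<in> box_at x (6 * e)" "0 \<le> t" "t \<le> 16 * e" for y t
  proof -
    have "\<bar>t * of_int (fst d)\<bar> \<le> 16 * e" "\<bar>t * of_int (snd d)\<bar> \<le> 16 * e"
      using that unit_pix_le[OF d] by (auto simp: abs_mult intro: order_trans[OF mult_left_le])
    then show ?thesis using that x(2) e by (auto simp: mem_box_at)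
  qed
  have xB: "x \<in> ?B" using x(2) e by (auto simp: mem_box_at)
  have "y + t *\<^sub>R pv d \<in> X" if "y \<in> X \<inter> box_at x (6 * e)" "t \<in> {0..16 * e}" for y t
  proof (rule up[of y])
    show yB: "y \<in> ?B" using shift[of y 0] that by simp
    show tB: "y + t *\<^sub>R pv d \<in> ?B" using shift that by auto
    show "\<sigma> * g y \<le> \<sigma> * g (y + t *\<^sub>R pv d)"
      by (rule inc[OF yB tB, of t 0]) (use that in auto)
  qed (use that in auto)
  moreover have "y + (4 * e) *\<^sub>R pv d \<in> X" if y: "y \<in> box_at x e" for y
  proof (rule up[OF x(1) xB])
    have y6: "y \<in> box_at x (6 * e)" using y e by (auto simp: mem_box_at)
    show tB: "y + (4 * e) *\<^sub>R pv d \<in> ?B" using shift[OF y6] e by auto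
    show "\<sigma> * g x \<le> \<sigma> * g (y + (4 * e) *\<^sub>R pv d)"
      by (rule inc[OF xB tB, of "4 * e" e]) (use y e in \<open>auto simp: mem_box_at\<close>)
  qed
  moreover have "y + (16 * e) *\<^sub>R pv d \<in> X" if y: "y \<in> box_at x (6 * e)" for y
  proof (rule up[OF x(1) xB])
    show tB: "y + (16 * e) *\<^sub>R pv d \<in> ?B" using shift[OF y] e by auto
    show "\<sigma> * g x \<le> \<sigma> * g (y + (16 * e) *\<^sub>R pv d)"
      by (rule inc[OF xB tB, of "16 * e" "6 * e"]) (use y e in \<open>auto simp: mem_box_at\<close>)
  qed
  ultimately show ?thesis using d by blast
qed

text \<open>Away from the boundary any direction serves, since 6 e + 16 e is below 40 e.\<close>

lemma tame_at_interior:
  assumes "box_at x (40 * e) \<subseteq> X" "e > 0"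
  shows "\<exists>d. \<bar>fst d\<bar> + \<bar>snd d\<bar> = 1 \<and>
     (\<forall>y\<in>X \<inter> box_at x (6 * e). \<forall>t\<in>{0..16 * e}. y + t *\<^sub>R pv d \<in> X) \<and>
     (\<forall>y\<in>box_at x e. y + (4 * e) *\<^sub>R pv d \<in> X) \<and>
     (\<forall>y\<in>box_at x (6 * e). y + (16 * e) *\<^sub>R pv d \<in> X)"
  using assms by (intro exI[of _ "(1, 0)"]) (auto intro!: subsetD[OF assms(1)] simp: mem_box_at)


lemma compact_cball_margin:
  fixes K :: "(real^2) set"
  assumes "compact K" "open W" "K \<subseteq> W"
  obtains r where "r > 0" "(\<Union>x\<in>K. cball x r) \<subseteq> W" "compact (\<Union>x\<in>K. cball x r)"
proof -
  obtain r where r: "r > 0" "(\<Union>x\<in>K. cball x r) \<subseteq> W"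
    using compact_subset_open_imp_cball_epsilon_subset[OF assms] by blast
  have "(\<Union>x\<in>K. cball x r) = {x + y |x y. x \<in> K \<and> y \<in> cball 0 r}"
  proof
    show "(\<Union>x\<in>K. cball x r) \<subseteq> {x + y |x y. x \<in> K \<and> y \<in> cball 0 r}"
    proof
      fix y assume "y \<in> (\<Union>x\<in>K. cball x r)"
      then obtain x where "x \<in> K" "dist x y \<le> r" by auto
      then show "y \<in> {x + y |x y. x \<in> K \<and> y \<in> cball 0 r}"
      proof -
        have "y = x + (y - x)" "y - x \<in> cball 0 r" using \<open>dist x y \<le> r\<close> by (auto simp: dist_norm norm_minus_commute)
        then show ?thesis using \<open>x \<in> K\<close> by blast
      qed
    qed
  qed (auto simp: dist_norm)
  then have "compact (\<Union>x\<in>K. cball x r)" using compact_sums[OF assms(1) compact_cball[of 0 r]] by (simp only:)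
  with r that show ?thesis by blast
qed

definition corner_count :: "pix set \<Rightarrow> int" where
  "corner_count P = int (card {p \<in> P. pixR p \<notin> P \<and> pixU p \<notin> P})
    - int (card {p. p \<notin> P \<and> pixL p \<in> P \<and> pixD p \<in> P})"

text \<open>The points with values in S form a compact set without critical points, on which the
  gradient has a positive minimum. The threshold is thus common to all levels in S, which later
  permits integrating over levels at a fixed mesh.\<close>

lemma excursion_tame:
  fixes g :: "real^2 \<Rightarrow> real"
  assumes W: "open W" and C1: "C1_on W g" and K: "compact (excursion W g u0)"
    and S: "closed S" "S \<subseteq> {u0..}" and reg: "\<And>u. u \<in> S \<Longrightarrow> \<not> critical_value W g u"
  obtains e0 where "e0 > 0" "\<And>e u. 0 < e \<Longrightarrow> e < e0 \<Longrightarrow> u \<in> S \<Longrightarrow>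
    tame (excursion W g u) e \<and> tame (- excursion W g u) e"
proof -
  let ?K = "excursion W g u0"
  have KW: "?K \<subseteq> W" by (auto simp: excursion_def)
  obtain r where r: "r > 0" "(\<Union>x\<in>?K. cball x r) \<subseteq> W" "compact (\<Union>x\<in>?K. cball x r)"
    by (rule compact_cball_margin[OF K W KW])
  let ?N = "\<Union>x\<in>?K. cball x r"
  have gK: "continuous_on ?K g" using C1_on_imp(3)[OF C1] KW continuous_on_subset by blast
  define Z where "Z = {x \<in> ?K. g x \<in> S}"
  have "Z = ?K \<inter> g -` S" by (auto simp: Z_def)
  moreover have "closed (?K \<inter> g -` S)"
    using continuous_closed_preimage[OF gK _ S(1)] K compact_imp_closed by blast
  ultimately have cZ: "compact Z" using K by (metis compact_Int_closed inf.left_idem)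
  define s where "s x = max \<bar>partial_deriv 1 g x\<bar> \<bar>partial_deriv 2 g x\<bar>" for x
  have "continuous_on Z (partial_deriv i g)" for i
    by (rule continuous_on_subset[OF C1_on_imp(2)[OF C1]]) (use KW in \<open>auto simp: Z_def\<close>)
  then have sc: "continuous_on Z s" unfolding s_def by (intro continuous_intros)
  have sp: "s x > 0" if "x \<in> Z" for x
  proof (rule ccontr)
    assume "\<not> s x > 0"
    then have "partial_deriv 1 g x = 0" "partial_deriv 2 g x = 0" by (auto simp: s_def)
    then have "grad g x = 0" by (simp add: grad_def vec_eq_iff forall_2)
    then show False using that reg[of "g x"] KW by (auto simp: critical_value_def Z_def)
  qed
  obtain m where m: "m > 0" "\<And>x. x \<in> Z \<Longrightarrow> m \<le> s x"
  proof (cases "Z = {}")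
    case True then show ?thesis using that[of 1] by auto
  next
    case False
    then obtain x where "x \<in> Z" "\<forall>y\<in>Z. s x \<le> s y" using continuous_attains_inf[OF cZ _ sc] by blast
    then show ?thesis using that[of "s x"] sp by blast
  qed
  have "\<exists>d. d > 0 \<and> (\<forall>x\<in>?N. \<forall>y\<in>?N. dist y x < d \<longrightarrow> dist (partial_deriv i g y) (partial_deriv i g x) < m / 10)" for i
  proof -
    have "uniformly_continuous_on ?N (partial_deriv i g)"
      by (rule compact_uniformly_continuous[OF continuous_on_subset[OF C1_on_imp(2)[OF C1] r(2)] r(3)])
    moreover have "m / 10 > 0" using m(1) by simp
    ultimately show ?thesis unfolding uniformly_continuous_on_def by blast
  qed
  then have "\<forall>i. \<exists>d. d > 0 \<and> (\<forall>x\<in>?N. \<forall>y\<in>?N. dist y x < d \<longrightarrow> dist (partial_deriv i g y) (partial_deriv i g x) < m / 10)"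
    by (rule allI)
  from choice[OF this] obtain \<delta> where \<delta>: "\<And>i. \<delta> i > 0"
    "\<And>i x y. x \<in> ?N \<Longrightarrow> y \<in> ?N \<Longrightarrow> dist y x < \<delta> i \<Longrightarrow> dist (partial_deriv i g y) (partial_deriv i g x) < m / 10"
    by blast
  \<comment> \<open>A box of radius 100 e lies in a ball of radius 200 e, which has to stay inside
    the margin around the excursion set and within the moduli of continuity of the partial
    derivatives.\<close>
  define e0 where "e0 = min r (min (\<delta> 1) (\<delta> 2)) / 300"
  have e0: "e0 > 0" using r(1) \<delta>(1) by (simp add: e0_def)
  show ?thesis
  proof (rule that[OF e0])
    fix e u assume e: "0 < e" "e < e0" and u: "u \<in> S"
    have er: "300 * e < r" "300 * e < \<delta> 1" "300 * e < \<delta> 2" using e(2) by (auto simp: e0_def)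
    let ?A = "excursion W g u"
    have AK: "?A \<subseteq> ?K" using u S(2) by (auto simp: excursion_def)
    have boxN: "box_at x (100 * e) \<subseteq> ?N" if "x \<in> ?K" for x
    proof
      fix y assume "y \<in> box_at x (100 * e)"
      then have "y \<in> cball x r" using box_at_subset_cball[of x "100 * e"] er(1) e(1) by auto
      then show "y \<in> ?N" using that by blast
    qed
    \<comment> \<open>If the boundary is within 40 e, the segment across it contains a point of
      value exactly u, by the intermediate value theorem. Such a point is not critical.\<close>
    have level: "\<exists>w\<in>Z. g w = u \<and> x \<in> box_at w (40 * e) \<and> y \<in> box_at w (40 * e)"
      if xy: "x \<in> ?A" "y \<notin> ?A" "y \<in> box_at x (40 * e)" for x y
    proof -
      have xK: "x \<in> ?K" using xy(1) AK by blast
      have seg: "closed_segment x y \<subseteq> box_at x (40 * e)"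
        using xy(3) e(1) by (intro closed_segment_subset convex_box_at) (auto simp: mem_box_at)
      also have "\<dots> \<subseteq> box_at x (100 * e)" using e(1) by (auto simp: mem_box_at)
      finally have "closed_segment x y \<subseteq> W" using boxN[OF xK] r(2) by blast
      have "y \<in> closed_segment x y" by simp
      then have yW: "y \<in> W" using \<open>closed_segment x y \<subseteq> W\<close> by (rule rev_subsetD)
      have "connected (g ` closed_segment x y)"
        by (rule connected_continuous_image[OF continuous_on_subset[OF C1_on_imp(3)[OF C1] \<open>closed_segment x y \<subseteq> W\<close>] connected_segment(1)])
      moreover have "g y \<le> u" "u \<le> g x" using xy yW by (auto simp: excursion_def)
      ultimately have "u \<in> g ` closed_segment x y"
        using connected_contains_Icc[of "g ` closed_segment x y" "g y" "g x"] by auto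
      then obtain w where w: "w \<in> closed_segment x y" "g w = u" by blast
      then have "w \<in> W" using \<open>closed_segment x y \<subseteq> W\<close> by blast
      then have "w \<in> Z" using w(2) u S(2) by (auto simp: Z_def excursion_def)
      moreover have "x \<in> box_at w (40 * e)" using subsetD[OF seg w(1)] by (auto simp: mem_box_at abs_minus_commute)
      moreover have "y \<in> box_at w (40 * e)"
      proof -
        have "closed_segment x y \<subseteq> box_at y (40 * e)"
          using xy(3) e(1) by (intro closed_segment_subset convex_box_at) (auto simp: mem_box_at abs_minus_commute)
        from subsetD[OF this w(1)] show ?thesis by (auto simp: mem_box_at abs_minus_commute)
      qed
      ultimately show ?thesis using w(2) by blast
    qed
    have near: "g differentiable (at y)" "\<bar>partial_deriv i g y - partial_deriv i g w\<bar> \<le> s w / 10" "y \<in> W"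
      if wy: "w \<in> Z" "y \<in> box_at w (100 * e)" for w y i
    proof -
      have wK: "w \<in> ?K" using wy(1) by (auto simp: Z_def)
      have yN: "y \<in> ?N" using boxN[OF wK] wy(2) by blast
      have wN: "w \<in> ?N" using wK r(1) by (intro UN_I[of w]) simp_all
      show "y \<in> W" using yN r(2) by blast
      then show "g differentiable (at y)" using C1_on_imp(1)[OF C1] by blast
      have "y \<in> cball w (2 * (100 * e))" using box_at_subset_cball[of w "100 * e"] wy(2) by blast
      then have "dist y w \<le> 2 * (100 * e)" by (simp add: dist_commute)
      then have "dist y w < \<delta> i" using er e(1) exhaust_2[of i] by auto
      from \<delta>(2)[OF wN yN this] show "\<bar>partial_deriv i g y - partial_deriv i g w\<bar> \<le> s w / 10"
        using m(2)[OF wy(1)] by (simp add: dist_real_def)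
    qed
    have "tame ?A e"
      unfolding tame_def
    proof
      fix x assume x: "x \<in> ?A"
      show "\<exists>d. \<bar>fst d\<bar> + \<bar>snd d\<bar> = 1 \<and>
         (\<forall>y\<in>?A \<inter> box_at x (6 * e). \<forall>t\<in>{0..16 * e}. y + t *\<^sub>R pv d \<in> ?A) \<and>
         (\<forall>y\<in>box_at x e. y + (4 * e) *\<^sub>R pv d \<in> ?A) \<and>
         (\<forall>y\<in>box_at x (6 * e). y + (16 * e) *\<^sub>R pv d \<in> ?A)"
      proof (cases "box_at x (40 * e) \<subseteq> ?A")
        case True then show ?thesis using e(1) by (rule tame_at_interior)
      next
        case False
        then obtain y where "y \<notin> ?A" "y \<in> box_at x (40 * e)" by blast
        from level[OF x this] obtain w where w: "w \<in> Z" "g w = u" "x \<in> box_at w (40 * e)" by blast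
        show ?thesis
        proof (rule tame_at_level[where \<sigma> = 1 and w = w and g = g and s = "s w"])
          show "g differentiable (at y)" if "y \<in> box_at w (100 * e)" for y
            using near(1)[OF w(1) that] .
          show "\<bar>partial_deriv i g y - partial_deriv i g w\<bar> \<le> s w / 10" if "y \<in> box_at w (100 * e)" for y i
            using near(2)[OF w(1) that] .
          show "y' \<in> ?A" if "y \<in> ?A" "y \<in> box_at w (100 * e)" "y' \<in> box_at w (100 * e)"
            "1 * g y \<le> 1 * g y'" for y y'
            using near(3)[OF w(1) that(3)] that(1,4) by (auto simp: excursion_def)
        qed (use e(1) w x sp[OF w(1)] in \<open>simp_all add: s_def\<close>)
      qed
    qed
    moreover have "tame (- ?A) e"
      unfolding tame_def
    proof
      fix x assume x: "x \<in> - ?A"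
      show "\<exists>d. \<bar>fst d\<bar> + \<bar>snd d\<bar> = 1 \<and>
         (\<forall>y\<in>- ?A \<inter> box_at x (6 * e). \<forall>t\<in>{0..16 * e}. y + t *\<^sub>R pv d \<in> - ?A) \<and>
         (\<forall>y\<in>box_at x e. y + (4 * e) *\<^sub>R pv d \<in> - ?A) \<and>
         (\<forall>y\<in>box_at x (6 * e). y + (16 * e) *\<^sub>R pv d \<in> - ?A)"
      proof (cases "box_at x (40 * e) \<subseteq> - ?A")
        case True then show ?thesis using e(1) by (rule tame_at_interior)
      next
        case False
        then obtain y where y: "y \<in> ?A" "y \<in> box_at x (40 * e)" by blast
        then have "x \<in> box_at y (40 * e)" by (auto simp: mem_box_at abs_minus_commute)
        from level[OF y(1) _ this] x obtain w where w: "w \<in> Z" "g w = u" "x \<in> box_at w (40 * e)" by blast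
        show ?thesis
        proof (rule tame_at_level[where \<sigma> = "-1" and w = w and g = g and s = "s w"])
          show "g differentiable (at y)" if "y \<in> box_at w (100 * e)" for y
            using near(1)[OF w(1) that] .
          show "\<bar>partial_deriv i g y - partial_deriv i g w\<bar> \<le> s w / 10" if "y \<in> box_at w (100 * e)" for y i
            using near(2)[OF w(1) that] .
          show "y' \<in> - ?A" if "y \<in> - ?A" "y \<in> box_at w (100 * e)" "y' \<in> box_at w (100 * e)"
            "-1 * g y \<le> -1 * g y'" for y y'
            using near(3)[OF w(1) that(2)] that(1,4) by (auto simp: excursion_def)
        qed (use e(1) w x sp[OF w(1)] in \<open>simp_all add: s_def\<close>)
      qed
    qed
    ultimately show "tame ?A e \<and> tame (- ?A) e" ..
  qed
qed

theorem euler_char_excursion_grid: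
  fixes g :: "real^2 \<Rightarrow> real"
  assumes W: "open W" and C1: "C1_on W g" and K: "compact (excursion W g u0)"
    and S: "closed S" "S \<subseteq> {u0..}" and reg: "\<And>u. u \<in> S \<Longrightarrow> \<not> critical_value W g u"
  obtains e0 where "e0 > 0" "\<And>e u z. 0 < e \<Longrightarrow> e < e0 \<Longrightarrow> u \<in> S \<Longrightarrow>
    euler_char (excursion W g u) = corner_count (gset z e (excursion W g u))"
proof (rule excursion_tame[OF assms])
  fix e0 assume e0: "0 < e0" "\<And>e u. 0 < e \<Longrightarrow> e < e0 \<Longrightarrow> u \<in> S \<Longrightarrow>
    tame (excursion W g u) e \<and> tame (- excursion W g u) e"
  have "bounded (excursion W g u)" if "u \<in> S" for u
    using compact_imp_bounded[OF K] by (rule bounded_subset) (use that S(2) in \<open>auto simp: excursion_def\<close>)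
  note bdd = this
  show ?thesis
  proof (rule that[OF e0(1)])
    fix e u z assume e: "0 < e" "e < e0" "u \<in> S"
    show "euler_char (excursion W g u) = corner_count (gset z e (excursion W g u))"
      unfolding corner_count_def using e0(2)[OF e] by (intro euler_char_grid bdd e) blast+
  qed
qed


section \<open>Second differences at a corner\<close>

lemma second_order_expansion:
  fixes \<phi> :: "real \<Rightarrow> real"
  assumes d1: "\<And>t. \<bar>t\<bar> < r \<Longrightarrow> (\<phi> has_real_derivative \<phi>' t) (at t)" and r: "r > 0"
    and d2: "(\<phi>' has_real_derivative c) (at 0)"
  shows "((\<lambda>t. (\<phi> t - \<phi> 0 - \<phi>' 0 * t) / t\<^sup>2) \<longlongrightarrow> c / 2) (at_right 0)"
proof (rule lhopital_right_0[where f' = "\<lambda>t. \<phi>' t - \<phi>' 0" and g' = "\<lambda>t. 2 * t"])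
  have near: "eventually (\<lambda>t. 0 < t \<and> t < r) (at_right 0)"
    using r eventually_at_right[of 0 1] by (auto simp: eventually_at_right_field)
  have "isCont \<phi> 0" using d1[of 0] r DERIV_isCont by auto
  then have "(\<phi> \<longlongrightarrow> \<phi> 0) (at_right 0)" by (auto simp: isCont_def intro: tendsto_mono at_le)
  then have "((\<lambda>t. \<phi> t - \<phi> 0 - \<phi>' 0 * t) \<longlongrightarrow> \<phi> 0 - \<phi> 0 - \<phi>' 0 * 0) (at_right 0)"
    by (intro tendsto_intros)
  then show "((\<lambda>t. \<phi> t - \<phi> 0 - \<phi>' 0 * t) \<longlongrightarrow> 0) (at_right 0)" by simp
  have "((\<lambda>t::real. t\<^sup>2) \<longlongrightarrow> 0\<^sup>2) (at_right 0)" by (intro tendsto_intros)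
  then show "((\<lambda>t::real. t\<^sup>2) \<longlongrightarrow> 0) (at_right 0)" by simp
  show "\<forall>\<^sub>F t in at_right 0. t\<^sup>2 \<noteq> (0::real)" "\<forall>\<^sub>F t in at_right 0. 2 * t \<noteq> (0::real)"
    using near by (auto elim: eventually_mono)
  show "\<forall>\<^sub>F t in at_right 0. ((\<lambda>t. t\<^sup>2) has_real_derivative 2 * t) (at t)"
    by (auto intro!: derivative_eq_intros always_eventually)
  show "\<forall>\<^sub>F t in at_right 0. ((\<lambda>t. \<phi> t - \<phi> 0 - \<phi>' 0 * t) has_real_derivative \<phi>' t - \<phi>' 0) (at t)"
    using near by (rule eventually_mono) (auto intro!: derivative_eq_intros d1)
  have "((\<lambda>t. (\<phi>' t - \<phi>' 0) / (t - 0)) \<longlongrightarrow> c) (at_right 0)"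
    using d2 unfolding has_field_derivative_iff by (auto intro: tendsto_mono at_le)
  then have "((\<lambda>t. (\<phi>' t - \<phi>' 0) / (t - 0) / 2) \<longlongrightarrow> c / 2) (at_right 0)" by (intro tendsto_intros) auto
  then show "((\<lambda>t. (\<phi>' t - \<phi>' 0) / (2 * t)) \<longlongrightarrow> c / 2) (at_right 0)" by (simp add: mult.commute)
qed

lemma second_order_expansion_left:
  fixes \<phi> :: "real \<Rightarrow> real"
  assumes d1: "\<And>t. \<bar>t\<bar> < r \<Longrightarrow> (\<phi> has_real_derivative \<phi>' t) (at t)" and r: "r > 0"
    and d2: "(\<phi>' has_real_derivative c) (at 0)"
  shows "((\<lambda>t. (\<phi> (- t) - \<phi> 0 + \<phi>' 0 * t) / t\<^sup>2) \<longlongrightarrow> c / 2) (at_right 0)"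
proof -
  have 1: "((\<lambda>t. \<phi> (- t)) has_real_derivative - \<phi>' (- t)) (at t)" if "\<bar>t\<bar> < r" for t
    using DERIV_mirror[where f = \<phi> and x = t and y = "\<phi>' (- t)"] d1[of "- t"] that by simp
  have 2: "((\<lambda>t. - \<phi>' (- t)) has_real_derivative c) (at 0)"
    using DERIV_minus[of "\<lambda>t. \<phi>' (- t)" "- c" 0 UNIV] DERIV_mirror[where f = \<phi>' and x = 0 and y = c] d2 by simp
  show ?thesis using second_order_expansion[OF 1 r 2] by simp
qed

lemma second_difference_limit:
  fixes \<phi> :: "real \<Rightarrow> real"
  assumes "\<And>t. \<bar>t\<bar> < r \<Longrightarrow> (\<phi> has_real_derivative \<phi>' t) (at t)" "r > 0"
    "(\<phi>' has_real_derivative c) (at 0)"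
  shows "((\<lambda>t. (\<phi> t + \<phi> (- t) - 2 * \<phi> 0) / t\<^sup>2) \<longlongrightarrow> c) (at_right 0)"
proof -
  have "((\<lambda>t. (\<phi> t - \<phi> 0 - \<phi>' 0 * t) / t\<^sup>2 + (\<phi> (- t) - \<phi> 0 + \<phi>' 0 * t) / t\<^sup>2) \<longlongrightarrow> c / 2 + c / 2) (at_right 0)"
    by (intro tendsto_add second_order_expansion[OF assms] second_order_expansion_left[OF assms])
  moreover have "(\<phi> t - \<phi> 0 - \<phi>' 0 * t) / t\<^sup>2 + (\<phi> (- t) - \<phi> 0 + \<phi>' 0 * t) / t\<^sup>2
      = (\<phi> t + \<phi> (- t) - 2 * \<phi> 0) / t\<^sup>2" for t
    unfolding add_divide_distrib[symmetric] by (simp add: algebra_simps)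
  ultimately show ?thesis by simp
qed

lemma first_order_limits:
  fixes \<phi> :: "real \<Rightarrow> real"
  assumes "(\<phi> has_real_derivative s) (at 0)"
  shows "((\<lambda>t. (\<phi> t - \<phi> 0) / t) \<longlongrightarrow> s) (at_right 0)" "((\<lambda>t. (\<phi> 0 - \<phi> (- t)) / t) \<longlongrightarrow> s) (at_right 0)"
proof -
  have "((\<lambda>t. (\<phi> t - \<phi> 0) / (t - 0)) \<longlongrightarrow> s) (at 0)"
    using assms unfolding has_field_derivative_iff .
  then show "((\<lambda>t. (\<phi> t - \<phi> 0) / t) \<longlongrightarrow> s) (at_right 0)"
    by (auto intro: tendsto_mono at_le)
  have "((\<lambda>t. \<phi> (- t)) has_real_derivative - s) (at 0)"
    using DERIV_mirror[where f = \<phi> and x = 0 and y = s] assms by simp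
  then have "((\<lambda>t. (\<phi> (- t) - \<phi> (- 0)) / (t - 0)) \<longlongrightarrow> - s) (at 0)"
    unfolding has_field_derivative_iff .
  then have "((\<lambda>t. - ((\<phi> (- t) - \<phi> (- 0)) / (t - 0))) \<longlongrightarrow> - (- s)) (at_right 0)"
    by (intro tendsto_minus) (auto intro: tendsto_mono at_le)
  then show "((\<lambda>t. (\<phi> 0 - \<phi> (- t)) / t) \<longlongrightarrow> s) (at_right 0)" by (simp add: minus_divide_left)
qed

text \<open>If \<open>H' = h\<close>, this is the integral of \<open>h\<close> over the levels \<open>u\<close> with \<open>M < u \<le> c\<close> minus that over the
  levels with \<open>c < u \<le> m\<close>: the contribution of one grid point with value \<open>c\<close> to the corner counts, \<open>M\<close> being
  the larger value at its right and upper neighbours and \<open>m\<close> the smaller one at its left and lower ones.\<close>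

definition corner_diff :: "(real \<Rightarrow> real) \<Rightarrow> real \<Rightarrow> real \<Rightarrow> real \<Rightarrow> real" where
  "corner_diff H c M m = H (max c M) - H M - H (max m c) + H c"

text \<open>The function \<phi> decreases more slowly, so it gives both the larger forward and the
  smaller backward value. The corner difference is then minus a symmetric second difference of H
  along \<phi>.\<close>

lemma tendsto_corner_diff_negative:
  fixes \<phi> \<psi> H :: "real \<Rightarrow> real"
  assumes r: "r > 0"
    and \<phi>: "\<And>t. \<bar>t\<bar> < r \<Longrightarrow> (\<phi> has_real_derivative \<phi>' t) (at t)" "(\<phi>' has_real_derivative c) (at 0)"
    and \<psi>: "(\<psi> has_real_derivative s) (at 0)"
    and eq: "\<phi> 0 = \<psi> 0" and neg: "s < \<phi>' 0" "\<phi>' 0 < 0"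
    and H: "\<And>u. (H has_real_derivative h u) (at u)" "\<And>u. (h has_real_derivative h' u) (at u)"
  shows "((\<lambda>t. corner_diff H (\<phi> 0) (max (\<phi> t) (\<psi> t)) (min (\<phi> (- t)) (\<psi> (- t))) / t\<^sup>2)
    \<longlongrightarrow> - ((\<phi>' 0)\<^sup>2 * h' (\<phi> 0) + c * h (\<phi> 0))) (at_right 0)"
proof -
  have \<phi>0: "(\<phi> has_real_derivative \<phi>' 0) (at 0)" using \<phi>(1)[of 0] r by simp
  have pos: "eventually (\<lambda>t::real. t > 0) (at_right 0)" by (simp add: eventually_at_right_less)
  have 1: "((\<lambda>t. ((\<phi> t - \<phi> 0) / t) - ((\<psi> t - \<psi> 0) / t)) \<longlongrightarrow> \<phi>' 0 - s) (at_right 0)"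
    "((\<lambda>t. ((\<phi> 0 - \<phi> (- t)) / t) - ((\<psi> 0 - \<psi> (- t)) / t)) \<longlongrightarrow> \<phi>' 0 - s) (at_right 0)"
    by (intro tendsto_diff first_order_limits \<phi>0 \<psi>)+
  have e1: "eventually (\<lambda>t. \<psi> t < \<phi> t) (at_right 0)"
  proof -
    have "eventually (\<lambda>t. 0 < (\<phi> t - \<phi> 0) / t - (\<psi> t - \<psi> 0) / t) (at_right 0)"
      by (rule order_tendstoD(1)[OF 1(1)]) (use neg in simp)
    then show ?thesis using pos
      by eventually_elim (use eq in \<open>simp add: diff_divide_distrib[symmetric] zero_less_divide_iff\<close>)
  qed
  have e2: "eventually (\<lambda>t. \<phi> (- t) < \<psi> (- t)) (at_right 0)"
  proof -
    have "eventually (\<lambda>t. 0 < (\<phi> 0 - \<phi> (- t)) / t - (\<psi> 0 - \<psi> (- t)) / t) (at_right 0)"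
      by (rule order_tendstoD(1)[OF 1(2)]) (use neg in simp)
    then show ?thesis using pos
      by eventually_elim (use eq in \<open>simp add: diff_divide_distrib[symmetric] zero_less_divide_iff\<close>)
  qed
  have "eventually (\<lambda>t. \<phi> t < \<phi> 0) (at_right 0)"
    using order_tendstoD(2)[OF first_order_limits(1)[OF \<phi>0] neg(2)] pos
    by eventually_elim (simp add: divide_less_0_iff)
  moreover have "eventually (\<lambda>t. \<phi> 0 < \<phi> (- t)) (at_right 0)"
    using order_tendstoD(2)[OF first_order_limits(2)[OF \<phi>0] neg(2)] pos
    by eventually_elim (simp add: divide_less_0_iff)
  ultimately have "eventually (\<lambda>t. \<phi> t < \<phi> 0 \<and> \<phi> 0 < \<phi> (- t)) (at_right 0)" by (rule eventually_conj)
  then have ev: "eventually (\<lambda>t. - ((H (\<phi> t) + H (\<phi> (- t)) - 2 * H (\<phi> 0)) / t\<^sup>2) =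
      corner_diff H (\<phi> 0) (max (\<phi> t) (\<psi> t)) (min (\<phi> (- t)) (\<psi> (- t))) / t\<^sup>2) (at_right 0)"
    using e1 e2 by eventually_elim (simp add: corner_diff_def max_absorb1 min_absorb1 minus_divide_left)
  have d1: "((\<lambda>t. H (\<phi> t)) has_real_derivative h (\<phi> t) * \<phi>' t) (at t)" if "\<bar>t\<bar> < r" for t
    by (rule DERIV_chain2[OF H(1) \<phi>(1)[OF that]])
  have "((\<lambda>t. h (\<phi> t)) has_real_derivative h' (\<phi> 0) * \<phi>' 0) (at 0)"
    by (rule DERIV_chain2[OF H(2) \<phi>0])
  from DERIV_mult[OF this \<phi>(2)]
  have d2: "((\<lambda>t. h (\<phi> t) * \<phi>' t) has_real_derivative ((\<phi>' 0)\<^sup>2 * h' (\<phi> 0) + c * h (\<phi> 0))) (at 0)"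
    by (simp add: power2_eq_square algebra_simps)
  have "((\<lambda>t. - ((H (\<phi> t) + H (\<phi> (- t)) - 2 * H (\<phi> 0)) / t\<^sup>2)) \<longlongrightarrow> - ((\<phi>' 0)\<^sup>2 * h' (\<phi> 0) + c * h (\<phi> 0))) (at_right 0)"
    by (rule tendsto_minus, rule second_difference_limit[OF d1 r d2])
  then show ?thesis using ev by (rule Lim_transform_eventually)
qed

text \<open>If one axis increases, some forward value exceeds the central one and some backward
  value is below it, so no level sees a corner of either kind.\<close>

lemma tendsto_corner_diff_positive:
  fixes \<phi> \<psi> H :: "real \<Rightarrow> real"
  assumes \<phi>: "(\<phi> has_real_derivative s) (at 0)" and pos: "s > 0"
  shows "((\<lambda>t. corner_diff H (\<phi> 0) (max (\<phi> t) (\<psi> t)) (min (\<phi> (- t)) (\<psi> (- t))) / t\<^sup>2) \<longlongrightarrow> 0) (at_right 0)"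
proof -
  have p: "eventually (\<lambda>t::real. t > 0) (at_right 0)" by (simp add: eventually_at_right_less)
  have "eventually (\<lambda>t. \<phi> 0 < \<phi> t) (at_right 0)"
    using order_tendstoD(1)[OF first_order_limits(1)[OF \<phi>] pos] p
    by eventually_elim (simp add: zero_less_divide_iff)
  moreover have "eventually (\<lambda>t. \<phi> (- t) < \<phi> 0) (at_right 0)"
    using order_tendstoD(1)[OF first_order_limits(2)[OF \<phi>] pos] p
    by eventually_elim (simp add: zero_less_divide_iff)
  ultimately have "eventually (\<lambda>t. 0 = corner_diff H (\<phi> 0) (max (\<phi> t) (\<psi> t)) (min (\<phi> (- t)) (\<psi> (- t))) / t\<^sup>2) (at_right 0)"
  proof eventually_elim
    case (elim t)
    then have "max (\<phi> 0) (max (\<phi> t) (\<psi> t)) = max (\<phi> t) (\<psi> t)" "max (min (\<phi> (- t)) (\<psi> (- t))) (\<phi> 0) = \<phi> 0" by auto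
    then show ?case by (simp add: corner_diff_def)
  qed
  then show ?thesis by (rule Lim_transform_eventually[OF tendsto_const])
qed

text \<open>The gradient lies on the border of the negative quadrant. With zero first and second
  derivative, \<phi> varies by o(t^2), and H is Lipschitz at the central value. The vanishing second
  derivative is available almost everywhere by \<open>null_set_level\<close>.\<close>

lemma tendsto_corner_diff_degenerate:
  fixes \<phi> \<psi> H :: "real \<Rightarrow> real"
  assumes r: "r > 0"
    and \<phi>: "\<And>t. \<bar>t\<bar> < r \<Longrightarrow> (\<phi> has_real_derivative \<phi>' t) (at t)" "(\<phi>' has_real_derivative 0) (at 0)" "\<phi>' 0 = 0"
    and \<psi>: "(\<psi> has_real_derivative s) (at 0)"
    and eq: "\<phi> 0 = \<psi> 0" and neg: "s < 0"
    and H: "(H has_real_derivative h) (at (\<phi> 0))"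
  shows "((\<lambda>t. corner_diff H (\<phi> 0) (max (\<phi> t) (\<psi> t)) (min (\<phi> (- t)) (\<psi> (- t))) / t\<^sup>2) \<longlongrightarrow> 0) (at_right 0)"
proof -
  have \<phi>0: "(\<phi> has_real_derivative 0) (at 0)" using \<phi>(1)[of 0] \<phi>(3) r by simp
  have p: "eventually (\<lambda>t::real. t > 0) (at_right 0)" by (simp add: eventually_at_right_less)
  have 1: "((\<lambda>t. ((\<phi> t - \<phi> 0) / t) - ((\<psi> t - \<psi> 0) / t)) \<longlongrightarrow> 0 - s) (at_right 0)"
    "((\<lambda>t. ((\<phi> 0 - \<phi> (- t)) / t) - ((\<psi> 0 - \<psi> (- t)) / t)) \<longlongrightarrow> 0 - s) (at_right 0)"
    by (intro tendsto_diff first_order_limits \<phi>0 \<psi>)+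
  have e1: "eventually (\<lambda>t. \<psi> t < \<phi> t) (at_right 0)"
  proof -
    have "eventually (\<lambda>t. 0 < (\<phi> t - \<phi> 0) / t - (\<psi> t - \<psi> 0) / t) (at_right 0)"
      by (rule order_tendstoD(1)[OF 1(1)]) (use neg in simp)
    then show ?thesis using p
      by eventually_elim (use eq in \<open>simp add: diff_divide_distrib[symmetric] zero_less_divide_iff\<close>)
  qed
  have e2: "eventually (\<lambda>t. \<phi> (- t) < \<psi> (- t)) (at_right 0)"
  proof -
    have "eventually (\<lambda>t. 0 < (\<phi> 0 - \<phi> (- t)) / t - (\<psi> 0 - \<psi> (- t)) / t) (at_right 0)"
      by (rule order_tendstoD(1)[OF 1(2)]) (use neg in simp)
    then show ?thesis using p
      by eventually_elim (use eq in \<open>simp add: diff_divide_distrib[symmetric] zero_less_divide_iff\<close>)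
  qed
  define B where "B = \<bar>h\<bar> + 1"
  have "((\<lambda>u. (H u - H (\<phi> 0)) / (u - \<phi> 0)) \<longlongrightarrow> h) (at (\<phi> 0))" using H unfolding has_field_derivative_iff .
  then have "((\<lambda>u. \<bar>(H u - H (\<phi> 0)) / (u - \<phi> 0)\<bar>) \<longlongrightarrow> \<bar>h\<bar>) (at (\<phi> 0))" by (rule tendsto_rabs)
  then have "eventually (\<lambda>u. \<bar>(H u - H (\<phi> 0)) / (u - \<phi> 0)\<bar> < B) (at (\<phi> 0))"
    by (rule order_tendstoD) (simp add: B_def)
  then have "eventually (\<lambda>u. \<bar>H u - H (\<phi> 0)\<bar> \<le> B * \<bar>u - \<phi> 0\<bar>) (at (\<phi> 0))"
  proof (rule eventually_mono)
    fix u assume "\<bar>(H u - H (\<phi> 0)) / (u - \<phi> 0)\<bar> < B"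
    then show "\<bar>H u - H (\<phi> 0)\<bar> \<le> B * \<bar>u - \<phi> 0\<bar>"
      by (cases "u = \<phi> 0") (auto simp: abs_divide divide_less_eq split: if_splits)
  qed
  then have "eventually (\<lambda>u. \<bar>H u - H (\<phi> 0)\<bar> \<le> B * \<bar>u - \<phi> 0\<bar>) (nhds (\<phi> 0))"
    by (auto simp: eventually_at_filter elim!: eventually_mono)
  moreover have "isCont \<phi> 0" using \<phi>0 DERIV_isCont by blast
  then have "(\<phi> \<longlongrightarrow> \<phi> 0) (at_right 0)" by (auto simp: isCont_def intro: tendsto_mono at_le)
  moreover have "((\<lambda>t. \<phi> (- t)) \<longlongrightarrow> \<phi> 0) (at_right 0)"
  proof -
    have "isCont (\<lambda>t. \<phi> (- t)) 0" using \<open>isCont \<phi> 0\<close> by (intro isCont_o2[of 0 uminus \<phi>]) auto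
    then show ?thesis by (auto simp: isCont_def intro: tendsto_mono at_le)
  qed
  ultimately have e3: "eventually (\<lambda>t. \<bar>H (\<phi> t) - H (\<phi> 0)\<bar> \<le> B * \<bar>\<phi> t - \<phi> 0\<bar>) (at_right 0)"
    "eventually (\<lambda>t. \<bar>H (\<phi> (- t)) - H (\<phi> 0)\<bar> \<le> B * \<bar>\<phi> (- t) - \<phi> 0\<bar>) (at_right 0)"
    by (auto intro: eventually_compose_filterlim)
  have "eventually (\<lambda>t. norm (corner_diff H (\<phi> 0) (max (\<phi> t) (\<psi> t)) (min (\<phi> (- t)) (\<psi> (- t))) / t\<^sup>2)
      \<le> B * \<bar>(\<phi> t - \<phi> 0 - \<phi>' 0 * t) / t\<^sup>2\<bar> + B * \<bar>(\<phi> (- t) - \<phi> 0 + \<phi>' 0 * t) / t\<^sup>2\<bar>) (at_right 0)"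
    using e1 e2 e3 p
  proof eventually_elim
    case (elim t)
    have B0: "B \<ge> 0" by (simp add: B_def)
    have "\<bar>corner_diff H (\<phi> 0) (max (\<phi> t) (\<psi> t)) (min (\<phi> (- t)) (\<psi> (- t)))\<bar>
        = \<bar>(H (max (\<phi> 0) (\<phi> t)) - H (\<phi> t)) - (H (max (\<phi> (- t)) (\<phi> 0)) - H (\<phi> 0))\<bar>"
      using elim(1,2) by (simp add: corner_diff_def max_absorb1 min_absorb1)
    also have "\<dots> \<le> B * \<bar>\<phi> t - \<phi> 0\<bar> + B * \<bar>\<phi> (- t) - \<phi> 0\<bar>"
    proof (rule order_trans[OF abs_triangle_ineq4 add_mono])
      show "\<bar>H (max (\<phi> 0) (\<phi> t)) - H (\<phi> t)\<bar> \<le> B * \<bar>\<phi> t - \<phi> 0\<bar>"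
        using elim(3) B0 by (cases "\<phi> t \<le> \<phi> 0") (simp_all add: max_absorb1 max_absorb2 abs_minus_commute)
      show "\<bar>H (max (\<phi> (- t)) (\<phi> 0)) - H (\<phi> 0)\<bar> \<le> B * \<bar>\<phi> (- t) - \<phi> 0\<bar>"
        using elim(4) B0 by (cases "\<phi> (- t) \<le> \<phi> 0") (simp_all add: max_absorb1 max_absorb2 abs_minus_commute)
    qed
    finally have "\<bar>corner_diff H (\<phi> 0) (max (\<phi> t) (\<psi> t)) (min (\<phi> (- t)) (\<psi> (- t)))\<bar> / t\<^sup>2 \<le>
      (B * \<bar>\<phi> t - \<phi> 0\<bar> + B * \<bar>\<phi> (- t) - \<phi> 0\<bar>) / t\<^sup>2" by (rule divide_right_mono) simp
    then show ?case using \<phi>(3) by (simp add: abs_divide add_divide_distrib)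
  qed
  moreover have "((\<lambda>t. B * \<bar>(\<phi> t - \<phi> 0 - \<phi>' 0 * t) / t\<^sup>2\<bar> + B * \<bar>(\<phi> (- t) - \<phi> 0 + \<phi>' 0 * t) / t\<^sup>2\<bar>)
      \<longlongrightarrow> B * \<bar>0 / 2\<bar> + B * \<bar>0 / 2\<bar>) (at_right 0)"
    by (intro tendsto_intros second_order_expansion[OF \<phi>(1) r \<phi>(2)] second_order_expansion_left[OF \<phi>(1) r \<phi>(2)])
  then have "((\<lambda>t. B * \<bar>(\<phi> t - \<phi> 0 - \<phi>' 0 * t) / t\<^sup>2\<bar> + B * \<bar>(\<phi> (- t) - \<phi> 0 + \<phi>' 0 * t) / t\<^sup>2\<bar>)
      \<longlongrightarrow> 0) (at_right 0)" by simp
  ultimately show ?thesis by (rule Lim_null_comparison)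
qed

text \<open>Here p and q are the forward and backward increments, in the application of size e but
  with p - q of size e^2. If their signs differ, each is at most the distance of p and q. If both
  are negative, replacing q by p leaves a genuine second difference. Otherwise the corner difference
  vanishes.\<close>

lemma corner_diff_bound:
  fixes H h h' :: "real \<Rightarrow> real"
  assumes H: "\<And>u. (H has_real_derivative h u) (at u)" "\<And>u. (h has_real_derivative h' u) (at u)"
    and B: "\<And>u. \<bar>u\<bar> \<le> r \<Longrightarrow> \<bar>h u\<bar> \<le> B" "\<And>u. \<bar>u\<bar> \<le> r \<Longrightarrow> \<bar>h' u\<bar> \<le> B'"
    and c: "\<bar>c\<bar> + \<bar>p\<bar> \<le> r" "\<bar>c\<bar> + \<bar>q\<bar> \<le> r"
  shows "\<bar>corner_diff H c (c + p) (c - q)\<bar> \<le> 2 * B * \<bar>p - q\<bar> + 2 * B' * p\<^sup>2"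
proof -
  have lip: "\<bar>H u - H v\<bar> \<le> B * \<bar>u - v\<bar>" if "\<bar>u\<bar> \<le> r" "\<bar>v\<bar> \<le> r" for u v
    by (rule field_differentiable_bound[of "{-r..r}" H h B u v, unfolded real_norm_def])
      (use that in \<open>auto intro!: has_field_derivative_at_within[OF H(1)] B\<close>)
  have liph: "\<bar>h u - h v\<bar> \<le> B' * \<bar>u - v\<bar>" if "\<bar>u\<bar> \<le> r" "\<bar>v\<bar> \<le> r" for u v
    by (rule field_differentiable_bound[of "{-r..r}" h h' B' u v, unfolded real_norm_def])
      (use that in \<open>auto intro!: has_field_derivative_at_within[OF H(2)] B\<close>)
  have B0: "0 \<le> B" "0 \<le> B'" using B(1)[of c] B(2)[of c] c by linarith+
  have sec: "\<bar>2 * H c - H (c + p) - H (c - p)\<bar> \<le> 2 * B' * p\<^sup>2"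
  proof -
    have "\<bar>(H (c + p) + H (c - p)) - (H (c + 0) + H (c - 0))\<bar> \<le> 2 * B' * \<bar>p\<bar> * \<bar>p - 0\<bar>"
    proof (rule field_differentiable_bound[of "{-\<bar>p\<bar>..\<bar>p\<bar>}" "\<lambda>t. H (c + t) + H (c - t)" "\<lambda>t. h (c + t) - h (c - t)", unfolded real_norm_def])
      fix t assume t: "t \<in> {-\<bar>p\<bar>..\<bar>p\<bar>}"
      have "((\<lambda>t. H (c + t) + H (c - t)) has_real_derivative h (c + t) * 1 + h (c - t) * (- 1)) (at t)"
        by (intro DERIV_add DERIV_chain2[OF H(1)]) (auto intro!: derivative_eq_intros)
      then show "((\<lambda>t. H (c + t) + H (c - t)) has_field_derivative h (c + t) - h (c - t)) (at t within {-\<bar>p\<bar>..\<bar>p\<bar>})"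
        by (simp add: has_field_derivative_at_within)
      have "\<bar>h (c + t) - h (c - t)\<bar> \<le> B' * \<bar>(c + t) - (c - t)\<bar>"
        by (rule liph) (use t c in auto)
      also have "\<dots> \<le> B' * (2 * \<bar>p\<bar>)" using t B0 by (intro mult_left_mono) auto
      finally show "\<bar>h (c + t) - h (c - t)\<bar> \<le> 2 * B' * \<bar>p\<bar>" by simp
    qed auto
    then show ?thesis by (simp add: power2_eq_square abs_mult_self algebra_simps)
  qed
  have pp: "0 \<le> 2 * B' * p\<^sup>2" using B0 by simp
  have mono: "B * x \<le> 2 * B * \<bar>p - q\<bar>" if "x \<le> \<bar>p - q\<bar>" for x
  proof -
    have "B * x \<le> B * \<bar>p - q\<bar>" using that B0 by (intro mult_left_mono)
    moreover have "0 \<le> B * \<bar>p - q\<bar>" using B0 by simp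
    ultimately show ?thesis by linarith
  qed
  show ?thesis
  proof (cases "p \<ge> 0")
    case True
    then have eq: "corner_diff H c (c + p) (c - q) = - (H (max (c - q) c) - H c)" by (simp add: corner_diff_def max_absorb2)
    show ?thesis
    proof (cases "q \<ge> 0")
      case True then show ?thesis unfolding eq using B0 by (simp add: max_absorb2)
    next
      case False
      then have "\<bar>H (c - q) - H c\<bar> \<le> B * \<bar>c - q - c\<bar>" using c by (intro lip) auto
      also have "\<dots> \<le> 2 * B * \<bar>p - q\<bar>" using True False by (intro mono) auto
      finally show ?thesis unfolding eq using False pp by (simp add: max_absorb1)
    qed
  next
    case False
    show ?thesis
    proof (cases "q \<ge> 0")
      case True
      then have "\<bar>corner_diff H c (c + p) (c - q)\<bar> = \<bar>H c - H (c + p)\<bar>" using False by (simp add: corner_diff_def max_absorb1 max_absorb2)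
      also have "\<dots> \<le> B * \<bar>c - (c + p)\<bar>" using c by (intro lip) auto
      also have "\<dots> \<le> 2 * B * \<bar>p - q\<bar>" using True False by (intro mono) auto
      finally show ?thesis using pp by linarith
    next
      case q: False
      then have "\<bar>corner_diff H c (c + p) (c - q)\<bar> = \<bar>(2 * H c - H (c + p) - H (c - p)) + (H (c - p) - H (c - q))\<bar>"
        using False by (simp add: corner_diff_def max_absorb1)
      also have "\<dots> \<le> 2 * B' * p\<^sup>2 + B * \<bar>(c - p) - (c - q)\<bar>"
        using sec lip[of "c - p" "c - q"] c by (intro order_trans[OF abs_triangle_ineq] add_mono) auto
      also have "B * \<bar>(c - p) - (c - q)\<bar> \<le> 2 * B * \<bar>p - q\<bar>" by (intro mono) auto
      finally show ?thesis by linarith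
    qed
  qed
qed


section \<open>Null sets and grid averages\<close>

text \<open>Simple zeros are isolated, and intervals with rational end points separate them.\<close>

lemma countable_simple_zeros:
  fixes f :: "real \<Rightarrow> real"
  assumes "\<And>t. t \<in> E \<Longrightarrow> f t = 0" "\<And>t. t \<in> E \<Longrightarrow> \<exists>d. (f has_real_derivative d) (at t) \<and> d \<noteq> 0"
  shows "countable E"
proof -
  have iso: "\<exists>p\<in>\<rat>. \<exists>q\<in>\<rat>. p < t \<and> t < q \<and> (\<forall>s\<in>E. p < s \<and> s < q \<longrightarrow> s = t)" if t: "t \<in> E" for t
  proof -
    obtain d where d: "(f has_real_derivative d) (at t)" "d \<noteq> 0" using assms(2)[OF t] by blast
    have "((\<lambda>s. (f s - f t) / (s - t)) \<longlongrightarrow> d) (at t)" using d(1) unfolding has_field_derivative_iff .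
    then have "eventually (\<lambda>s. (f s - f t) / (s - t) \<noteq> 0) (at t)"
      using d(2) tendsto_imp_eventually_ne by blast
    then obtain e where e: "e > 0" "\<And>s. s \<noteq> t \<Longrightarrow> dist s t < e \<Longrightarrow> (f s - f t) / (s - t) \<noteq> 0"
      unfolding eventually_at by blast
    obtain p q where pq: "p \<in> \<rat>" "t - e < p" "p < t" "q \<in> \<rat>" "t < q" "q < t + e"
      using Rats_dense_in_real[of "t - e" t] Rats_dense_in_real[of t "t + e"] e(1) by auto
    have "s = t" if s: "s \<in> E" "p < s" "s < q" for s
    proof (rule ccontr)
      assume "s \<noteq> t"
      moreover have "dist s t < e" using s pq by (auto simp: dist_real_def)
      ultimately show False using e(2) assms(1)[OF s(1)] assms(1)[OF t] by fastforce
    qed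
    then show ?thesis using pq by blast
  qed
  have "E \<subseteq> (\<lambda>(p, q). THE t. t \<in> E \<and> p < t \<and> t < q) ` (\<rat> \<times> \<rat>)"
  proof
    fix t assume t: "t \<in> E"
    obtain p q where pq: "p \<in> \<rat>" "q \<in> \<rat>" "p < t" "t < q" "\<And>s. s \<in> E \<Longrightarrow> p < s \<Longrightarrow> s < q \<Longrightarrow> s = t"
      using iso[OF t] by blast
    have "(THE t. t \<in> E \<and> p < t \<and> t < q) = t" by (rule the_equality) (use t pq in blast)+
    then show "t \<in> (\<lambda>(p, q). THE t. t \<in> E \<and> p < t \<and> t < q) ` (\<rat> \<times> \<rat>)"
      using pq(1,2) by (auto intro!: image_eqI[of _ _ "(p, q)"])
  qed
  then show ?thesis by (rule countable_subset) (intro countable_image countable_SIGMA countable_rat)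
qed

lemma emeasure_lborel_translate:
  fixes E :: "'a::euclidean_space set"
  assumes "E \<in> sets borel"
  shows "(\<integral>\<^sup>+x. indicator E (x + v) \<partial>lborel) = emeasure lborel E"
proof -
  have "(\<integral>\<^sup>+x. indicator E (x + v) \<partial>lborel) = (\<integral>\<^sup>+x. indicator E x \<partial>distr lborel borel ((+) v))"
    using assms by (subst nn_integral_distr) (auto simp: add.commute)
  then show ?thesis using assms by (simp add: lborel_distr_plus)
qed

text \<open>Fubini along a direction, without splitting the space into coordinates: average the indicator
  over the translates by \<open>t *\<^sub>R v\<close>, \<open>t \<in> [0, 1]\<close>.\<close>

lemma null_set_countable_lines:
  fixes E :: "'a::euclidean_space set"
  assumes E: "E \<in> sets borel" and lines: "\<And>x. countable {t::real. x + t *\<^sub>R v \<in> E}"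
  shows "E \<in> null_sets lborel"
proof -
  have meas: "(\<lambda>(t, x). (indicator E (x + t *\<^sub>R v) :: ennreal) * indicator {0..1} t)
      \<in> borel_measurable ((lborel :: real measure) \<Otimes>\<^sub>M lborel)"
    using E by measurable
  have "emeasure lborel E = (\<integral>\<^sup>+t. emeasure lborel E * indicator {0..1::real} t \<partial>lborel)"
    by (subst nn_integral_cmult_indicator) auto
  also have "\<dots> = (\<integral>\<^sup>+t. (\<integral>\<^sup>+x. indicator E (x + t *\<^sub>R v) * indicator {0..1::real} t \<partial>lborel) \<partial>lborel)"
    using emeasure_lborel_translate[OF E]
    by (intro nn_integral_cong) (auto simp: nn_integral_multc split: split_indicator)
  also have "\<dots> = (\<integral>\<^sup>+x. (\<integral>\<^sup>+t. indicator E (x + t *\<^sub>R v) * indicator {0..1::real} t \<partial>lborel) \<partial>lborel)"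
    using lborel_pair.Fubini'[OF meas] by simp
  also have "\<dots> = (\<integral>\<^sup>+x. 0 \<partial>(lborel :: 'a measure))"
  proof (rule nn_integral_cong)
    fix x :: 'a
    have "{t::real. x + t *\<^sub>R v \<in> E} \<in> null_sets lborel" by (rule countable_imp_null_set_lborel[OF lines])
    then have "AE t in lborel. t \<notin> {t::real. x + t *\<^sub>R v \<in> E}" by (rule AE_not_in)
    then have "AE t in lborel. indicator E (x + t *\<^sub>R v) * indicator {0..1} t = (0::ennreal)"
      by eventually_elim (auto simp: indicator_def)
    then show "(\<integral>\<^sup>+t. indicator E (x + t *\<^sub>R v) * indicator {0..1::real} t \<partial>lborel) = 0"
      by (subst nn_integral_cong_AE[where v = "\<lambda>_. 0"]) auto
  qed
  finally show ?thesis using E by (simp add: null_sets_def)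
qed

text \<open>On each line in direction i these points are simple zeros. Applied to g it makes level
  sets null up to critical points; applied to a partial derivative it shows that its zeros are
  almost all flat along the axis.\<close>

lemma null_set_level:
  fixes w :: "real^2 \<Rightarrow> real"
  assumes W: "open W" and C1: "C1_on W w"
  shows "{x \<in> W. w x = c \<and> partial_deriv i w x \<noteq> 0} \<in> null_sets lborel"
proof (rule null_set_countable_lines[where v = "axis i 1"])
  have Wb: "W \<in> sets borel" using W by simp
  have "(\<lambda>x. indicator W x *\<^sub>R w x) \<in> borel_measurable borel" "(\<lambda>x. indicator W x *\<^sub>R partial_deriv i w x) \<in> borel_measurable borel"
    using borel_measurable_continuous_on_indicator[OF Wb] C1_on_imp[OF C1] by blast+
  then have "{x. indicator W x *\<^sub>R w x = c} \<in> sets borel" "{x. indicator W x *\<^sub>R partial_deriv i w x \<noteq> 0} \<in> sets borel"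
  proof -
    assume m: "(\<lambda>x. indicator W x *\<^sub>R w x) \<in> borel_measurable borel" "(\<lambda>x. indicator W x *\<^sub>R partial_deriv i w x) \<in> borel_measurable borel"
    show "{x. indicator W x *\<^sub>R w x = c} \<in> sets borel"
      using measurable_sets[OF m(1), of "{c}"] by (simp add: vimage_def)
    have "- {0::real} \<in> sets borel" by simp
    from measurable_sets[OF m(2) this] show "{x. indicator W x *\<^sub>R partial_deriv i w x \<noteq> 0} \<in> sets borel"
      by (simp add: vimage_def)
  qed
  moreover have "{x \<in> W. w x = c \<and> partial_deriv i w x \<noteq> 0} =
      W \<inter> {x. indicator W x *\<^sub>R w x = c} \<inter> {x. indicator W x *\<^sub>R partial_deriv i w x \<noteq> 0}"
    by (auto simp: indicator_def)
  ultimately show "{x \<in> W. w x = c \<and> partial_deriv i w x \<noteq> 0} \<in> sets borel" using Wb by simp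
  fix x
  show "countable {t::real. x + t *\<^sub>R axis i 1 \<in> {x \<in> W. w x = c \<and> partial_deriv i w x \<noteq> 0}}"
  proof (rule countable_simple_zeros[where f = "\<lambda>t. w (x + t *\<^sub>R axis i 1) - c"])
    fix t assume t: "t \<in> {t::real. x + t *\<^sub>R axis i 1 \<in> {x \<in> W. w x = c \<and> partial_deriv i w x \<noteq> 0}}"
    then show "w (x + t *\<^sub>R axis i 1) - c = 0" by simp
    have "w differentiable (at (x + t *\<^sub>R axis i 1))" using t C1_on_imp(1)[OF C1] by blast
    from axis_line_has_real_derivative[OF this] t
    show "\<exists>d. ((\<lambda>t. w (x + t *\<^sub>R axis i 1) - c) has_real_derivative d) (at t) \<and> d \<noteq> 0"
      by (intro exI[of _ "partial_deriv i w (x + t *\<^sub>R axis i 1)"]) (auto intro!: derivative_eq_intros)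
  qed
qed

lemma lborel_integral_translate:
  fixes f :: "'a::euclidean_space \<Rightarrow> real"
  assumes "f \<in> borel_measurable borel"
  shows "(\<integral>x. f (x + v) \<partial>lborel) = (\<integral>x. f x \<partial>lborel)"
    and "integrable lborel (\<lambda>x. f (x + v)) \<longleftrightarrow> integrable lborel f"
proof -
  have eq: "f (x + v) = f ((+) v x)" for x by (simp add: add.commute)
  show "(\<integral>x. f (x + v) \<partial>lborel) = (\<integral>x. f x \<partial>lborel)"
    unfolding eq using assms integral_distr[of "(+) v" lborel borel f] by (simp add: lborel_distr_plus)
  show "integrable lborel (\<lambda>x. f (x + v)) \<longleftrightarrow> integrable lborel f"
    unfolding eq using assms integrable_distr_eq[of "(+) v" lborel borel f] by (simp add: lborel_distr_plus)
qed

text \<open>Half-open, so that its grid translates tile the plane exactly.\<close>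

definition cell :: "real \<Rightarrow> (real^2) set" where
  "cell e = {x. 0 \<le> x$1 \<and> x$1 < e \<and> 0 \<le> x$2 \<and> x$2 < e}"

lemma cell_borel [measurable]: "cell e \<in> sets borel"
proof -
  have "(\<lambda>x::real^2. x $ i) \<in> borel_measurable borel" for i by measurable
  then show ?thesis unfolding cell_def by measurable
qed

lemma measure_cell:
  assumes "e > 0"
  shows "emeasure lborel (cell e) = ennreal (e\<^sup>2)"
proof (rule antisym)
  let ?b = "vec e :: real^2"
  have cb: "emeasure lborel (cbox 0 ?b) = ennreal (e\<^sup>2)"
  proof -
    have "cbox 0 ?b \<noteq> {}" using assms by (auto simp: interval_eq_empty_cart forall_2 not_less)
    then have "measure lborel (cbox 0 ?b) = e\<^sup>2"
      by (simp add: content_cbox_cart UNIV_2 power2_eq_square)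
    then show ?thesis by (metis emeasure_eq_ennreal_measure emeasure_lborel_cbox_finite less_irrefl top.extremum_strict)
  qed
  have "cell e \<subseteq> cbox 0 ?b" by (auto simp: cell_def mem_box_cart forall_2)
  then have "emeasure lborel (cell e) \<le> emeasure lborel (cbox 0 ?b)" by (intro emeasure_mono) auto
  also note cb
  finally show "emeasure lborel (cell e) \<le> ennreal (e\<^sup>2)" .
  have "box 0 ?b \<subseteq> cell e" by (auto simp: cell_def mem_box_cart forall_2)
  then have "emeasure lborel (box 0 ?b) \<le> emeasure lborel (cell e)" by (intro emeasure_mono) auto
  moreover have "emeasure lborel (box 0 ?b) = ennreal (e\<^sup>2)"
    unfolding cb[symmetric] by (simp add: emeasure_lborel_box_eq emeasure_lborel_cbox_eq)
  ultimately show "ennreal (e\<^sup>2) \<le> emeasure lborel (cell e)" by simp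
qed

lemma cell_unique:
  assumes "e > 0"
  shows "x - e *\<^sub>R pv p \<in> cell e \<longleftrightarrow> p = (\<lfloor>x$1 / e\<rfloor>, \<lfloor>x$2 / e\<rfloor>)"
proof -
  have "(0 \<le> y - e * of_int k \<and> y - e * of_int k < e) \<longleftrightarrow> k = \<lfloor>y / e\<rfloor>" for y :: real and k :: int
  proof -
    have "(0 \<le> y - e * of_int k \<and> y - e * of_int k < e) \<longleftrightarrow> of_int k \<le> y / e \<and> y / e < of_int k + 1"
      using assms by (simp add: field_simps)
    also have "\<dots> \<longleftrightarrow> k = \<lfloor>y / e\<rfloor>" by linarith
    finally show ?thesis .
  qed
  then show ?thesis by (cases p) (auto simp: cell_def)
qed

text \<open>The plane is folded onto one cell: the integral of f becomes the integral, over a cell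
  of area e^2, of the sum of f over the translated grid.\<close>

lemma integral_grid_average:
  fixes f :: "real^2 \<Rightarrow> real"
  assumes e: "e > 0" and f: "integrable lborel f" and B: "finite B"
    and supp: "\<And>p x. p \<notin> B \<Longrightarrow> x \<in> cell e \<Longrightarrow> f (x + e *\<^sub>R pv p) = 0"
    and avg: "\<And>x. x \<in> cell e \<Longrightarrow> (\<Sum>p\<in>B. f (x + e *\<^sub>R pv p)) = c"
  shows "(\<integral>x. f x \<partial>lborel) = e\<^sup>2 * c"
proof -
  have fm: "f \<in> borel_measurable borel" using f by auto
  have "f x = (\<Sum>p\<in>B. f x * indicator (cell e) (x - e *\<^sub>R pv p))" for x
  proof -
    let ?p = "(\<lfloor>x$1 / e\<rfloor>, \<lfloor>x$2 / e\<rfloor>)"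
    have ind: "indicator (cell e) (x - e *\<^sub>R pv p) = (if p = ?p then 1 else (0::real))" for p
      using cell_unique[OF e, of x p] by (simp add: indicator_def)
    have "(\<Sum>p\<in>B. f x * indicator (cell e) (x - e *\<^sub>R pv p)) = (if ?p \<in> B then f x else 0)"
      using B by (simp add: ind if_distrib[of "\<lambda>y. f x * y"] cong: if_cong)
    moreover have "f x = 0" if "?p \<notin> B"
      using supp[OF that, of "x - e *\<^sub>R pv ?p"] cell_unique[OF e, of x ?p] by simp
    ultimately show ?thesis by auto
  qed
  then have "(\<integral>x. f x \<partial>lborel) = (\<integral>x. (\<Sum>p\<in>B. f x * indicator (cell e) (x - e *\<^sub>R pv p)) \<partial>lborel)"
    by (rule Bochner_Integration.integral_cong[OF refl])
  also have "\<dots> = (\<Sum>p\<in>B. \<integral>x. f x * indicator (cell e) (x - e *\<^sub>R pv p) \<partial>lborel)"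
  proof (rule Bochner_Integration.integral_sum)
    fix p
    have "(\<lambda>x. indicator (cell e) (x - e *\<^sub>R pv p) :: real) \<in> borel_measurable lborel" by measurable
    moreover have "AE x in lborel. norm (indicator (cell e) (x - e *\<^sub>R pv p) :: real) \<le> 1" by (auto simp: indicator_def)
    ultimately show "integrable lborel (\<lambda>x. f x * indicator (cell e) (x - e *\<^sub>R pv p))"
      using integrable_real_mult_indicator[of "{x. x - e *\<^sub>R pv p \<in> cell e}" lborel f] f
      by (intro Bochner_Integration.integrable_bound[OF f]) (auto simp: indicator_def)
  qed
  also have "\<dots> = (\<Sum>p\<in>B. \<integral>x. f (x + e *\<^sub>R pv p) * indicator (cell e) x \<partial>lborel)"
  proof (rule sum.cong[OF refl])
    fix p
    have m: "(\<lambda>x. f x * indicator (cell e) (x - e *\<^sub>R pv p)) \<in> borel_measurable borel" using fm by measurable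
    from lborel_integral_translate(1)[OF m, of "e *\<^sub>R pv p"]
    show "(\<integral>x. f x * indicator (cell e) (x - e *\<^sub>R pv p) \<partial>lborel) = (\<integral>x. f (x + e *\<^sub>R pv p) * indicator (cell e) x \<partial>lborel)"
      by simp
  qed
  also have "\<dots> = (\<integral>x. (\<Sum>p\<in>B. f (x + e *\<^sub>R pv p) * indicator (cell e) x) \<partial>lborel)"
  proof (rule Bochner_Integration.integral_sum[symmetric])
    fix p
    have i: "integrable lborel (\<lambda>x. f (x + e *\<^sub>R pv p))" using lborel_integral_translate(2)[OF fm] f by blast
    show "integrable lborel (\<lambda>x. f (x + e *\<^sub>R pv p) * indicator (cell e) x)"
      using fm by (intro Bochner_Integration.integrable_bound[OF i]) (auto simp: indicator_def)
  qed
  also have "\<dots> = (\<integral>x. c * indicator (cell e) x \<partial>lborel)"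
    by (intro Bochner_Integration.integral_cong) (auto simp flip: sum_distrib_right simp: avg indicator_def)
  also have "\<dots> = e\<^sup>2 * c"
    using measure_cell[OF e] by (simp add: measure_def)
  finally show ?thesis .
qed


section \<open>The grid functional of a smooth function\<close>

lemma C2_on_imp:
  assumes "C2_on W g"
  shows "C1_on W g" "C1_on W (partial_deriv i g)"
  using assms by (auto simp: C2_on_def)

lemma axis_line_bounds:
  fixes g :: "real^2 \<Rightarrow> real"
  assumes sub: "cball x \<rho> \<subseteq> A" and A: "A \<subseteq> W" and C2: "C2_on W g"
    and B1: "\<And>y. y \<in> A \<Longrightarrow> \<bar>partial_deriv i g y\<bar> \<le> B1"
    and B2: "\<And>y. y \<in> A \<Longrightarrow> \<bar>partial_deriv i (partial_deriv i g) y\<bar> \<le> B2"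
    and e: "0 \<le> e" "e \<le> \<rho>"
  shows "\<bar>g (x + e *\<^sub>R axis i 1) - g x\<bar> \<le> B1 * e" "\<bar>g (x - e *\<^sub>R axis i 1) - g x\<bar> \<le> B1 * e"
    and "\<bar>g (x + e *\<^sub>R axis i 1) + g (x - e *\<^sub>R axis i 1) - 2 * g x\<bar> \<le> 2 * B2 * e\<^sup>2"
proof -
  let ?a = "axis i 1 :: real^2"
  have mem: "x + t *\<^sub>R ?a \<in> A" if "\<bar>t\<bar> \<le> e" for t
    using sub that e by (auto simp: subset_iff dist_norm norm_axis_1)
  have d1: "((\<lambda>t. g (x + t *\<^sub>R ?a)) has_real_derivative partial_deriv i g (x + t *\<^sub>R ?a)) (at t)" if "\<bar>t\<bar> \<le> e" for t
    using axis_line_has_real_derivative C1_on_imp(1)[OF C2_on_imp(1)[OF C2]] mem[OF that] A by blast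
  have d2: "((\<lambda>t. partial_deriv i g (x + t *\<^sub>R ?a)) has_real_derivative partial_deriv i (partial_deriv i g) (x + t *\<^sub>R ?a)) (at t)" if "\<bar>t\<bar> \<le> e" for t
    using axis_line_has_real_derivative C1_on_imp(1)[OF C2_on_imp(2)[OF C2]] mem[OF that] A by blast
  have lip: "\<bar>g (x + t *\<^sub>R ?a) - g (x + s *\<^sub>R ?a)\<bar> \<le> B1 * \<bar>t - s\<bar>" if "\<bar>t\<bar> \<le> e" "\<bar>s\<bar> \<le> e" for t s
    by (rule field_differentiable_bound[of "{-e..e}" "\<lambda>t. g (x + t *\<^sub>R ?a)" "\<lambda>t. partial_deriv i g (x + t *\<^sub>R ?a)", unfolded real_norm_def])
      (use that in \<open>auto intro!: has_field_derivative_at_within[OF d1] B1 mem\<close>)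
  have lip2: "\<bar>partial_deriv i g (x + t *\<^sub>R ?a) - partial_deriv i g (x + s *\<^sub>R ?a)\<bar> \<le> B2 * \<bar>t - s\<bar>" if "\<bar>t\<bar> \<le> e" "\<bar>s\<bar> \<le> e" for t s
    by (rule field_differentiable_bound[of "{-e..e}" "\<lambda>t. partial_deriv i g (x + t *\<^sub>R ?a)" "\<lambda>t. partial_deriv i (partial_deriv i g) (x + t *\<^sub>R ?a)", unfolded real_norm_def])
      (use that in \<open>auto intro!: has_field_derivative_at_within[OF d2] B2 mem\<close>)
  have mns: "x + (- t) *\<^sub>R ?a = x - t *\<^sub>R ?a" for t by simp
  show "\<bar>g (x + e *\<^sub>R ?a) - g x\<bar> \<le> B1 * e" "\<bar>g (x - e *\<^sub>R ?a) - g x\<bar> \<le> B1 * e"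
    using lip[of e 0] lip[of "- e" 0] e by simp_all
  have B20: "B2 \<ge> 0" using B2[OF mem[of 0]] e by (simp add: order_trans[OF abs_ge_zero])
  have "\<bar>(g (x + e *\<^sub>R ?a) + g (x + (- e) *\<^sub>R ?a)) - (g (x + 0 *\<^sub>R ?a) + g (x + (- 0) *\<^sub>R ?a))\<bar> \<le> 2 * B2 * e * \<bar>e - 0\<bar>"
  proof (rule field_differentiable_bound[of "{-e..e}" "\<lambda>t. g (x + t *\<^sub>R ?a) + g (x + (- t) *\<^sub>R ?a)"
        "\<lambda>t. partial_deriv i g (x + t *\<^sub>R ?a) - partial_deriv i g (x + (- t) *\<^sub>R ?a)", unfolded real_norm_def])
    fix t assume t: "t \<in> {-e..e}"
    then have t': "\<bar>t\<bar> \<le> e" "\<bar>- t\<bar> \<le> e" by auto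
    have "((\<lambda>t. g (x + (- t) *\<^sub>R ?a)) has_real_derivative - partial_deriv i g (x + (- t) *\<^sub>R ?a)) (at t)"
      using DERIV_mirror[where f = "\<lambda>t. g (x + t *\<^sub>R ?a)" and x = t and y = "partial_deriv i g (x + (- t) *\<^sub>R ?a)"] d1[OF t'(2)] by blast
    from DERIV_add[OF d1[OF t'(1)] this]
    show "((\<lambda>t. g (x + t *\<^sub>R ?a) + g (x + (- t) *\<^sub>R ?a)) has_real_derivative
        partial_deriv i g (x + t *\<^sub>R ?a) - partial_deriv i g (x + (- t) *\<^sub>R ?a)) (at t within {-e..e})"
      by (simp add: has_field_derivative_at_within)
    have "\<bar>partial_deriv i g (x + t *\<^sub>R ?a) - partial_deriv i g (x + (- t) *\<^sub>R ?a)\<bar> \<le> B2 * \<bar>t - - t\<bar>" by (rule lip2[OF t'])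
    also have "\<dots> \<le> B2 * (2 * e)" using t' B20 by (intro mult_left_mono) auto
    finally show "\<bar>partial_deriv i g (x + t *\<^sub>R ?a) - partial_deriv i g (x + (- t) *\<^sub>R ?a)\<bar> \<le> 2 * B2 * e" by simp
  qed (use e in auto)
  then show "\<bar>g (x + e *\<^sub>R ?a) + g (x - e *\<^sub>R ?a) - 2 * g x\<bar> \<le> 2 * B2 * e\<^sup>2"
    using e by (simp add: power2_eq_square)
qed

text \<open>Truncation at u commutes with maxima and minima, and H cannot see it.\<close>

lemma corner_diff_truncate:
  assumes "\<And>a. H (max a u) = H a"
  shows "corner_diff H (max c u) (max (max a u) (max b u)) (min (max a' u) (max b' u)) = corner_diff H c (max a b) (min a' b')"
proof -
  have "max (max c u) (max (max a u) (max b u)) = max (max c (max a b)) u" by linarith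
  moreover have "max (max a u) (max b u) = max (max a b) u" by linarith
  moreover have "max (min (max a' u) (max b' u)) (max c u) = max (max (min a' b') c) u" by linarith
  ultimately show ?thesis by (simp only: corner_diff_def assms)
qed

text \<open>\<open>G\<close> truncates \<open>g\<close> at the level \<open>u0\<close>, so that it makes sense on the whole plane.\<close>

locale excursion_field =
  fixes W :: "(real^2) set" and g :: "real^2 \<Rightarrow> real" and u0 :: real
  assumes W: "open W" and C2: "C2_on W g" and cK: "compact (excursion W g u0)"
begin

abbreviation "K \<equiv> excursion W g u0"

definition margin :: real where
  "margin = (SOME r. r > 0 \<and> (\<Union>x\<in>K. cball x r) \<subseteq> W \<and> compact (\<Union>x\<in>K. cball x r))"

definition N :: "(real^2) set" where "N = (\<Union>x\<in>K. cball x margin)"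

lemma K_W: "K \<subseteq> W" by (auto simp: excursion_def)

lemma margin: "margin > 0" "N \<subseteq> W" "compact N"
proof -
  have "\<exists>r. r > 0 \<and> (\<Union>x\<in>K. cball x r) \<subseteq> W \<and> compact (\<Union>x\<in>K. cball x r)"
    by (rule compact_cball_margin[OF cK W K_W]) blast
  from someI_ex[OF this] show "margin > 0" "N \<subseteq> W" "compact N" by (simp_all add: margin_def N_def)
qed

lemma K_N: "K \<subseteq> N" using margin(1) by (auto simp: N_def intro!: bexI)

lemmas C1 = C2_on_imp(1)[OF C2] C2_on_imp(2)[OF C2]

lemma bounded_on_N:
  assumes "continuous_on W (f :: real^2 \<Rightarrow> real)"
  shows "\<exists>B\<ge>0. \<forall>x\<in>N. \<bar>f x\<bar> \<le> B"
proof -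
  have "compact (f ` N)" using compact_continuous_image[OF continuous_on_subset[OF assms margin(2)] margin(3)] .
  then obtain B where "\<forall>x\<in>N. \<bar>f x\<bar> \<le> B" by (auto dest!: compact_imp_bounded simp: bounded_iff)
  then show ?thesis by (intro exI[of _ "max B 0"]) (simp add: le_max_iff_disj)
qed

definition G :: "real^2 \<Rightarrow> real" where "G x = (if x \<in> K then g x else u0)"

lemma G_eq: "x \<in> W \<Longrightarrow> G x = max (g x) u0"
  by (auto simp: G_def excursion_def)

lemma G_measurable [measurable]: "G \<in> borel_measurable borel"
proof -
  have Kb [measurable]: "K \<in> sets borel" using cK by (simp add: borel_compact)
  have "continuous_on K g" using C1_on_imp(3)[OF C1(1)] K_W continuous_on_subset by blast
  from borel_measurable_continuous_on_indicator[OF Kb this]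
  have [measurable]: "(\<lambda>x. indicator K x *\<^sub>R g x) \<in> borel_measurable borel" .
  have "G = (\<lambda>x. indicator K x *\<^sub>R g x + u0 * (1 - indicator K x))"
    by (auto simp: G_def fun_eq_iff indicator_def)
  moreover have "(\<lambda>x. indicator K x *\<^sub>R g x + u0 * (1 - indicator K x)) \<in> borel_measurable borel" by measurable
  ultimately show ?thesis by simp
qed

definition upper :: "real \<Rightarrow> real^2 \<Rightarrow> real" where
  "upper e x = max (G (x + e *\<^sub>R axis 1 1)) (G (x + e *\<^sub>R axis 2 1))"

definition lower :: "real \<Rightarrow> real^2 \<Rightarrow> real" where
  "lower e x = min (G (x - e *\<^sub>R axis 1 1)) (G (x - e *\<^sub>R axis 2 1))"

definition corner :: "(real \<Rightarrow> real) \<Rightarrow> real \<Rightarrow> real^2 \<Rightarrow> real" where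
  "corner H e x = corner_diff H (G x) (upper e x) (lower e x)"

lemma upper_lower_measurable [measurable]:
  "upper e \<in> borel_measurable borel" "lower e \<in> borel_measurable borel"
  unfolding upper_def[abs_def] lower_def[abs_def] by measurable

lemma outside:
  assumes "0 \<le> e" "\<And>y. y \<in> K \<Longrightarrow> dist y x > e"
  shows "G x = u0" "upper e x = u0" "lower e x = u0"
proof -
  have x: "x \<notin> K" using assms(2)[of x] assms(1) by auto
  have "x + e *\<^sub>R axis i 1 \<notin> K" "x - e *\<^sub>R axis i 1 \<notin> K" for i :: 2
    using assms(2)[of "x + e *\<^sub>R axis i 1"] assms(2)[of "x - e *\<^sub>R axis i 1"] assms(1) by (auto simp: dist_norm norm_axis_1)
  then show "G x = u0" "upper e x = u0" "lower e x = u0"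
    using x by (simp_all add: G_def upper_def lower_def)
qed

lemma corner_outside:
  assumes "0 \<le> e" "\<And>y. y \<in> K \<Longrightarrow> dist y x > e"
  shows "corner H e x = 0"
  using outside[OF assms] by (simp add: corner_def corner_diff_def)

lemma corner_eq:
  assumes H: "\<And>a. H (max a u0) = H a" and x: "x \<in> W" and e: "\<And>i. x + e *\<^sub>R axis i 1 \<in> W" "\<And>i. x - e *\<^sub>R axis i 1 \<in> W"
  shows "corner H e x = corner_diff H (g x) (max (g (x + e *\<^sub>R axis 1 1)) (g (x + e *\<^sub>R axis 2 1)))
    (min (g (x - e *\<^sub>R axis 1 1)) (g (x - e *\<^sub>R axis 2 1)))"
  unfolding corner_def upper_def lower_def G_eq[OF x] G_eq[OF e(1)] G_eq[OF e(2)]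
  by (rule corner_diff_truncate[where H = H and u = u0, OF H])

end

locale excursion_test = excursion_field +
  fixes H h h' :: "real \<Rightarrow> real"
  assumes H: "\<And>u. (H has_real_derivative h u) (at u)"
    and h: "\<And>u. (h has_real_derivative h' u) (at u)"
    and h'_cont: "continuous_on UNIV h'"
    and h_zero: "\<And>u. u \<le> u0 \<Longrightarrow> h u = 0"
begin

lemma h_cont: "continuous_on UNIV h"
  using h by (meson DERIV_isCont continuous_at_imp_continuous_on)

lemma H_cont: "continuous_on UNIV H"
  using H by (meson DERIV_isCont continuous_at_imp_continuous_on)

lemma H_const: "H (max a u0) = H a"
proof (cases "a < u0")
  case True
  have "\<exists>z>a. z < u0 \<and> H u0 - H a = (u0 - a) * h z" using True by (intro MVT2 H) auto
  then obtain z where "z < u0" "H u0 - H a = (u0 - a) * h z" by auto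
  then show ?thesis using h_zero[of z] True by (simp add: max_absorb2)
qed (simp add: max_absorb1)

lemma h'_zero: "u \<le> u0 \<Longrightarrow> h' u = 0"
proof -
  assume u: "u \<le> u0"
  have "((\<lambda>t. (h t - h u) / (t - u)) \<longlongrightarrow> h' u) (at u)" using h[of u] unfolding has_field_derivative_iff .
  then have "((\<lambda>t. (h t - h u) / (t - u)) \<longlongrightarrow> h' u) (at_left u)" by (rule tendsto_mono[rotated]) (simp add: at_le)
  moreover have "((\<lambda>t. (h t - h u) / (t - u)) \<longlongrightarrow> 0) (at_left u)"
  proof (rule Lim_transform_eventually[OF tendsto_const])
    show "eventually (\<lambda>t. 0 = (h t - h u) / (t - u)) (at_left u)"
      using u h_zero by (auto simp: eventually_at_left_field intro!: exI[of _ "u - 1"])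
  qed
  ultimately show "h' u = 0" by (rule tendsto_unique[OF trivial_limit_at_left_real])
qed

text \<open>The majorant for dominated convergence after division by e^2. Far from the excursion set
  all sampled values of \<open>G\<close> equal u0 and the difference vanishes.\<close>

lemma corner_bound:
  obtains C where "C \<ge> 0" "\<And>e x. 0 < e \<Longrightarrow> e \<le> margin / 2 \<Longrightarrow> \<bar>corner H e x\<bar> \<le> C * e\<^sup>2 * indicator N x"
proof -
  obtain B0 where B0: "B0 \<ge> 0" "\<And>x. x \<in> N \<Longrightarrow> \<bar>g x\<bar> \<le> B0" using bounded_on_N[OF C1_on_imp(3)[OF C1(1)]] by blast
  obtain b1 where "b1 \<ge> 0" and b1: "\<And>x. x \<in> N \<Longrightarrow> \<bar>partial_deriv 1 g x\<bar> \<le> b1" using bounded_on_N[OF C1_on_imp(2)[OF C1(1)]] by blast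
  obtain b2 where "b2 \<ge> 0" and b2: "\<And>x. x \<in> N \<Longrightarrow> \<bar>partial_deriv 2 g x\<bar> \<le> b2" using bounded_on_N[OF C1_on_imp(2)[OF C1(1)]] by blast
  obtain c1 where "c1 \<ge> 0" and c1: "\<And>x. x \<in> N \<Longrightarrow> \<bar>partial_deriv 1 (partial_deriv 1 g) x\<bar> \<le> c1" using bounded_on_N[OF C1_on_imp(2)[OF C1(2)]] by blast
  obtain c2 where "c2 \<ge> 0" and c2: "\<And>x. x \<in> N \<Longrightarrow> \<bar>partial_deriv 2 (partial_deriv 2 g) x\<bar> \<le> c2" using bounded_on_N[OF C1_on_imp(2)[OF C1(2)]] by blast
  define B1 where "B1 = max 0 (max b1 b2)"
  define B2 where "B2 = max 0 (max c1 c2)"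
  have B1: "\<bar>partial_deriv i g x\<bar> \<le> B1" if "x \<in> N" for x i
    using b1[OF that] b2[OF that] exhaust_2[of i] by (auto simp: B1_def le_max_iff_disj)
  have B2: "\<bar>partial_deriv i (partial_deriv i g) x\<bar> \<le> B2" if "x \<in> N" for x i
    using c1[OF that] c2[OF that] exhaust_2[of i] by (auto simp: B2_def le_max_iff_disj)
  have pos: "B1 \<ge> 0" "B2 \<ge> 0" by (simp_all add: B1_def B2_def)
  define r where "r = B0 + B1 * margin"
  have "compact (h ` {-r..r})" "compact (h' ` {-r..r})"
    by (auto intro!: compact_continuous_image continuous_on_subset[OF h_cont] continuous_on_subset[OF h'_cont])
  then obtain Bh Bh' where "\<forall>u\<in>{-r..r}. \<bar>h u\<bar> \<le> Bh" "\<forall>u\<in>{-r..r}. \<bar>h' u\<bar> \<le> Bh'"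
    by (auto dest!: compact_imp_bounded simp: bounded_iff)
  then have Bh: "\<bar>h u\<bar> \<le> Bh" "\<bar>h' u\<bar> \<le> Bh'" if "\<bar>u\<bar> \<le> r" for u using that by (auto simp: abs_le_iff)
  have "r \<ge> 0" using B0 pos margin(1) by (simp add: r_def)
  then have Bh0: "Bh \<ge> 0" "Bh' \<ge> 0" using Bh[of 0] by auto
  show ?thesis
  proof (rule that)
    show "4 * Bh * B2 + 2 * Bh' * B1\<^sup>2 \<ge> 0" using pos Bh0 by simp
    fix e x assume e: "0 < e" "e \<le> margin / 2"
    show "\<bar>corner H e x\<bar> \<le> (4 * Bh * B2 + 2 * Bh' * B1\<^sup>2) * e\<^sup>2 * indicator N x"
    proof (cases "\<exists>y\<in>K. dist y x \<le> e")
      case False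
      then have "corner H e x = 0" using e by (intro corner_outside) (auto simp: not_le)
      then show ?thesis using pos Bh0 by (simp add: indicator_def)
    next
      case True
      then obtain y where y: "y \<in> K" "dist y x \<le> e" by blast
      have sub: "cball x e \<subseteq> N"
      proof
        fix z assume "z \<in> cball x e"
        then have "dist y z \<le> margin" using y(2) e dist_triangle[of y z x] by auto
        then show "z \<in> N" using y(1) by (auto simp: N_def)
      qed
      have xN: "x \<in> N" using sub e by auto
      have mem: "x + e *\<^sub>R axis i 1 \<in> N" "x - e *\<^sub>R axis i 1 \<in> N" for i :: 2
        using sub e by (auto simp: subset_iff dist_norm norm_axis_1)
      note b = axis_line_bounds[OF sub margin(2) C2 B1 B2 less_imp_le[OF e(1)] order_refl]
      let ?a = "\<lambda>i. g (x + e *\<^sub>R axis i 1)" and ?b = "\<lambda>i. g (x - e *\<^sub>R axis i 1)"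
      define p where "p = max (?a 1) (?a 2) - g x"
      define q where "q = g x - min (?b 1) (?b 2)"
      have p: "\<bar>p\<bar> \<le> B1 * e" using b(1)[of 1] b(1)[of 2] unfolding p_def by linarith
      have q: "\<bar>q\<bar> \<le> B1 * e" using b(2)[of 1] b(2)[of 2] unfolding q_def by linarith
      \<comment> \<open>The larger forward value plus the smaller backward value lies between the
        sums of forward and backward values along the two axes, so p - q inherits the second order
        bound of these symmetric differences.\<close>
      have pq: "\<bar>p - q\<bar> \<le> 2 * B2 * e\<^sup>2" using b(3)[of 1] b(3)[of 2] unfolding p_def q_def by linarith
      have "B1 * e \<le> B1 * margin" using e margin(1) pos by (intro mult_left_mono) auto
      then have "\<bar>g x\<bar> + \<bar>p\<bar> \<le> r" "\<bar>g x\<bar> + \<bar>q\<bar> \<le> r" using p q B0(2)[OF xN] by (auto simp: r_def)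
      from corner_diff_bound[of H h h' r Bh Bh', OF H h Bh this]
      have "\<bar>corner_diff H (g x) (g x + p) (g x - q)\<bar> \<le> 2 * Bh * \<bar>p - q\<bar> + 2 * Bh' * p\<^sup>2" .
      also have "corner_diff H (g x) (g x + p) (g x - q) = corner H e x"
        using corner_eq[of H x e] H_const xN mem margin(2) by (simp add: p_def q_def subset_iff)
      also have "2 * Bh * \<bar>p - q\<bar> + 2 * Bh' * p\<^sup>2 \<le> 2 * Bh * (2 * B2 * e\<^sup>2) + 2 * Bh' * (B1 * e)\<^sup>2"
        using pq p Bh0 by (intro add_mono mult_left_mono power2_le_iff_abs_le[THEN iffD2]) (auto simp: power2_le_iff_abs_le pos e)
      finally show ?thesis using xN by (simp add: power_mult_distrib algebra_simps)
    qed
  qed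
qed

lemma gamma_outside: "x \<notin> K \<Longrightarrow> x \<in> W \<Longrightarrow> gamma x g h = 0"
  using h_zero[of "g x"] h'_zero[of "g x"] DERIV_imp_deriv[OF h]
  by (auto simp: gamma_def gamma_dir_def excursion_def)

text \<open>On \<open>K\<close> the sign pattern of the gradient leaves six cases: the two regions
  \<open>Q\<close>, an increasing first or second axis, and the two half-axes bordering the negative
  quadrant. The condition \<open>flat\<close> settles the half-axes; \<open>diag\<close> removes the
  ray on which neither axis dominates.\<close>

lemma tendsto_corner:
  assumes x: "x \<in> W"
    and crit: "x \<in> K \<Longrightarrow> grad g x \<noteq> 0"
    and diag: "x \<in> K \<Longrightarrow> \<not> (partial_deriv 1 g x = partial_deriv 2 g x \<and> partial_deriv 1 g x < 0)"
    and flat: "\<And>i. x \<in> K \<Longrightarrow> partial_deriv i g x = 0 \<Longrightarrow> partial_deriv i (partial_deriv i g) x = 0"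
  shows "((\<lambda>e. corner H e x / e\<^sup>2) \<longlongrightarrow> - gamma x g h) (at_right 0)"
proof (cases "x \<in> K")
  case False
  have "closed K" using cK by (rule compact_imp_closed)
  then obtain d where d: "d > 0" "ball x d \<subseteq> - K"
    using False open_contains_ball[of "- K"] by auto
  have "eventually (\<lambda>e. e < d) (at_right 0)" "eventually (\<lambda>e::real. 0 < e) (at_right 0)"
    using d(1) by (auto simp: eventually_at_right_field)
  then have "eventually (\<lambda>e. 0 = corner H e x / e\<^sup>2) (at_right 0)"
  proof eventually_elim
    case (elim e)
    have "dist y x > e" if "y \<in> K" for y
      using d(2) that elim by (metis ComplD dist_commute dual_order.strict_trans1 linorder_not_less mem_ball subsetD)
    then show ?case using corner_outside[of e x H] elim by simp
  qed
  then show ?thesis using gamma_outside[OF False x] by (simp add: Lim_transform_eventually[OF tendsto_const])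
next
  case True
  have ball: "x + t *\<^sub>R axis i 1 \<in> W" if "\<bar>t\<bar> < margin" for t and i :: 2
  proof -
    have "x + t *\<^sub>R axis i 1 \<in> N" using True that by (auto simp: N_def dist_norm norm_axis_1 intro!: bexI[of _ x])
    then show ?thesis using margin(2) by blast
  qed
  let ?\<phi> = "\<lambda>i t. g (x + t *\<^sub>R axis i 1)" and ?\<phi>' = "\<lambda>i t. partial_deriv i g (x + t *\<^sub>R axis i 1)"
  have d1: "(?\<phi> i has_real_derivative ?\<phi>' i t) (at t)" if "\<bar>t\<bar> < margin" for t i
    by (rule axis_line_has_real_derivative, rule C1_on_imp(1)[OF C1(1) ball[OF that]])
  have d2: "(?\<phi>' i has_real_derivative partial_deriv i (partial_deriv i g) x) (at 0)" for i
    using axis_line_has_real_derivative[of "partial_deriv i g" x 0 i] C1_on_imp(1)[OF C1(2) x] by simp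
  have d10: "(?\<phi> i has_real_derivative partial_deriv i g x) (at 0)" for i
    using d1[of 0 i] margin(1) by simp
  have "eventually (\<lambda>e. e < margin) (at_right 0)" "eventually (\<lambda>e::real. 0 < e) (at_right 0)"
    using margin(1) by (auto simp: eventually_at_right_field)
  then have ev: "eventually (\<lambda>e. corner_diff H (?\<phi> 1 0) (max (?\<phi> 1 e) (?\<phi> 2 e)) (min (?\<phi> 1 (- e)) (?\<phi> 2 (- e))) / e\<^sup>2
      = corner H e x / e\<^sup>2) (at_right 0)"
  proof eventually_elim
    case (elim e)
    have "corner H e x = corner_diff H (g x) (max (g (x + e *\<^sub>R axis 1 1)) (g (x + e *\<^sub>R axis 2 1)))
      (min (g (x - e *\<^sub>R axis 1 1)) (g (x - e *\<^sub>R axis 2 1)))"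
      using ball[of e] ball[of "- e"] elim by (intro corner_eq H_const x) auto
    then show ?case by simp
  qed
  let ?s = "partial_deriv 1 g x" and ?t = "partial_deriv 2 g x"
  have hd: "deriv h u = h' u" for u using DERIV_imp_deriv[OF h] .
  have gr: "grad g x $ i = partial_deriv i g x" for i by (simp add: grad_def)
  have nz: "?s \<noteq> 0 \<or> ?t \<noteq> 0" using crit[OF True] by (auto simp: vec_eq_iff forall_2 gr)
  have swap: "max (?\<phi> 1 e) (?\<phi> 2 e) = max (?\<phi> 2 e) (?\<phi> 1 e)" "min (?\<phi> 1 e) (?\<phi> 2 e) = min (?\<phi> 2 e) (?\<phi> 1 e)" for e
    by (simp_all add: max.commute min.commute)
  have g0: "?\<phi> 1 0 = ?\<phi> 2 0" by simp
  consider (n1) "?t < ?s" "?s < 0" | (n2) "?s < ?t" "?t < 0" | (p1) "?s > 0" | (p2) "?t > 0"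
    | (z1) "?s = 0" "?t < 0" | (z2) "?t = 0" "?s < 0"
    using nz diag[OF True] by linarith
  then have "((\<lambda>e. corner_diff H (?\<phi> 1 0) (max (?\<phi> 1 e) (?\<phi> 2 e)) (min (?\<phi> 1 (- e)) (?\<phi> 2 (- e))) / e\<^sup>2)
      \<longlongrightarrow> - gamma x g h) (at_right 0)"
  proof cases
    case n1
    have "gamma x g h = ?s\<^sup>2 * h' (g x) + partial_deriv 1 (partial_deriv 1 g) x * h (g x)"
      using n1 by (simp add: gamma_def gamma_dir_def Q_def gr hd indicator_def)
    then show ?thesis
      using tendsto_corner_diff_negative[where \<phi> = "?\<phi> 1" and \<psi> = "?\<phi> 2" and \<phi>' = "?\<phi>' 1", OF margin(1) d1 d2 d10 g0 _ _ H h] n1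
      by simp
  next
    case n2
    have "gamma x g h = ?t\<^sup>2 * h' (g x) + partial_deriv 2 (partial_deriv 2 g) x * h (g x)"
      using n2 by (simp add: gamma_def gamma_dir_def Q_def gr hd indicator_def)
    then show ?thesis
      using tendsto_corner_diff_negative[where \<phi> = "?\<phi> 2" and \<psi> = "?\<phi> 1" and \<phi>' = "?\<phi>' 2", OF margin(1) d1 d2 d10 g0[symmetric] _ _ H h] n2
      unfolding swap by simp
  next
    case p1
    then have "gamma x g h = 0" by (simp add: gamma_def gamma_dir_def Q_def gr indicator_def)
    then show ?thesis using tendsto_corner_diff_positive[where \<phi> = "?\<phi> 1" and \<psi> = "?\<phi> 2" and H = H, OF d10 p1] by simp
  next
    case p2
    then have "gamma x g h = 0" by (simp add: gamma_def gamma_dir_def Q_def gr indicator_def)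
    then show ?thesis using tendsto_corner_diff_positive[where \<phi> = "?\<phi> 2" and \<psi> = "?\<phi> 1" and H = H, OF d10 p2] unfolding swap by simp
  next
    case z1
    then have "gamma x g h = 0" by (simp add: gamma_def gamma_dir_def Q_def gr indicator_def)
    moreover have "(?\<phi>' 1 has_real_derivative 0) (at 0)" using d2[of 1] flat[OF True z1(1)] by simp
    ultimately show ?thesis
      using tendsto_corner_diff_degenerate[where \<phi> = "?\<phi> 1" and \<psi> = "?\<phi> 2" and \<phi>' = "?\<phi>' 1", OF margin(1) d1 _ _ d10 g0 z1(2) H] z1(1)
      by simp
  next
    case z2
    then have "gamma x g h = 0" by (simp add: gamma_def gamma_dir_def Q_def gr indicator_def)
    moreover have "(?\<phi>' 2 has_real_derivative 0) (at 0)" using d2[of 2] flat[OF True z2(1)] by simp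
    ultimately show ?thesis
      using tendsto_corner_diff_degenerate[where \<phi> = "?\<phi> 2" and \<psi> = "?\<phi> 1" and \<phi>' = "?\<phi>' 2", OF margin(1) d1 _ _ d10 g0[symmetric] z2(2) H] z2(1)
      unfolding swap by simp
  qed
  then show ?thesis using ev by (rule Lim_transform_eventually)
qed

end


section \<open>Exchanging the integrals over levels and over positions\<close>

lemma integral_level:
  fixes H h :: "real \<Rightarrow> real"
  assumes H: "\<And>u. (H has_real_derivative h u) (at u)" and h: "continuous_on UNIV h"
  shows "(\<integral>u. h u * (if b < u \<and> u \<le> a then 1 else 0) \<partial>lborel) = H (max a b) - H b"
    and "integrable lborel (\<lambda>u. h u * (if b < u \<and> u \<le> a then 1 else 0))"
proof -
  have eq: "AE u in lborel. h u * (if b < u \<and> u \<le> a then 1 else 0) = h u * indicator {b..max a b} u"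
    using AE_lborel_singleton[of b] by eventually_elim (auto simp: indicator_def)
  have hm: "h \<in> borel_measurable borel" using h by (rule borel_measurable_continuous_onI)
  have "has_bochner_integral lborel (\<lambda>u. h u * indicator {b..max a b} u) (H (max a b) - H b)"
    using H h by (intro has_bochner_integral_FTC_Icc_real) (auto simp: continuous_on_eq_continuous_at)
  then have "has_bochner_integral lborel (\<lambda>u. h u * (if b < u \<and> u \<le> a then 1 else 0)) (H (max a b) - H b)"
    using hm eq by (subst has_bochner_integral_cong_AE[where g = "\<lambda>u. h u * indicator {b..max a b} u"]) auto
  then show "(\<integral>u. h u * (if b < u \<and> u \<le> a then 1 else 0) \<partial>lborel) = H (max a b) - H b"
    "integrable lborel (\<lambda>u. h u * (if b < u \<and> u \<le> a then 1 else 0))"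
    by (auto simp: has_bochner_integral_iff)
qed

context excursion_field
begin

lemma N_finite: "emeasure lborel N < top"
  using emeasure_bounded_finite[OF compact_imp_bounded[OF margin(3)]] by (simp add: infinity_ennreal_def)

lemma G_ge: "u0 \<le> G x"
  by (simp add: G_def excursion_def)

lemma G_bounded: "\<exists>B. \<forall>x. G x \<le> B"
proof -
  obtain B where "\<forall>x\<in>N. \<bar>g x\<bar> \<le> B" using bounded_on_N[OF C1_on_imp(3)[OF C1(1)]] by blast
  then have "G x \<le> max B u0" for x using K_N by (auto simp: G_def le_max_iff_disj dest!: subsetD)
  then show ?thesis by blast
qed

lemma upper_lower_ge: "u0 \<le> upper e x" "u0 \<le> lower e x"
  using G_ge by (simp_all add: upper_def lower_def le_max_iff_disj)

lemma excursion_eq_G: "u0 < u \<Longrightarrow> excursion W g u = {x. u \<le> G x}"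
  by (auto simp: G_def excursion_def split: if_splits)

lemma excursion_compact: "u0 \<le> u \<Longrightarrow> compact (excursion W g u)"
proof -
  assume u: "u0 \<le> u"
  have "continuous_on K g" using C1_on_imp(3)[OF C1(1)] K_W continuous_on_subset by blast
  then have "closed (K \<inter> g -` {u..})" using cK compact_imp_closed continuous_closed_preimage by blast
  moreover have "excursion W g u = K \<inter> (K \<inter> g -` {u..})" using u by (auto simp: excursion_def)
  ultimately show ?thesis using compact_Int_closed[OF cK, of "K \<inter> g -` {u..}"] by metis
qed

lemma near_K_N: "y \<in> K \<Longrightarrow> dist y x \<le> margin \<Longrightarrow> x \<in> N"
  by (auto simp: N_def)

text \<open>For x on the grid: 1 if x is an upper right convex corner of the sampled level set, -1
  if it is a lower left concave one, as \<open>flip_eq\<close> confirms. Integrating over x gives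
  corner counts, integrating against \<open>h\<close> over u gives corner differences.\<close>

definition flip :: "real \<Rightarrow> real^2 \<Rightarrow> real \<Rightarrow> real" where
  "flip e x u = (if upper e x < u \<and> u \<le> G x then 1 else 0) - (if G x < u \<and> u \<le> lower e x then 1 else 0)"

lemma flip_measurable [measurable]: "(\<lambda>(x, u). flip e x u) \<in> borel_measurable (borel \<Otimes>\<^sub>M borel)"
  unfolding flip_def[abs_def] by measurable

lemma flip_outside:
  assumes "0 \<le> e" "e \<le> margin" "x \<notin> N"
  shows "flip e x u = 0"
proof -
  have "dist y x > e" if "y \<in> K" for y using near_K_N[OF that, of x] assms by fastforce
  from outside[OF assms(1) this] show ?thesis by (simp add: flip_def)
qed

lemma flip_abs_le: "\<bar>flip e x u\<bar> \<le> 1"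
  by (simp add: flip_def)

lemma flip_eq:
  assumes "u0 < u"
  shows "flip e (gpt z e p) u =
    of_bool (p \<in> gset z e (excursion W g u) \<and> pixR p \<notin> gset z e (excursion W g u) \<and> pixU p \<notin> gset z e (excursion W g u))
    - of_bool (p \<notin> gset z e (excursion W g u) \<and> pixL p \<in> gset z e (excursion W g u) \<and> pixD p \<in> gset z e (excursion W g u))"
proof -
  have "gpt z e p + e *\<^sub>R axis 1 1 = gpt z e (pixR p)" "gpt z e p + e *\<^sub>R axis 2 1 = gpt z e (pixU p)"
    "gpt z e p - e *\<^sub>R axis 1 1 = gpt z e (pixL p)" "gpt z e p - e *\<^sub>R axis 2 1 = gpt z e (pixD p)"
    by (simp_all add: vec2_eq_iff moves axis_def algebra_simps)
  then show ?thesis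
    unfolding excursion_eq_G[OF assms] gset_def by (auto simp: flip_def upper_def lower_def not_le)
qed

text \<open>An integral over positions is an average over the translates of the grid, and every
  translate has the same corner count c.\<close>

lemma integral_flip:
  assumes e: "0 < e" "e \<le> margin" and u: "u0 < u"
    and count: "\<And>z. corner_count (gset z e (excursion W g u)) = c"
  shows "(\<integral>x. flip e x u \<partial>lborel) = e\<^sup>2 * of_int c"
proof -
  obtain R where R: "\<forall>x\<in>N. norm x \<le> R" using margin(3) by (auto dest!: compact_imp_bounded simp: bounded_iff)
  \<comment> \<open>Cell points have norm at most 2 e, so a grid point outside B remains outside
    \<open>N\<close> after translation by any of them.\<close>
  define B where "B = {p. gpt 0 e p \<in> cball 0 (R + 2 * e)}"
  have finB: "finite B" unfolding B_def by (rule finite_grid_bounded[OF bounded_cball e(1)])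
  have supp: "flip e (x + e *\<^sub>R pv p) u = 0" if p: "p \<notin> B" and x: "x \<in> cell e" for p x
  proof (rule flip_outside)
    have "norm x \<le> \<bar>x$1\<bar> + \<bar>x$2\<bar>" using norm_le_l1_cart[of x] by (simp add: sum_2)
    then have "norm x \<le> 2 * e" using x by (auto simp: cell_def)
    moreover have "norm (gpt 0 e p) > R + 2 * e" using p by (simp add: B_def)
    moreover have "norm (gpt 0 e p) \<le> norm (x + e *\<^sub>R pv p) + norm x"
      using norm_triangle_ineq4[of "x + e *\<^sub>R pv p" x] by (simp add: gpt_def)
    ultimately show "x + e *\<^sub>R pv p \<notin> N" using R by fastforce
  qed (use e in auto)
  have [measurable]: "(\<lambda>x. flip e x u) \<in> borel_measurable borel" by measurable
  have int: "integrable lborel (\<lambda>x. flip e x u)"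
  proof (rule Bochner_Integration.integrable_bound[where f = "\<lambda>x. indicator N x :: real"])
    show "integrable lborel (\<lambda>x. indicator N x :: real)"
      using margin(3) by (intro integrable_real_indicator) (auto simp: borel_compact N_finite)
    show "AE x in lborel. norm (flip e x u) \<le> norm (indicator N x :: real)"
      using flip_outside[of e] flip_abs_le e by (auto simp: indicator_def)
  qed simp
  show ?thesis
  proof (rule integral_grid_average[OF e(1) int finB supp])
    fix x assume x: "x \<in> cell e"
    let ?P = "gset x e (excursion W g u)"
    let ?A = "\<lambda>p. p \<in> ?P \<and> pixR p \<notin> ?P \<and> pixU p \<notin> ?P" and ?D = "\<lambda>p. p \<notin> ?P \<and> pixL p \<in> ?P \<and> pixD p \<in> ?P"
    have AD: "?A p \<Longrightarrow> p \<in> B" "?D p \<Longrightarrow> p \<in> B" for p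
      using supp[OF _ x, of p] flip_eq[OF u, of e x p] unfolding gpt_def by (auto split: if_splits)
    have "(\<Sum>p\<in>B. flip e (x + e *\<^sub>R pv p) u) = (\<Sum>p\<in>B. of_bool (?A p)) - (\<Sum>p\<in>B. of_bool (?D p))"
      unfolding gpt_def[symmetric] flip_eq[OF u] by (rule sum_subtractf)
    also have "(\<Sum>p\<in>B. of_bool (?A p) :: real) = of_nat (card (B \<inter> {p. ?A p}))"
      by (rule sum_of_bool_eq) (rule finB)+
    also have "(\<Sum>p\<in>B. of_bool (?D p) :: real) = of_nat (card (B \<inter> {p. ?D p}))"
      by (rule sum_of_bool_eq) (rule finB)+
    also have "B \<inter> {p. ?A p} = {p \<in> ?P. pixR p \<notin> ?P \<and> pixU p \<notin> ?P}" using AD(1) by blast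
    also have "B \<inter> {p. ?D p} = {p. p \<notin> ?P \<and> pixL p \<in> ?P \<and> pixD p \<in> ?P}" using AD(2) by blast
    finally show "(\<Sum>p\<in>B. flip e (x + e *\<^sub>R pv p) u) = of_int c"
      unfolding count[of x, unfolded corner_count_def, symmetric] by (simp only: of_int_diff of_int_of_nat_eq)
  qed
qed

end

context excursion_test
begin

lemma h_measurable [measurable]: "h \<in> borel_measurable borel" "h' \<in> borel_measurable borel"
  using h_cont h'_cont by (auto intro: borel_measurable_continuous_onI)

lemma integral_flip_level: "(\<integral>u. h u * flip e x u \<partial>lborel) = corner H e x"
proof -
  have "(\<integral>u. h u * flip e x u \<partial>lborel) = (\<integral>u. h u * (if upper e x < u \<and> u \<le> G x then 1 else 0)
      - h u * (if G x < u \<and> u \<le> lower e x then 1 else 0) \<partial>lborel)"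
    by (simp add: flip_def right_diff_distrib)
  also have "\<dots> = (H (max (G x) (upper e x)) - H (upper e x)) - (H (max (lower e x) (G x)) - H (G x))"
    by (simp only: Bochner_Integration.integral_diff integral_level[OF H h_cont])
  finally show ?thesis by (simp add: corner_def corner_diff_def)
qed

lemma integrable_flip:
  assumes e: "0 < e" "e \<le> margin"
  shows "integrable (lborel \<Otimes>\<^sub>M lborel) (\<lambda>(x, u). h u * flip e x u)"
proof -
  obtain B where B: "\<And>x. G x \<le> B" using G_bounded by blast
  have "compact (h ` {u0..B})" by (intro compact_continuous_image continuous_on_subset[OF h_cont]) auto
  then obtain C where C: "\<forall>u\<in>{u0..B}. \<bar>h u\<bar> \<le> C" by (auto dest!: compact_imp_bounded simp: bounded_iff)
  have Nb: "N \<in> sets borel" using margin(3) by (simp add: borel_compact)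
  have fin: "emeasure (lborel \<Otimes>\<^sub>M lborel) (N \<times> {u0..B}) < \<infinity>"
    using Nb margin(3) by (subst lborel.emeasure_pair_measure_Times)
      (auto simp: N_finite ennreal_mult_less_top emeasure_lborel_Icc_eq)
  show ?thesis
  proof (rule Bochner_Integration.integrable_bound[where f = "\<lambda>z. C * indicator (N \<times> {u0..B}) z"])
    show "integrable (lborel \<Otimes>\<^sub>M lborel) (\<lambda>z. C * indicator (N \<times> {u0..B}) z)"
      using fin Nb by (intro integrable_mult_right integrable_real_indicator) auto
    show "(\<lambda>(x, u). h u * flip e x u) \<in> borel_measurable (lborel \<Otimes>\<^sub>M lborel)" by measurable
    have "norm (h u * flip e x u) \<le> norm (C * indicator (N \<times> {u0..B}) (x, u))" for x u
    proof (cases "x \<in> N \<and> u \<in> {u0..B}")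
      case True
      have "\<bar>h u\<bar> * \<bar>flip e x u\<bar> \<le> C * 1" using True C flip_abs_le by (intro mult_mono) (auto intro: order_trans[OF abs_ge_zero])
      then show ?thesis using True by (simp add: abs_mult)
    next
      case False
      have "flip e x u = 0"
      proof (cases "x \<in> N")
        case True
        then consider "u < u0" | "u > B" using False by force
        then show ?thesis
        proof cases
          case 1
          then show ?thesis using upper_lower_ge[of e x] G_ge[of x] by (simp add: flip_def)
        next
          case 2
          have "lower e x \<le> B" using B by (auto simp: lower_def min_le_iff_disj)
          then show ?thesis using 2 B[of x] by (simp add: flip_def)
        qed
      qed (use flip_outside e in auto)
      then show ?thesis by simp
    qed
    then show "AE z in lborel \<Otimes>\<^sub>M lborel. norm (case z of (x, u) \<Rightarrow> h u * flip e x u) \<le> norm (C * indicator (N \<times> {u0..B}) z)"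
      by auto
  qed
qed

text \<open>Fubini for \<open>flip\<close>: integrating first over u gives corner differences, first
  over x gives e^2 times the Euler characteristic. The identity is exact for each small mesh, not
  merely asymptotic, as one threshold serves all levels in S.\<close>

lemma chi_eq_corner:
  assumes S: "closed S" "S \<subseteq> {u0..}" "\<And>u. u \<in> S \<Longrightarrow> \<not> critical_value W g u" and hS: "\<And>u. u \<notin> S \<Longrightarrow> h u = 0"
  shows "integrable lborel (\<lambda>u. h u * excursion_euler W g u)"
    and "\<exists>e0>0. \<forall>e. 0 < e \<and> e < e0 \<longrightarrow> (\<integral>x. corner H e x \<partial>lborel) / e\<^sup>2 = chi W g h"
proof -
  have "\<exists>e0>0. \<forall>e u z. 0 < e \<longrightarrow> e < e0 \<longrightarrow> u \<in> S \<longrightarrow> euler_char (excursion W g u) = corner_count (gset z e (excursion W g u))"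
  proof (rule euler_char_excursion_grid[OF W C1(1) cK S])
    fix e0 assume "0 < e0" and "\<And>e u z. 0 < e \<Longrightarrow> e < e0 \<Longrightarrow> u \<in> S \<Longrightarrow> euler_char (excursion W g u) = corner_count (gset z e (excursion W g u))"
    then show ?thesis by (intro exI[of _ e0] conjI allI impI)
  qed
  then obtain e0 where e0: "e0 > 0" "\<And>e u z. 0 < e \<Longrightarrow> e < e0 \<Longrightarrow> u \<in> S \<Longrightarrow> corner_count (gset z e (excursion W g u)) = euler_char (excursion W g u)"
    by metis
  define e1 where "e1 = min e0 margin"
  have e1: "e1 > 0" using e0(1) margin(1) by (simp add: e1_def)
  have inner: "(\<integral>x. h u * flip e x u \<partial>lborel) = e\<^sup>2 * (h u * excursion_euler W g u)" if e: "0 < e" "e < e1" for e u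
  \<comment> \<open>The level u0 is set apart because every point of the plane satisfies
    \<open>u0 \<le> G x\<close>; \<open>h\<close> vanishes there.\<close>
  proof (cases "u \<in> S \<and> u \<noteq> u0")
    case True
    then have u: "u0 < u" using S(2) by force
    have ee: "0 < e" "e < e0" "e \<le> margin" using e by (auto simp: e1_def)
    have "compact (excursion W g u)" using excursion_compact u by simp
    then have "excursion_euler W g u = of_int (euler_char (excursion W g u))"
      using S(3) True by (simp add: excursion_euler_def)
    then show ?thesis using integral_flip[OF ee(1,3) u e0(2)[OF ee(1,2)]] True by simp
  next
    case False
    then have "h u = 0" using hS h_zero by blast
    then show ?thesis by simp
  qed
  note int = integrable_flip
  have Fub: "(\<integral>x. corner H e x \<partial>lborel) = e\<^sup>2 * chi W g h"
    "integrable lborel (\<lambda>u. e\<^sup>2 * (h u * excursion_euler W g u))" if e: "0 < e" "e < e1" for e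
  proof -
    have ee: "0 < e" "e \<le> margin" using e by (auto simp: e1_def)
    have "(\<integral>x. corner H e x \<partial>lborel) = (\<integral>x. (\<integral>u. h u * flip e x u \<partial>lborel) \<partial>lborel)"
      by (simp add: integral_flip_level)
    also have "\<dots> = (\<integral>u. (\<integral>x. h u * flip e x u \<partial>lborel) \<partial>lborel)"
      by (rule lborel_pair.Fubini_integral[OF int[OF ee], symmetric])
    also have "\<dots> = e\<^sup>2 * chi W g h" unfolding inner[OF e] chi_def by simp
    finally show "(\<integral>x. corner H e x \<partial>lborel) = e\<^sup>2 * chi W g h" .
    show "integrable lborel (\<lambda>u. e\<^sup>2 * (h u * excursion_euler W g u))"
      using lborel_pair.integrable_snd[OF int[OF ee]] unfolding inner[OF e] .
  qed
  from e1 have "0 < e1 / 2" "e1 / 2 < e1" by auto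
  from Fub(2)[OF this] e1 show "integrable lborel (\<lambda>u. h u * excursion_euler W g u)" by simp
  show "\<exists>e0>0. \<forall>e. 0 < e \<and> e < e0 \<longrightarrow> (\<integral>x. corner H e x \<partial>lborel) / e\<^sup>2 = chi W g h"
    using e1 Fub(1) by (intro exI[of _ e1]) simp
qed

section \<open>Passage to the limit in the mesh\<close>

lemma corner_measurable [measurable]: "corner H e \<in> borel_measurable borel"
proof -
  have [measurable]: "H \<in> borel_measurable borel" using H_cont by (rule borel_measurable_continuous_onI)
  show ?thesis unfolding corner_def[abs_def] corner_diff_def by measurable
qed

lemma gamma_measurable [measurable]: "(\<lambda>x. indicator W x * gamma x g h) \<in> borel_measurable borel"
proof -
  have Wb [measurable]: "W \<in> sets borel" using W by simp
  have [measurable]: "(\<lambda>x. indicator W x *\<^sub>R g x) \<in> borel_measurable borel"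
    "(\<lambda>x. indicator W x *\<^sub>R partial_deriv i g x) \<in> borel_measurable borel"
    "(\<lambda>x. indicator W x *\<^sub>R partial_deriv i (partial_deriv i g) x) \<in> borel_measurable borel" for i
    using borel_measurable_continuous_on_indicator[OF Wb] C1_on_imp[OF C1(1)] C1_on_imp[OF C1(2)] by blast+
  let ?g = "\<lambda>x. indicator W x *\<^sub>R g x" and ?p = "\<lambda>i x. indicator W x *\<^sub>R partial_deriv i g x"
    and ?q = "\<lambda>i x. indicator W x *\<^sub>R partial_deriv i (partial_deriv i g) x"
  have hd: "deriv h u = h' u" for u using DERIV_imp_deriv[OF h] .
  have eq: "indicator W x * gamma x g h =
     (if ?p 2 x < ?p 1 x \<and> ?p 1 x < 0 then (?p 1 x)\<^sup>2 * h' (?g x) + ?q 1 x * h (?g x) else 0)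
    + (if ?p 1 x < ?p 2 x \<and> ?p 2 x < 0 then (?p 2 x)\<^sup>2 * h' (?g x) + ?q 2 x * h (?g x) else 0)" for x
    by (auto simp: gamma_def gamma_dir_def Q_def grad_def hd indicator_def)
  show ?thesis unfolding eq by measurable
qed

text \<open>Only almost every point matters, so critical values in the support of \<open>h\<close>
  do no harm here. It is the link with \<open>chi\<close> that calls for regular levels.\<close>

lemma corner_limit:
  assumes crit: "AE x in lborel. x \<in> K \<longrightarrow> grad g x \<noteq> 0"
    and diag: "AE x in lborel. x \<in> K \<longrightarrow> \<not> (grad g x $ 1 = grad g x $ 2 \<and> grad g x $ 1 < 0)"
  shows "set_integrable lborel W (\<lambda>x. gamma x g h)"
    and "\<lbrakk>\<And>n. 0 < e n; e \<longlonglongrightarrow> 0\<rbrakk> \<Longrightarrow> (\<lambda>n. (\<integral>x. corner H (e n) x \<partial>lborel) / (e n)\<^sup>2) \<longlonglongrightarrow> I_functional W g h"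
proof -
  \<comment> \<open>The level set lemma for the function \<open>partial_deriv i g\<close> at level
    0.\<close>
  have flat1: "AE x in lborel. \<not> (x \<in> W \<and> partial_deriv i g x = 0 \<and> partial_deriv i (partial_deriv i g) x \<noteq> 0)" for i
    using AE_not_in[OF null_set_level[OF W C1(2), of i 0 i]] by simp
  have Nb: "N \<in> sets borel" using margin(3) by (simp add: borel_compact)
  obtain C where C: "C \<ge> 0" "\<And>e x. 0 < e \<Longrightarrow> e \<le> margin / 2 \<Longrightarrow> \<bar>corner H e x\<bar> \<le> C * e\<^sup>2 * indicator N x"
    using corner_bound by metis
  have main: "integrable lborel (\<lambda>x. - (indicator W x * gamma x g h)) \<and>
    (\<lambda>n. \<integral>x. corner H (e n) x / (e n)\<^sup>2 \<partial>lborel) \<longlonglongrightarrow> (\<integral>x. - (indicator W x * gamma x g h) \<partial>lborel)"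
    if e: "\<And>n. 0 < e n" "\<And>n. e n \<le> margin / 2" "e \<longlonglongrightarrow> 0" for e
  proof -
    have lim: "AE x in lborel. (\<lambda>n. corner H (e n) x / (e n)\<^sup>2) \<longlonglongrightarrow> - (indicator W x * gamma x g h)"
      using crit diag flat1[of 1] flat1[of 2]
    proof eventually_elim
      case (elim x)
      show ?case
      proof (cases "x \<in> W")
        case True
        have "((\<lambda>t. corner H t x / t\<^sup>2) \<longlongrightarrow> - gamma x g h) (at_right 0)"
        proof (rule tendsto_corner[OF True])
          show "partial_deriv i (partial_deriv i g) x = 0" if "x \<in> K" "partial_deriv i g x = 0" for i
            using elim(3,4) that True exhaust_2[of i] by auto
        qed (use elim in \<open>auto simp: grad_def\<close>)
        moreover have "filterlim e (at_right 0) sequentially"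
          using e(1) by (intro tendsto_imp_filterlim_at_right[OF e(3)]) simp
        ultimately show ?thesis using True by (auto intro: filterlim_compose)
      next
        case False
        have "eventually (\<lambda>n. corner H (e n) x / (e n)\<^sup>2 = 0) sequentially"
        proof -
          have "x \<in> - K" "open (- K)" using False K_W cK compact_imp_closed by blast+
          then obtain d where d: "d > 0" "ball x d \<subseteq> - K" using open_contains_ball by blast
          have "eventually (\<lambda>n. e n < d) sequentially" using e(3) d(1) by (rule order_tendstoD)
          then show ?thesis
          proof eventually_elim
            case (elim n)
            have "dist y x > e n" if "y \<in> K" for y
              using d(2) that elim by (metis ComplD dist_commute dual_order.strict_trans1 linorder_not_less mem_ball subsetD)
            then show ?case using corner_outside[of "e n" x H] e(1)[of n] by simp
          qed
        qed
        then show ?thesis using False by (simp add: tendsto_eventually)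
      qed
    qed
    have dom: "AE x in lborel. norm (corner H (e n) x / (e n)\<^sup>2) \<le> C * indicator N x" for n
    proof (rule AE_I2)
      fix x
      have "\<bar>corner H (e n) x\<bar> / (e n)\<^sup>2 \<le> (C * (e n)\<^sup>2 * indicator N x) / (e n)\<^sup>2"
        using C(2)[OF e(1,2)] by (intro divide_right_mono) auto
      then show "norm (corner H (e n) x / (e n)\<^sup>2) \<le> C * indicator N x"
        using e(1)[of n] by (simp add: abs_divide)
    qed
    have w: "integrable lborel (\<lambda>x. C * indicator N x)"
      using margin(3) Nb by (intro integrable_mult_right integrable_real_indicator) (auto simp: N_finite)
    have m1: "(\<lambda>x. - (indicator W x * gamma x g h)) \<in> borel_measurable lborel" by simp
    have m2: "(\<lambda>x. corner H (e n) x / (e n)\<^sup>2) \<in> borel_measurable lborel" for n by simp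
    show ?thesis
      using integral_dominated_convergence[OF m1 m2 w lim dom] integrable_dominated_convergence[OF m1 m2 w lim dom] by blast
  qed
  have "(\<lambda>n. margin / 2 * (1 / real (Suc n))) \<longlonglongrightarrow> margin / 2 * 0"
    by (intro tendsto_mult tendsto_const LIMSEQ_inverse_real_of_nat[unfolded inverse_eq_divide])
  then have "integrable lborel (\<lambda>x. - (indicator W x * gamma x g h))"
    using main[of "\<lambda>n. margin / 2 * (1 / real (Suc n))"] margin(1) by (auto simp: field_simps)
  then show "set_integrable lborel W (\<lambda>x. gamma x g h)"
    by (simp add: set_integrable_def)
  assume e: "\<And>n. 0 < e n" "e \<longlonglongrightarrow> 0"
  have "eventually (\<lambda>n. e n < margin / 2) sequentially" using e(2) margin(1) by (intro order_tendstoD) auto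
  then obtain n0 where n0: "\<And>n. n \<ge> n0 \<Longrightarrow> e n < margin / 2" by (auto simp: eventually_sequentially)
  have "(\<lambda>n. e (n + n0)) \<longlonglongrightarrow> 0" using e(2) by (rule LIMSEQ_ignore_initial_segment)
  then have "(\<lambda>n. \<integral>x. corner H (e (n + n0)) x / (e (n + n0))\<^sup>2 \<partial>lborel) \<longlonglongrightarrow> (\<integral>x. - (indicator W x * gamma x g h) \<partial>lborel)"
    using main[of "\<lambda>n. e (n + n0)"] e(1) n0 by (simp add: less_imp_le)
  then have "(\<lambda>n. (\<integral>x. corner H (e (n + n0)) x \<partial>lborel) / (e (n + n0))\<^sup>2) \<longlonglongrightarrow> I_functional W g h"
    by (simp add: I_functional_def set_lebesgue_integral_def)
  then show "(\<lambda>n. (\<integral>x. corner H (e n) x \<partial>lborel) / (e n)\<^sup>2) \<longlonglongrightarrow> I_functional W g h"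
    by (rule LIMSEQ_offset)
qed

lemma chi_eq_I_regular:
  assumes crit: "AE x in lborel. x \<in> K \<longrightarrow> grad g x \<noteq> 0"
    and diag: "AE x in lborel. x \<in> K \<longrightarrow> \<not> (grad g x $ 1 = grad g x $ 2 \<and> grad g x $ 1 < 0)"
    and S: "closed S" "S \<subseteq> {u0..}" "\<And>u. u \<in> S \<Longrightarrow> \<not> critical_value W g u" and hS: "\<And>u. u \<notin> S \<Longrightarrow> h u = 0"
  shows "chi W g h = I_functional W g h"
proof -
  obtain e0 where e0: "e0 > 0" "\<And>e. 0 < e \<Longrightarrow> e < e0 \<Longrightarrow> (\<integral>x. corner H e x \<partial>lborel) / e\<^sup>2 = chi W g h"
    using chi_eq_corner(2)[OF S hS] by blast
  let ?e = "\<lambda>n. e0 / 2 * (1 / real (Suc n))"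
  have "?e \<longlonglongrightarrow> e0 / 2 * 0"
    by (intro tendsto_mult tendsto_const LIMSEQ_inverse_real_of_nat[unfolded inverse_eq_divide])
  then have "?e \<longlonglongrightarrow> 0" by simp
  moreover have e: "0 < ?e n" "?e n < e0" for n
  proof -
    have "e0 / 2 * (1 / real (Suc n)) \<le> e0 / 2 * 1" using e0(1) by (intro mult_left_mono) auto
    also have "\<dots> < e0" using e0(1) by simp
    finally show "?e n < e0" .
  qed (use e0(1) in simp)
  ultimately have "(\<lambda>n. (\<integral>x. corner H (?e n) x \<partial>lborel) / (?e n)\<^sup>2) \<longlonglongrightarrow> I_functional W g h"
    by (intro corner_limit(2)[OF crit diag]) auto
  then have "(\<lambda>n. chi W g h) \<longlonglongrightarrow> I_functional W g h" by (simp only: e0(2)[OF e])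
  then show ?thesis by (simp add: LIMSEQ_const_iff)
qed

end


section \<open>A bound near critical levels\<close>

text \<open>On the quadrant \<open>s, t < 0\<close> with \<open>a = -s\<close>, \<open>b = -t\<close>, this is the Lipschitz coefficient for which
  \<open>clip a b * a = (min a b)\<^sup>2\<close>; it turns the term with \<open>h'\<close> into a derivative of \<open>h \<circ> g\<close> along the first axis.\<close>

definition clip :: "real \<Rightarrow> real \<Rightarrow> real" where
  "clip a b = (if a \<le> b then a else b\<^sup>2 / a)"

lemma clip_lipschitz_1:
  assumes "0 \<le> a" "a \<le> a'" "0 \<le> b"
  shows "\<bar>clip a b - clip a' b\<bar> \<le> a' - a"
proof (cases "a' \<le> b")
  case True then show ?thesis using assms by (simp add: clip_def)
next
  case a': False
  show ?thesis
  proof (cases "a \<le> b")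
    case True
    \<comment> \<open>The tangent bound \<open>2 * b - a' \<le> b^2 / a'\<close> for the hyperbola
      branch. Together with \<open>a \<le> b\<close> it keeps the slope across the kink at most
      1.\<close>
    have "0 \<le> (b - a')\<^sup>2" by simp
    then have "2 * b - a' \<le> b\<^sup>2 / a'" using a' assms by (simp add: field_simps power2_eq_square)
    moreover have "b\<^sup>2 / a' \<le> b" using a' assms by (simp add: divide_le_eq power2_eq_square mult_left_mono)
    ultimately show ?thesis using True a' assms by (simp add: clip_def)
  next
    case False
    then have pos: "0 < a" "0 < a'" using assms by auto
    have "b\<^sup>2 \<le> a * a'" using False a' assms unfolding power2_eq_square by (intro mult_mono) auto
    then have "(a' - a) * b\<^sup>2 \<le> (a' - a) * (a * a')" using assms by (intro mult_left_mono) auto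
    moreover have "b\<^sup>2 / a - b\<^sup>2 / a' = (a' - a) * b\<^sup>2 / (a * a')" using pos by (simp add: field_simps)
    ultimately have "b\<^sup>2 / a - b\<^sup>2 / a' \<le> a' - a" using pos by (simp add: divide_le_eq)
    moreover have "b\<^sup>2 / a' \<le> b\<^sup>2 / a" using pos assms by (intro divide_left_mono) auto
    ultimately show ?thesis using False a' by (simp add: clip_def)
  qed
qed

lemma clip_lipschitz_2:
  assumes "0 \<le> a" "0 \<le> b" "b \<le> b'"
  shows "\<bar>clip a b - clip a b'\<bar> \<le> 2 * (b' - b)"
proof (cases "a \<le> b")
  case True then show ?thesis using assms by (simp add: clip_def)
next
  case b: False
  then have a: "0 < a" using assms by simp
  define c where "c = min a b'"
  have c: "b \<le> c" "c \<le> a" "c \<le> b'" "clip a b' = c\<^sup>2 / a"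
    using b assms a by (auto simp: c_def clip_def min_def power2_eq_square)
  have "c\<^sup>2 / a - b\<^sup>2 / a = (c - b) * ((c + b) / a)" using a by (simp add: field_simps power2_eq_square)
  moreover have "(c - b) * ((c + b) / a) \<le> (c - b) * 2"
    using c b a by (intro mult_left_mono) (auto simp: divide_le_eq)
  moreover have "0 \<le> (c - b) * ((c + b) / a)" using c b a assms by (intro mult_nonneg_nonneg divide_nonneg_nonneg) auto
  ultimately have "\<bar>b\<^sup>2 / a - c\<^sup>2 / a\<bar> \<le> 2 * (c - b)" by linarith
  then show ?thesis using b c by (simp add: clip_def)
qed

lemma clip_lipschitz:
  assumes "0 \<le> a" "0 \<le> a'" "0 \<le> b" "0 \<le> b'"
  shows "\<bar>clip a b - clip a' b'\<bar> \<le> \<bar>a - a'\<bar> + 2 * \<bar>b - b'\<bar>"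
proof -
  have "\<bar>clip a b - clip a' b\<bar> \<le> \<bar>a - a'\<bar>"
    using clip_lipschitz_1[of a a' b] clip_lipschitz_1[of a' a b] assms by (cases "a \<le> a'") (auto simp: abs_minus_commute)
  moreover have "\<bar>clip a' b - clip a' b'\<bar> \<le> 2 * \<bar>b - b'\<bar>"
    using clip_lipschitz_2[of a' b b'] clip_lipschitz_2[of a' b' b] assms by (cases "b \<le> b'") (auto simp: abs_minus_commute)
  ultimately show ?thesis by linarith
qed

section \<open>Integration by parts along the first axis\<close>

context excursion_field
begin

text \<open>Chosen so that \<open>Y x * partial_deriv 1 g x\<close> is minus the square of the slope
  of smaller modulus when both partial derivatives are negative, and 0 otherwise.\<close>

definition Y :: "real^2 \<Rightarrow> real" where
  "Y x = clip (max 0 (- partial_deriv 1 g x)) (max 0 (- partial_deriv 2 g x))"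

text \<open>Increments along the first axis suffice, since the integration by parts runs in that
  direction; x stays in \<open>K\<close> because \<open>h (G x)\<close> vanishes elsewhere.\<close>

lemma Y_lipschitz:
  "\<exists>L\<ge>0. \<forall>x\<in>K. \<forall>e. 0 \<le> e \<and> e \<le> margin \<longrightarrow> \<bar>Y (x - e *\<^sub>R axis 1 1) - Y x\<bar> \<le> L * e"
proof -
  obtain c1 where c1: "c1 \<ge> 0" "\<forall>x\<in>N. \<bar>partial_deriv 1 (partial_deriv 1 g) x\<bar> \<le> c1" using bounded_on_N[OF C1_on_imp(2)[OF C1(2)]] by blast
  obtain c2 where c2: "c2 \<ge> 0" "\<forall>x\<in>N. \<bar>partial_deriv 1 (partial_deriv 2 g) x\<bar> \<le> c2" using bounded_on_N[OF C1_on_imp(2)[OF C1(2)]] by blast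
  have lip: "\<bar>partial_deriv i g (x - e *\<^sub>R axis 1 1) - partial_deriv i g x\<bar> \<le> c * e"
    if x: "x \<in> K" and e: "0 \<le> e" "e \<le> margin" and c: "\<forall>x\<in>N. \<bar>partial_deriv 1 (partial_deriv i g) x\<bar> \<le> c" for x e c i
  proof -
    have mem: "x + t *\<^sub>R axis 1 1 \<in> N" if "\<bar>t\<bar> \<le> e" for t
      using x that e by (auto simp: N_def dist_norm norm_axis_1 intro!: bexI[of _ x])
    have d: "((\<lambda>t. partial_deriv i g (x + t *\<^sub>R axis 1 1)) has_real_derivative partial_deriv 1 (partial_deriv i g) (x + t *\<^sub>R axis 1 1)) (at t)" if "\<bar>t\<bar> \<le> e" for t
      using axis_line_has_real_derivative C1_on_imp(1)[OF C1(2)] mem[OF that] margin(2) by blast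
    have "\<bar>partial_deriv i g (x + (- e) *\<^sub>R axis 1 1) - partial_deriv i g (x + 0 *\<^sub>R axis 1 1)\<bar> \<le> c * \<bar>- e - 0\<bar>"
      by (rule field_differentiable_bound[of "{-e..e}" "\<lambda>t. partial_deriv i g (x + t *\<^sub>R axis 1 1)" "\<lambda>t. partial_deriv 1 (partial_deriv i g) (x + t *\<^sub>R axis 1 1)", unfolded real_norm_def])
        (use e c in \<open>auto intro!: has_field_derivative_at_within[OF d] mem\<close>)
    then show ?thesis using e by simp
  qed
  show ?thesis
  proof (intro exI[of _ "c1 + 2 * c2"] conjI ballI allI impI)
    show "0 \<le> c1 + 2 * c2" using c1 c2 by simp
    fix x e assume x: "x \<in> K" and e: "0 \<le> e \<and> e \<le> margin"
    let ?y = "x - e *\<^sub>R axis 1 1"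
    have "\<bar>Y ?y - Y x\<bar> \<le> \<bar>max 0 (- partial_deriv 1 g ?y) - max 0 (- partial_deriv 1 g x)\<bar>
        + 2 * \<bar>max 0 (- partial_deriv 2 g ?y) - max 0 (- partial_deriv 2 g x)\<bar>"
      unfolding Y_def by (rule clip_lipschitz) auto
    also have "\<dots> \<le> \<bar>partial_deriv 1 g ?y - partial_deriv 1 g x\<bar> + 2 * \<bar>partial_deriv 2 g ?y - partial_deriv 2 g x\<bar>"
    proof -
      have "\<bar>max 0 (- p) - max 0 (- q)\<bar> \<le> \<bar>p - q\<bar>" for p q :: real by linarith
      then show ?thesis by (intro add_mono mult_left_mono) auto
    qed
    also have "\<dots> \<le> c1 * e + 2 * (c2 * e)"
      using lip[OF x _ _ c1(2), of e] lip[OF x _ _ c2(2), of e] e by (intro add_mono mult_left_mono) auto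
    finally show "\<bar>Y ?y - Y x\<bar> \<le> (c1 + 2 * c2) * e" by (simp add: algebra_simps)
  qed
qed

lemma Y_measurable [measurable]: "(\<lambda>x. indicator N x * Y x) \<in> borel_measurable borel"
proof -
  have Nb [measurable]: "N \<in> sets borel" using margin(3) by (simp add: borel_compact)
  have [measurable]: "(\<lambda>x. indicator N x *\<^sub>R partial_deriv i g x) \<in> borel_measurable borel" for i
    by (rule borel_measurable_continuous_on_indicator[OF Nb continuous_on_subset[OF C1_on_imp(2)[OF C1(1)] margin(2)]])
  have "(\<lambda>x. indicator N x * Y x) = (\<lambda>x. indicator N x * clip (max 0 (- (indicator N x *\<^sub>R partial_deriv 1 g x))) (max 0 (- (indicator N x *\<^sub>R partial_deriv 2 g x))))"
    by (simp add: Y_def indicator_def fun_eq_iff)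
  moreover have "(\<lambda>x. indicator N x * clip (max 0 (- (indicator N x *\<^sub>R partial_deriv 1 g x))) (max 0 (- (indicator N x *\<^sub>R partial_deriv 2 g x)))) \<in> borel_measurable borel"
    unfolding clip_def by measurable
  ultimately show ?thesis by (simp only:)
qed

lemma Y_bounded: "\<exists>B\<ge>0. \<forall>x\<in>N. \<bar>Y x\<bar> \<le> B"
proof -
  obtain B where B: "B \<ge> 0" "\<forall>x\<in>N. \<bar>partial_deriv 1 g x\<bar> \<le> B" using bounded_on_N[OF C1_on_imp(2)[OF C1(1)]] by blast
  have "\<bar>clip a b\<bar> \<le> a" if "0 \<le> a" "0 \<le> b" for a b
    using clip_lipschitz_1[of 0 a b] that by (simp add: clip_def)
  then have "\<bar>Y x\<bar> \<le> max 0 (- partial_deriv 1 g x)" for x by (simp add: Y_def)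
  moreover have "max 0 (- partial_deriv 1 g x) \<le> B" if "x \<in> N" for x using B that by force
  ultimately show ?thesis using B(1) order_trans by blast
qed

end

context excursion_test
begin

abbreviation "w x \<equiv> h (G x)"

lemma w_outside: "x \<notin> K \<Longrightarrow> w x = 0"
  using h_zero[of u0] by (simp add: G_def)

lemma w_W: "x \<in> W \<Longrightarrow> w x = h (g x)"
  using h_zero[of "g x"] h_zero[of u0] by (auto simp: G_def excursion_def not_le)

lemma h'_outside: "x \<in> W \<Longrightarrow> x \<notin> K \<Longrightarrow> h' (g x) = 0"
  using h'_zero[of "g x"] by (simp add: excursion_def)

lemma w_integrable: "integrable lborel (\<lambda>x. \<bar>w x\<bar>)"
proof -
  obtain B where B: "\<And>x. G x \<le> B" using G_bounded by blast
  have "compact (h ` {u0..B})" by (intro compact_continuous_image continuous_on_subset[OF h_cont]) auto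
  then obtain C where C: "\<forall>u\<in>{u0..B}. \<bar>h u\<bar> \<le> C" by (auto dest!: compact_imp_bounded simp: bounded_iff)
  have [measurable]: "N \<in> sets borel" using margin(3) by (simp add: borel_compact)
  show ?thesis
  proof (rule Bochner_Integration.integrable_bound[where f = "\<lambda>x. C * indicator N x"])
    show "integrable lborel (\<lambda>x. C * indicator N x)"
      using N_finite by (intro integrable_mult_right integrable_real_indicator) auto
    have "\<bar>w x\<bar> \<le> norm (C * indicator N x)" for x
    proof (cases "x \<in> K")
      case True
      then show ?thesis using C B[of x] G_ge[of x] K_N by (auto simp: indicator_def intro: order_trans[OF _ abs_ge_self])
    qed (simp add: w_outside)
    then show "AE x in lborel. norm \<bar>w x\<bar> \<le> norm (C * indicator N x)" by simp
  qed simp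
qed

text \<open>Integration by parts with difference quotients, as \<open>Y\<close> is merely Lipschitz.
  The limit of the quotients produces \<open>h'\<close>, but after the increment has moved to
  \<open>Y\<close> the bound involves \<open>h\<close> alone.\<close>

lemma integral_Y_bound:
  assumes L: "L \<ge> 0" "\<forall>x\<in>K. \<forall>e. 0 \<le> e \<and> e \<le> margin \<longrightarrow> \<bar>Y (x - e *\<^sub>R axis 1 1) - Y x\<bar> \<le> L * e"
  shows "integrable lborel (\<lambda>x. indicator W x * (Y x * partial_deriv 1 g x * h' (g x)))"
    and "\<bar>\<integral>x. indicator W x * (Y x * partial_deriv 1 g x * h' (g x)) \<partial>lborel\<bar> \<le> L * (\<integral>x. \<bar>w x\<bar> \<partial>lborel)"
proof -
  define e where "e n = margin / 2 * (1 / real (Suc n))" for n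
  have "(\<lambda>n. margin / 2 * (1 / real (Suc n))) \<longlonglongrightarrow> margin / 2 * 0"
    by (intro tendsto_mult tendsto_const LIMSEQ_inverse_real_of_nat[unfolded inverse_eq_divide])
  then have e0: "e \<longlonglongrightarrow> 0" by (simp add: e_def[abs_def])
  have ep: "0 < e n" "e n \<le> margin / 2" for n
  proof -
    have "margin / 2 * (1 / real (Suc n)) \<le> margin / 2 * 1" using margin(1) by (intro mult_left_mono) auto
    then show "e n \<le> margin / 2" by (simp add: e_def)
  qed (use margin(1) in \<open>simp add: e_def\<close>)
  have eF: "filterlim e (at 0) sequentially" using e0 ep(1) by (auto simp: filterlim_at less_imp_neq intro!: always_eventually) (metis less_irrefl)
  let ?a = "axis 1 1 :: real^2"
  let ?f = "\<lambda>x. indicator W x * (Y x * partial_deriv 1 g x * h' (g x))"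
  let ?q = "\<lambda>n x. indicator N x * Y x * ((w (x + e n *\<^sub>R ?a) - w x) / e n)"
  have Nb [measurable]: "N \<in> sets borel" using margin(3) by (simp add: borel_compact)
  obtain B where B: "B \<ge> 0" "\<forall>x\<in>N. \<bar>Y x\<bar> \<le> B" using Y_bounded by blast
  have "continuous_on W (\<lambda>x. partial_deriv 1 g x * h' (g x))"
    by (rule continuous_on_mult[OF C1_on_imp(2)[OF C1(1)] continuous_on_compose2[OF h'_cont C1_on_imp(3)[OF C1(1)] subset_UNIV]])
  from bounded_on_N[OF this] obtain B1 where B1: "B1 \<ge> 0" "\<forall>x\<in>N. \<bar>partial_deriv 1 g x * h' (g x)\<bar> \<le> B1" by blast
  have dw: "((\<lambda>t. w (x + t *\<^sub>R ?a)) has_real_derivative partial_deriv 1 g (x + t *\<^sub>R ?a) * h' (g (x + t *\<^sub>R ?a))) (at t)"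
    if x: "x + t *\<^sub>R ?a \<in> W" for x t
  proof -
    have "((\<lambda>t. g (x + t *\<^sub>R ?a)) has_real_derivative partial_deriv 1 g (x + t *\<^sub>R ?a)) (at t)"
      by (rule axis_line_has_real_derivative[OF C1_on_imp(1)[OF C1(1) x]])
    from DERIV_chain2[OF h this]
    have "((\<lambda>t. h (g (x + t *\<^sub>R ?a))) has_real_derivative partial_deriv 1 g (x + t *\<^sub>R ?a) * h' (g (x + t *\<^sub>R ?a))) (at t)"
      by (simp add: mult.commute)
    moreover have "eventually (\<lambda>s. x + s *\<^sub>R ?a \<in> W) (nhds t)"
    proof -
      have "((\<lambda>s. x + s *\<^sub>R ?a) \<longlongrightarrow> x + t *\<^sub>R ?a) (nhds t)" by (intro tendsto_intros filterlim_ident)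
      then show ?thesis using W x by (rule topological_tendstoD)
    qed
    then have "eventually (\<lambda>s. h (g (x + s *\<^sub>R ?a)) = w (x + s *\<^sub>R ?a)) (nhds t)"
      by (rule eventually_mono) (simp add: w_W)
    ultimately show ?thesis using DERIV_cong_ev[of t t "\<lambda>s. h (g (x + s *\<^sub>R ?a))" "\<lambda>s. w (x + s *\<^sub>R ?a)"] by blast
  qed
  have lim: "AE x in lborel. (\<lambda>n. ?q n x) \<longlonglongrightarrow> ?f x"
  proof (rule AE_I2)
    fix x
    show "(\<lambda>n. ?q n x) \<longlonglongrightarrow> ?f x"
    proof (cases "x \<in> N")
      case True
      then have xW: "x \<in> W" using margin(2) by blast
      have "((\<lambda>t. (w (x + t *\<^sub>R ?a) - w (x + 0 *\<^sub>R ?a)) / (t - 0)) \<longlongrightarrow> partial_deriv 1 g x * h' (g x)) (at 0)"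
        using dw[of x 0] xW unfolding has_field_derivative_iff by simp
      from filterlim_compose[OF this eF]
      have "(\<lambda>n. (w (x + e n *\<^sub>R ?a) - w x) / e n) \<longlonglongrightarrow> partial_deriv 1 g x * h' (g x)" by simp
      then have "(\<lambda>n. Y x * ((w (x + e n *\<^sub>R ?a) - w x) / e n)) \<longlonglongrightarrow> Y x * (partial_deriv 1 g x * h' (g x))"
        by (intro tendsto_mult tendsto_const)
      then show ?thesis using True xW by (simp add: mult.assoc)
    next
      case False
      then have "x \<notin> K" using K_N by blast
      then have f0: "?f x = 0" by (cases "x \<in> W") (simp_all add: h'_outside)
      show ?thesis unfolding f0 using False by simp
    qed
  qed
  have dom: "AE x in lborel. norm (?q n x) \<le> B * B1 * indicator N x" for n
  proof (rule AE_I2)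
    fix x
    show "norm (?q n x) \<le> B * B1 * indicator N x"
    proof (cases "x \<in> N")
      case True
      have "\<bar>w (x + e n *\<^sub>R ?a) - w x\<bar> \<le> B1 * e n"
      proof (cases "\<exists>y\<in>K. dist y x \<le> e n")
        case near: True
        then obtain y where y: "y \<in> K" "dist y x \<le> e n" by blast
        have mem: "x + t *\<^sub>R ?a \<in> N" if "t \<in> {0..e n}" for t
        proof (rule near_K_N[OF y(1)])
          have "dist x (x + t *\<^sub>R ?a) \<le> e n" using that by (simp add: dist_norm norm_axis_1)
          then show "dist y (x + t *\<^sub>R ?a) \<le> margin" using y(2) ep(2)[of n] dist_triangle[of y "x + t *\<^sub>R ?a" x] by linarith
        qed
        have "\<bar>w (x + e n *\<^sub>R ?a) - w (x + 0 *\<^sub>R ?a)\<bar> \<le> B1 * \<bar>e n - 0\<bar>"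
          by (rule field_differentiable_bound[of "{0..e n}" "\<lambda>t. w (x + t *\<^sub>R ?a)" "\<lambda>t. partial_deriv 1 g (x + t *\<^sub>R ?a) * h' (g (x + t *\<^sub>R ?a))", unfolded real_norm_def])
            (use ep(1)[of n] B1 mem margin(2) in \<open>auto intro!: has_field_derivative_at_within[OF dw]\<close>)
        then show ?thesis using ep(1)[of n] by simp
      next
        case False
        have "x \<notin> K" using False ep(1)[of n] by force
        moreover have "x + e n *\<^sub>R ?a \<notin> K" using False ep(1)[of n] by (force simp: dist_norm norm_axis_1)
        ultimately show ?thesis using w_outside B1(1) ep(1)[of n] by simp
      qed
      then have "\<bar>(w (x + e n *\<^sub>R ?a) - w x) / e n\<bar> \<le> B1" using ep(1)[of n] by (simp add: abs_divide divide_le_eq)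
      then have "\<bar>Y x\<bar> * \<bar>(w (x + e n *\<^sub>R ?a) - w x) / e n\<bar> \<le> B * B1" using B True by (intro mult_mono) auto
      then show ?thesis using True by (simp add: abs_mult)
    qed simp
  qed
  have wint: "integrable lborel (\<lambda>x. B * B1 * indicator N x)"
    using N_finite by (intro integrable_mult_right integrable_real_indicator) auto
  have qm: "?q n \<in> borel_measurable lborel" for n by measurable
  have fm: "?f \<in> borel_measurable lborel"
  proof -
    have Wb [measurable]: "W \<in> sets borel" using W by simp
    have [measurable]: "(\<lambda>x. indicator W x *\<^sub>R g x) \<in> borel_measurable borel" "(\<lambda>x. indicator W x *\<^sub>R partial_deriv i g x) \<in> borel_measurable borel" for i
      using borel_measurable_continuous_on_indicator[OF Wb] C1_on_imp[OF C1(1)] by blast+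
    have "?f x = (indicator N x * Y x) * ((indicator W x *\<^sub>R partial_deriv 1 g x) * h' (indicator W x *\<^sub>R g x))" for x
    proof (cases "x \<in> N")
      case True
      then have "x \<in> W" using margin(2) by blast
      then show ?thesis using True by simp
    next
      case False
      then have "x \<notin> K" using K_N by blast
      then show ?thesis using False by (cases "x \<in> W") (simp_all add: h'_outside)
    qed
    then have "?f = (\<lambda>x. (indicator N x * Y x) * ((indicator W x *\<^sub>R partial_deriv 1 g x) * h' (indicator W x *\<^sub>R g x)))" by (rule ext)
    moreover have "(\<lambda>x. (indicator N x * Y x) * ((indicator W x *\<^sub>R partial_deriv 1 g x) * h' (indicator W x *\<^sub>R g x))) \<in> borel_measurable lborel" by measurable
    ultimately show ?thesis by (simp only:)
  qed
  show "integrable lborel ?f" by (rule integrable_dominated_convergence[OF fm qm wint lim dom])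
  have conv: "(\<lambda>n. \<integral>x. ?q n x \<partial>lborel) \<longlonglongrightarrow> (\<integral>x. ?f x \<partial>lborel)"
    by (rule integral_dominated_convergence[OF fm qm wint lim dom])
  have wi: "integrable lborel w" using w_integrable by (subst (asm) integrable_abs_iff) auto
  have bd: "\<bar>\<integral>x. ?q n x \<partial>lborel\<bar> \<le> L * (\<integral>x. \<bar>w x\<bar> \<partial>lborel)" for n
  proof -
    let ?y = "\<lambda>x. indicator N x * Y x" and ?v = "e n *\<^sub>R ?a"
    have yb: "\<bar>?y x\<bar> \<le> B" for x using B by (simp add: indicator_def)
    have yw: "\<bar>?y z * w x\<bar> \<le> \<bar>B * w x\<bar>" for x z
      unfolding abs_mult[of _ "w x"] by (intro mult_right_mono order_trans[OF yb abs_ge_self]) simp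
    have i1: "integrable lborel (\<lambda>x. ?y x * w x)"
      by (rule Bochner_Integration.integrable_bound[OF integrable_mult_right[OF wi, of B]])
        (measurable, rule AE_I2, unfold real_norm_def, rule yw)
    have i2: "integrable lborel (\<lambda>x. ?y (x - ?v) * w x)"
      by (rule Bochner_Integration.integrable_bound[OF integrable_mult_right[OF wi, of B]])
        (measurable, rule AE_I2, unfold real_norm_def, rule yw)
    \<comment> \<open>Translation invariance shifts the increment from \<open>w\<close> to
      \<open>Y\<close>.\<close>
    have tr: "(\<integral>x. ?y x * w (x + ?v) \<partial>lborel) = (\<integral>x. ?y (x - ?v) * w x \<partial>lborel)"
      "integrable lborel (\<lambda>x. ?y x * w (x + ?v))"
      using lborel_integral_translate[of "\<lambda>x. ?y (x - ?v) * w x" ?v] i2 by simp_all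
    have "(\<integral>x. ?q n x \<partial>lborel) = (\<integral>x. (?y x * w (x + ?v) - ?y x * w x) / e n \<partial>lborel)"
      by (rule Bochner_Integration.integral_cong) (simp_all add: right_diff_distrib diff_divide_distrib)
    also have "\<dots> = ((\<integral>x. ?y x * w (x + ?v) \<partial>lborel) - (\<integral>x. ?y x * w x \<partial>lborel)) / e n"
      using tr(2) i1 by simp
    also have "\<dots> = (\<integral>x. ?y (x - ?v) * w x - ?y x * w x \<partial>lborel) / e n"
      using tr(1) i1 i2 by simp
    finally have eq: "(\<integral>x. ?q n x \<partial>lborel) = (\<integral>x. ?y (x - ?v) * w x - ?y x * w x \<partial>lborel) / e n" .
    have pt: "\<bar>?y (x - ?v) * w x - ?y x * w x\<bar> \<le> L * e n * \<bar>w x\<bar>" for x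
    proof (cases "x \<in> K")
      case True
      have "x - ?v \<in> N" using near_K_N[OF True] ep[of n] margin(1) by (simp add: dist_norm norm_axis_1)
      moreover have "x \<in> N" using True K_N by blast
      moreover have "\<bar>Y (x - ?v) - Y x\<bar> \<le> L * e n" using L(2) True ep[of n] margin(1) by auto
      then have "\<bar>Y (x - ?v) - Y x\<bar> * \<bar>w x\<bar> \<le> L * e n * \<bar>w x\<bar>" by (intro mult_right_mono) auto
      ultimately show ?thesis by (simp flip: left_diff_distrib add: abs_mult)
    qed (simp add: w_outside)
    have "\<bar>\<integral>x. ?y (x - ?v) * w x - ?y x * w x \<partial>lborel\<bar> \<le> (\<integral>x. \<bar>?y (x - ?v) * w x - ?y x * w x\<bar> \<partial>lborel)"
      by (rule integral_abs_bound)
    also have "\<dots> \<le> (\<integral>x. L * e n * \<bar>w x\<bar> \<partial>lborel)"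
      by (rule integral_mono[OF integrable_abs[OF Bochner_Integration.integrable_diff[OF i2 i1]] integrable_mult_right[OF w_integrable] pt])
    also have "\<dots> = L * e n * (\<integral>x. \<bar>w x\<bar> \<partial>lborel)" by simp
    finally show ?thesis unfolding eq using ep(1)[of n] by (simp add: abs_divide divide_le_eq mult.commute mult.left_commute)
  qed
  show "\<bar>\<integral>x. ?f x \<partial>lborel\<bar> \<le> L * (\<integral>x. \<bar>w x\<bar> \<partial>lborel)"
    by (rule Lim_bounded[OF tendsto_rabs[OF conv]]) (use bd in blast)
qed

text \<open>On both regions \<open>Q\<close> the term with \<open>Y\<close> cancels the part of
  \<open>gamma\<close> containing \<open>h'\<close>, which leaves a second derivative times
  \<open>h\<close>. On the excluded diagonal \<open>gamma\<close> vanishes whereas the term with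
  \<open>Y\<close> need not.\<close>

lemma I_bound:
  assumes diag: "AE x in lborel. x \<in> K \<longrightarrow> \<not> (grad g x $ 1 = grad g x $ 2 \<and> grad g x $ 1 < 0)"
    and L: "L \<ge> 0" "\<forall>x\<in>K. \<forall>e. 0 \<le> e \<and> e \<le> margin \<longrightarrow> \<bar>Y (x - e *\<^sub>R axis 1 1) - Y x\<bar> \<le> L * e"
    and c: "\<forall>x\<in>K. \<bar>partial_deriv 1 (partial_deriv 1 g) x\<bar> \<le> c" "\<forall>x\<in>K. \<bar>partial_deriv 2 (partial_deriv 2 g) x\<bar> \<le> c"
    and si: "set_integrable lborel W (\<lambda>x. gamma x g h)"
  shows "\<bar>I_functional W g h\<bar> \<le> (L + c) * (\<integral>x. \<bar>w x\<bar> \<partial>lborel)"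
proof -
  let ?f = "\<lambda>x. indicator W x * (Y x * partial_deriv 1 g x * h' (g x))"
  note f = integral_Y_bound[OF L]
  have gi: "integrable lborel (\<lambda>x. indicator W x * gamma x g h)" using si by (simp add: set_integrable_def)
  have hd: "deriv h u = h' u" for u using DERIV_imp_deriv[OF h] .
  have rest: "AE x in lborel. \<bar>indicator W x * gamma x g h + ?f x\<bar> \<le> c * \<bar>w x\<bar>"
    using diag
  proof eventually_elim
    case (elim x)
    show ?case
    proof (cases "x \<in> K")
      case False
      then show ?thesis using gamma_outside[OF False] h'_zero[of "g x"] w_outside[OF False]
        by (auto simp: indicator_def excursion_def)
    next
      case True
      let ?s = "partial_deriv 1 g x" and ?t = "partial_deriv 2 g x"
      have xW: "x \<in> W" using True K_W by blast
      have nd: "\<not> (?s = ?t \<and> ?s < 0)" using elim True by (simp add: grad_def)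
      have w: "w x = h (g x)" using w_W xW .
      have cs: "\<bar>k * w x\<bar> \<le> c * \<bar>w x\<bar>" if "\<bar>k\<bar> \<le> c" for k
        unfolding abs_mult using that by (intro mult_right_mono) auto
      have c0: "0 \<le> c * \<bar>w x\<bar>" using cs[of 0] c True by force
      consider "?t < ?s \<and> ?s < 0" | "?s < ?t \<and> ?t < 0" | "?s \<ge> 0 \<or> ?t \<ge> 0" using nd by linarith
      then show ?thesis
      proof cases
        case 1
        then have "Y x * ?s = - ?s\<^sup>2" by (simp add: Y_def clip_def max_absorb2 power2_eq_square)
        then have "indicator W x * gamma x g h + ?f x = partial_deriv 1 (partial_deriv 1 g) x * w x"
          using 1 xW by (simp add: gamma_def gamma_dir_def Q_def grad_def hd w)
        then show ?thesis using cs c(1) True by simp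
      next
        case 2
        then have "Y x * ?s = - ?t\<^sup>2" by (simp add: Y_def clip_def max_absorb2)
        then have "indicator W x * gamma x g h + ?f x = partial_deriv 2 (partial_deriv 2 g) x * w x"
          using 2 xW by (simp add: gamma_def gamma_dir_def Q_def grad_def hd w)
        then show ?thesis using cs c(2) True by simp
      next
        case 3
        then have "Y x * ?s = 0" by (auto simp: Y_def clip_def max_def)
        moreover have "gamma x g h = 0" using 3 by (auto simp: gamma_def gamma_dir_def Q_def grad_def indicator_def)
        ultimately have "indicator W x * gamma x g h + ?f x = 0" by (simp only:)
        then show ?thesis using c0 by simp
      qed
    qed
  qed
  have "I_functional W g h = (\<integral>x. ?f x \<partial>lborel) - (\<integral>x. indicator W x * gamma x g h + ?f x \<partial>lborel)"
    using f(1) gi by (simp add: I_functional_def set_lebesgue_integral_def)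
  moreover have "\<bar>\<integral>x. indicator W x * gamma x g h + ?f x \<partial>lborel\<bar> \<le> (\<integral>x. \<bar>indicator W x * gamma x g h + ?f x\<bar> \<partial>lborel)"
    by (rule integral_abs_bound)
  moreover have "\<dots> \<le> (\<integral>x. c * \<bar>w x\<bar> \<partial>lborel)"
    by (rule integral_mono_AE[OF integrable_abs[OF Bochner_Integration.integrable_add[OF gi f(1)]] integrable_mult_right[OF w_integrable] rest])
  moreover have "\<dots> = c * (\<integral>x. \<bar>w x\<bar> \<partial>lborel)" by simp
  ultimately show ?thesis using f(2) unfolding distrib_right by linarith
qed

end


section \<open>Test functions and cut-offs near critical values\<close>

lemma antiderivative_exists:
  fixes f :: "real \<Rightarrow> real"
  assumes "continuous_on UNIV f"
  obtains F where "\<And>u. (F has_real_derivative f u) (at u)"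
proof -
  have "\<exists>F. \<forall>x :: real. -\<infinity> < ereal x \<longrightarrow> ereal x < \<infinity> \<longrightarrow> (F has_vector_derivative f x) (at x)"
    by (rule einterval_antiderivative) (use assms in \<open>auto simp: continuous_on_eq_continuous_at\<close>)
  then obtain F where "\<And>x :: real. (F has_vector_derivative f x) (at x)" by auto
  then show ?thesis using that[of F] by (simp add: has_real_derivative_iff_has_vector_derivative)
qed

definition test_fun :: "real \<Rightarrow> (real \<Rightarrow> real) \<Rightarrow> (real \<Rightarrow> real) \<Rightarrow> bool" where
  "test_fun u0 h h' \<longleftrightarrow> (\<forall>u. (h has_real_derivative h' u) (at u)) \<and> continuous_on UNIV h' \<and> (\<forall>u\<le>u0. h u = 0)"

lemma (in excursion_field) test_fun_excursion_test:
  assumes "test_fun u0 h h'"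
  obtains H where "excursion_test W g u0 H h h'"
proof -
  have "continuous_on UNIV h"
    using assms unfolding test_fun_def by (meson DERIV_isCont continuous_at_imp_continuous_on)
  then obtain H where "\<And>u. (H has_real_derivative h u) (at u)" using antiderivative_exists by blast
  then have "excursion_test W g u0 H h h'"
    using assms by unfold_locales (auto simp: test_fun_def)
  then show ?thesis by (rule that)
qed

lemma has_real_derivative_pos_square:
  "((\<lambda>y::real. (max 0 y)\<^sup>2) has_real_derivative 2 * max 0 y) (at y)"
proof -
  consider "y > 0" | "y < 0" | "y = 0" by linarith
  then show ?thesis
  proof cases
    case 1
    have "((\<lambda>y. y\<^sup>2) has_real_derivative 2 * y) (at y)" by (auto intro!: derivative_eq_intros)
    then show ?thesis
      by (rule has_field_derivative_transform_within_open[where S = "{0<..}", THEN DERIV_cong]) (use 1 in auto)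
  next
    case 2
    have "((\<lambda>y. 0) has_real_derivative 0) (at y)" by simp
    then show ?thesis
      by (rule has_field_derivative_transform_within_open[where S = "{..<0}", THEN DERIV_cong]) (use 2 in auto)
  next
    case 3
    have "((\<lambda>t. ((max 0 t)\<^sup>2 - (max 0 0)\<^sup>2) / (t - 0)) \<longlongrightarrow> (0::real)) (at 0)"
    proof (rule Lim_null_comparison[where g = "\<lambda>t. \<bar>t\<bar>"])
      have "norm (((max 0 t)\<^sup>2 - (max 0 0)\<^sup>2) / (t - 0)) \<le> \<bar>t\<bar>" for t :: real
        by (cases "t \<ge> 0") (auto simp: power2_eq_square max_absorb1)
      then show "eventually (\<lambda>t::real. norm (((max 0 t)\<^sup>2 - (max 0 0)\<^sup>2) / (t - 0)) \<le> \<bar>t\<bar>) (at 0)"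
        by (rule always_eventually[OF allI])
      show "((\<lambda>t::real. \<bar>t\<bar>) \<longlongrightarrow> 0) (at 0)" by (rule tendsto_rabs_zero[OF tendsto_ident_at])
    qed
    then show ?thesis unfolding has_field_derivative_iff using 3 by simp
  qed
qed

text \<open>A continuously differentiable cut-off with an explicit derivative: 0 up to 1, and
  tending to 1 at infinity.\<close>

definition bump :: "real \<Rightarrow> real" where "bump v = (max 0 (v - 1))\<^sup>2 / (1 + (max 0 (v - 1))\<^sup>2)"

lemma bump_bounds: "0 \<le> bump v" "bump v \<le> 1" "v \<le> 1 \<Longrightarrow> bump v = 0"
  using zero_le_power2[of "max 0 (v - 1)"] by (auto simp: bump_def divide_le_eq not_less)

lemma has_real_derivative_bump:
  "(bump has_real_derivative 2 * max 0 (v - 1) / (1 + (max 0 (v - 1))\<^sup>2)\<^sup>2) (at v)"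
proof -
  have "((\<lambda>v. v - 1 :: real) has_real_derivative 1) (at v)" by (auto intro!: derivative_eq_intros)
  from DERIV_chain2[OF has_real_derivative_pos_square this]
  have q: "((\<lambda>v. (max 0 (v - 1 :: real))\<^sup>2) has_real_derivative 2 * max 0 (v - 1)) (at v)" by simp
  have nz: "1 + (max 0 (v - 1))\<^sup>2 \<noteq> (0::real)" using zero_le_power2[of "max 0 (v - 1)"] by linarith
  have "(\<lambda>v. (max 0 (v - 1))\<^sup>2 / (1 + (max 0 (v - 1))\<^sup>2)) = bump" by (simp add: bump_def fun_eq_iff)
  with DERIV_divide[OF q DERIV_add[OF DERIV_const[of 1] q] nz] show ?thesis
    by (simp add: algebra_simps power2_eq_square)
qed

lemma bump_tendsto:
  assumes "p > 0"
  shows "(\<lambda>n. bump (real n * p)) \<longlonglongrightarrow> 1"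
proof -
  have "filterlim (\<lambda>n. real n * p) at_top sequentially"
    using filterlim_tendsto_pos_mult_at_top[OF tendsto_const assms filterlim_real_sequentially] by (simp add: mult.commute)
  from filterlim_tendsto_add_at_top[OF tendsto_const[of "-1"] this]
  have "filterlim (\<lambda>n. real n * p - 1) at_top sequentially" by simp
  then have f: "filterlim (\<lambda>n. (real n * p - 1)\<^sup>2) at_top sequentially"
    by (intro filterlim_pow_at_top) auto
  have "(\<lambda>n. 1 - inverse (1 + (real n * p - 1)\<^sup>2)) \<longlonglongrightarrow> 1 - 0"
    by (intro tendsto_diff tendsto_const tendsto_inverse_0_at_top filterlim_tendsto_add_at_top[OF tendsto_const f])
  then have "(\<lambda>n. 1 - inverse (1 + (real n * p - 1)\<^sup>2)) \<longlonglongrightarrow> 1" by simp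
  moreover have "eventually (\<lambda>n. 1 - inverse (1 + (real n * p - 1)\<^sup>2) = bump (real n * p)) sequentially"
  proof -
    have "eventually (\<lambda>n. real n * p \<ge> 1) sequentially"
      using \<open>filterlim (\<lambda>n. real n * p) at_top sequentially\<close> by (simp add: filterlim_at_top)
    then show ?thesis
    proof eventually_elim
      case (elim n)
      have "1 + (real n * p - 1)\<^sup>2 \<noteq> 0" using zero_le_power2[of "real n * p - 1"] by linarith
      then show ?case using elim by (simp add: bump_def field_simps)
    qed
  qed
  ultimately show ?thesis by (rule Lim_transform_eventually)
qed

lemma cutoff_sequence:
  assumes fin: "finite (A :: real set)" and h: "test_fun u0 h h'"
  shows "\<exists>(\<theta> :: nat \<Rightarrow> real \<Rightarrow> real) k S. (\<forall>n. test_fun u0 (\<lambda>u. \<theta> n u * h u) (k n) \<and> continuous_on UNIV (\<theta> n)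
      \<and> closed (S n) \<and> S n \<subseteq> {u0..} \<and> S n \<inter> A = {} \<and> (\<forall>u. 0 \<le> \<theta> n u \<and> \<theta> n u \<le> 1 \<and> (u \<notin> S n \<longrightarrow> \<theta> n u * h u = 0)))
      \<and> (\<forall>u. u \<notin> A \<longrightarrow> (\<lambda>n. \<theta> n u) \<longlonglongrightarrow> 1)"
proof -
  \<comment> \<open>A nonnegative polynomial vanishing exactly on A. Since \<open>bump\<close> is 0
    up to 1, \<open>bump (n * P)\<close> vanishes near A, and off A it tends to 1.\<close>
  define P where "P = (\<Prod>c\<in>A. [:- c, 1:] ^ 2)"
  have P: "poly P u = (\<Prod>c\<in>A. (u - c)\<^sup>2)" for u by (simp add: P_def poly_prod)
  have P0: "poly P u \<ge> 0" for u unfolding P by (rule prod_nonneg) simp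
  have Pz: "poly P u = 0 \<longleftrightarrow> u \<in> A" for u unfolding P using fin by (simp add: prod_zero_iff)
  define \<theta> where "\<theta> n u = bump (real n * poly P u)" for n u
  define S where "S n = {u. u0 \<le> u \<and> 1 \<le> real n * poly P u}" for n
  define d where "d n u = 2 * max 0 (real n * poly P u - 1) / (1 + (max 0 (real n * poly P u - 1))\<^sup>2)\<^sup>2 * (real n * poly (pderiv P) u)" for n u
  have \<theta>': "(\<theta> n has_real_derivative d n u) (at u)" for n u
  proof -
    have "((\<lambda>u. real n * poly P u) has_real_derivative real n * poly (pderiv P) u) (at u)"
      by (auto intro!: derivative_eq_intros)
    from DERIV_chain2[OF has_real_derivative_bump this] show ?thesis by (simp add: \<theta>_def[abs_def] d_def)
  qed
  have nz: "1 + (max 0 v)\<^sup>2 \<noteq> (0::real)" for v using zero_le_power2[of "max 0 v"] by linarith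
  have dc: "continuous_on UNIV (d n)" for n
    unfolding d_def[abs_def] using nz by (intro continuous_intros) auto
  have \<theta>c: "continuous_on UNIV (\<theta> n)" for n
    using \<theta>' by (meson DERIV_isCont continuous_at_imp_continuous_on)
  have hc: "continuous_on UNIV h" "continuous_on UNIV h'" and hd: "\<And>u. (h has_real_derivative h' u) (at u)"
    using h unfolding test_fun_def by (meson DERIV_isCont continuous_at_imp_continuous_on)+
  have t: "test_fun u0 (\<lambda>u. \<theta> n u * h u) (\<lambda>u. d n u * h u + h' u * \<theta> n u)" for n
    unfolding test_fun_def
  proof (intro conjI allI impI)
    show "((\<lambda>u. \<theta> n u * h u) has_real_derivative d n u * h u + h' u * \<theta> n u) (at u)" for u
      by (rule DERIV_mult[OF \<theta>' hd])
    show "continuous_on UNIV (\<lambda>u. d n u * h u + h' u * \<theta> n u)" by (intro continuous_intros dc \<theta>c hc)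
    show "u \<le> u0 \<Longrightarrow> \<theta> n u * h u = 0" for u using h by (simp add: test_fun_def)
  qed
  have lim: "(\<lambda>n. \<theta> n u) \<longlonglongrightarrow> 1" if "u \<notin> A" for u
  proof -
    have "poly P u > 0" using P0[of u] Pz[of u] that by linarith
    from bump_tendsto[OF this] show ?thesis by (simp add: \<theta>_def)
  qed
  have "closed (S n)" for n
  proof -
    have "S n = {u. u0 \<le> u} \<inter> {u. 1 \<le> real n * poly P u}" by (auto simp: S_def)
    moreover have "closed {u. u0 \<le> u}" "closed {u. 1 \<le> real n * poly P u}"
      by (intro closed_Collect_le continuous_intros)+
    ultimately show ?thesis by (simp add: closed_Int)
  qed
  moreover have "S n \<inter> A = {}" for n
  proof -
    have "u \<notin> S n" if "u \<in> A" for u using Pz[of u] that by (simp add: S_def)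
    then show ?thesis by blast
  qed
  moreover have "\<theta> n u * h u = 0" if "u \<notin> S n" for n u
    using that h bump_bounds(3)[of "real n * poly P u"] by (auto simp: S_def \<theta>_def test_fun_def not_le)
  ultimately show ?thesis
    using t lim \<theta>c bump_bounds(1,2)
    by (intro exI[of _ \<theta>] exI[of _ "\<lambda>n u. d n u * h u + h' u * \<theta> n u"] exI[of _ S] conjI allI impI) (auto simp: S_def \<theta>_def)
qed


section \<open>Functions that are Morse above a level\<close>

text \<open>The linearised gradient is injective, hence bounded below, and near x this dominates the
  remainder.\<close>

lemma critical_point_isolated:
  assumes C2: "C2_on W g" and x: "x \<in> W" "grad g x = 0" "invertible (hessian g x)"
  shows "\<exists>d>0. \<forall>y. norm (y - x) < d \<and> grad g y = 0 \<longrightarrow> y = x"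
proof -
  \<comment> \<open>Row i of the transpose holds the derivatives of the i-th partial derivative, so
    A is the derivative of the gradient without appeal to the symmetry of second
    derivatives.\<close>
  define A where "A = transpose (hessian g x)"
  have "invertible A" unfolding A_def by (rule transpose_invertible[OF x(3)])
  then have "inj ((*v) A)" by (rule inj_matrix_vector_mult)
  then obtain B where B: "B > 0" "\<And>v. B * norm v \<le> norm (A *v v)"
    using linear_inj_bounded_below_pos[OF matrix_vector_mul_linear] by blast
  have Av: "(A *v v) $ i = v$1 * partial_deriv 1 (partial_deriv i g) x + v$2 * partial_deriv 2 (partial_deriv i g) x" for v i
    by (simp add: matrix_vector_mult_def A_def transpose_def hessian_def sum_2)
  \<comment> \<open>A quarter of B for each of the two coordinates adds up to B / 2, strictly below
    the lower bound B.\<close>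
  have "\<exists>d>0. \<forall>y. norm (y - x) < d \<longrightarrow> norm (partial_deriv i g y - partial_deriv i g x - (A *v (y - x)) $ i) \<le> B / 4 * norm (y - x)" for i
  proof -
    have "(partial_deriv i g has_derivative (\<lambda>v. (A *v v) $ i)) (at x)"
      unfolding Av by (rule has_derivative_partials[OF C1_on_imp(1)[OF C2_on_imp(2)[OF C2] x(1)]])
    then show ?thesis using B(1) unfolding has_derivative_at_alt by (metis divide_pos_pos zero_less_numeral)
  qed
  from this[of 1] this[of 2] obtain d1 d2 where d: "d1 > 0" "d2 > 0"
    "\<And>y. norm (y - x) < d1 \<Longrightarrow> norm (partial_deriv 1 g y - partial_deriv 1 g x - (A *v (y - x)) $ 1) \<le> B / 4 * norm (y - x)"
    "\<And>y. norm (y - x) < d2 \<Longrightarrow> norm (partial_deriv 2 g y - partial_deriv 2 g x - (A *v (y - x)) $ 2) \<le> B / 4 * norm (y - x)"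
    by blast
  have "y = x" if y: "norm (y - x) < min d1 d2" "grad g y = 0" for y
  proof (rule ccontr)
    assume "y \<noteq> x"
    have z: "partial_deriv i g y = 0" "partial_deriv i g x = 0" for i
      using y(2) x(2) by (auto simp: grad_def vec_eq_iff)
    have "\<bar>(A *v (y - x)) $ 1\<bar> \<le> B / 4 * norm (y - x)" "\<bar>(A *v (y - x)) $ 2\<bar> \<le> B / 4 * norm (y - x)"
      using d(3)[of y] d(4)[of y] y(1) by (simp_all add: z)
    then have "norm (A *v (y - x)) \<le> B / 2 * norm (y - x)"
      using norm_le_l1_cart[of "A *v (y - x)"] by (simp add: sum_2)
    moreover have "B / 2 * norm (y - x) < B * norm (y - x)" using \<open>y \<noteq> x\<close> B(1) by simp
    ultimately show False using B(2)[of "y - x"] by linarith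
  qed
  then show ?thesis using d(1,2) by (intro exI[of _ "min d1 d2"]) auto
qed

lemma AE_lborel_ex: "(AE x in (lborel :: 'a::euclidean_space measure). P x) \<Longrightarrow> \<exists>x. P x"
proof (rule ccontr)
  assume P: "AE x in (lborel :: 'a measure). P x" and "\<not> (\<exists>x. P x)"
  then have "AE x in (lborel :: 'a measure). False" by simp
  then have "ae_filter (lborel :: 'a measure) = bot" by (simp add: trivial_limit_def)
  then show False by (simp add: ae_filter_eq_bot_iff)
qed

locale morse_field = excursion_field +
  assumes morse: "morse_above W g u0"
begin

text \<open>Infinitely many critical points would accumulate in the compact set \<open>K\<close>; by
  continuity the limit is critical, contradicting isolation.\<close>

lemma finite_critical: "finite {x \<in> K. grad g x = 0}"
proof (rule ccontr)
  assume "infinite {x \<in> K. grad g x = 0}"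
  then obtain x where x: "x \<in> K" "x islimpt {x \<in> K. grad g x = 0}"
    using cK unfolding compact_eq_Bolzano_Weierstrass by (metis (no_types, lifting) mem_Collect_eq subsetI)
  have xW: "x \<in> W" using x(1) K_W by blast
  have "partial_deriv i g x = 0" for i
  proof (rule ccontr)
    assume nz: "partial_deriv i g x \<noteq> 0"
    have "continuous (at x) (partial_deriv i g)"
      using C1_on_imp(2)[OF C1(1)] W xW continuous_on_eq_continuous_at by blast
    then have "eventually (\<lambda>y. partial_deriv i g y \<noteq> 0) (at x)"
      using nz by (auto simp: isCont_def intro: tendsto_imp_eventually_ne)
    then have "eventually (\<lambda>y. y \<notin> {x \<in> K. grad g x = 0}) (at x)"
      by (rule eventually_mono) (auto simp: grad_def vec_eq_iff)
    then show False using x(2) by (simp add: islimpt_iff_eventually)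
  qed
  then have gx: "grad g x = 0" by (simp add: grad_def vec_eq_iff)
  have "g x \<ge> u0" using x(1) by (simp add: excursion_def)
  then have "invertible (hessian g x)" using morse xW gx by (simp add: morse_above_def)
  then obtain d where d: "d > 0" "\<And>y. norm (y - x) < d \<Longrightarrow> grad g y = 0 \<Longrightarrow> y = x"
    using critical_point_isolated[OF C2 xW gx] by blast
  obtain y where "y \<in> K" "grad g y = 0" "y \<noteq> x" "dist y x < d"
    using x(2) d(1) by (auto simp: islimpt_approachable)
  then show False using d(2)[of y] by (simp add: dist_norm)
qed

lemma AE_not_critical: "AE x in lborel. x \<in> K \<longrightarrow> grad g x \<noteq> 0"
  using AE_not_in[OF finite_imp_null_set_lborel[OF finite_critical]] by eventually_elim simp

lemma AE_level: "AE x in lborel. x \<in> K \<longrightarrow> g x \<noteq> c"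
proof -
  have "AE x in lborel. x \<notin> {x \<in> W. g x = c \<and> partial_deriv i g x \<noteq> 0}" for i
    by (rule AE_not_in[OF null_set_level[OF W C1(1)]])
  from this[of 1] this[of 2] AE_not_critical show ?thesis
  proof eventually_elim
    case (elim x)
    then show ?case using K_W by (auto simp: grad_def vec_eq_iff forall_2)
  qed
qed

definition crit_values :: "real set" where "crit_values = g ` {x \<in> K. grad g x = 0}"

lemma finite_crit_values: "finite crit_values"
  unfolding crit_values_def using finite_critical by simp

lemma critical_value_iff: "u0 \<le> u \<Longrightarrow> critical_value W g u \<longleftrightarrow> u \<in> crit_values"
  by (auto simp: critical_value_def crit_values_def excursion_def)

section \<open>Dependence of the Euler characteristic on the level\<close>

abbreviation "EC \<equiv> excursion_euler W g"

text \<open>No deformation of level sets is used. One mesh is fine enough for all levels near u, and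
  on a grid none of whose points has value u the sampled set does not change under small changes of
  the level.\<close>

lemma chi_locally_constant:
  assumes u: "u0 < u" "u \<notin> crit_values"
  shows "\<exists>\<delta>>0. \<forall>u'. \<bar>u' - u\<bar> < \<delta> \<longrightarrow> EC u' = EC u"
proof -
  have "open ({u0<..} - crit_values)" using finite_crit_values by (intro open_Diff finite_imp_closed) auto
  then obtain d where d: "d > 0" "cball u d \<subseteq> {u0<..} - crit_values"
    using u open_contains_cball by (metis DiffI greaterThan_iff)
  have reg: "\<not> critical_value W g v" if "v \<in> cball u d" for v
    using d(2) that critical_value_iff[of v] by force
  have "\<exists>e0>0. \<forall>e v z. 0 < e \<longrightarrow> e < e0 \<longrightarrow> v \<in> cball u d \<longrightarrow> euler_char (excursion W g v) = corner_count (gset z e (excursion W g v))"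
  proof (rule euler_char_excursion_grid[OF W C1(1) cK closed_cball _ reg])
    show "cball u d \<subseteq> {u0..}" using d(2) by force
    fix e0 assume "0 < e0" and "\<And>e v z. 0 < e \<Longrightarrow> e < e0 \<Longrightarrow> v \<in> cball u d \<Longrightarrow> euler_char (excursion W g v) = corner_count (gset z e (excursion W g v))"
    then show ?thesis by (intro exI[of _ e0] conjI allI impI)
  qed
  then obtain e0 where e0: "e0 > 0" "\<And>e v z. 0 < e \<Longrightarrow> e < e0 \<Longrightarrow> v \<in> cball u d \<Longrightarrow> euler_char (excursion W g v) = corner_count (gset z e (excursion W g v))"
    by metis
  define e where "e = e0 / 2"
  have e: "0 < e" "e < e0" using e0(1) by (auto simp: e_def)
  \<comment> \<open>For each of the countably many p, almost every translate keeps
    \<open>gpt z e p\<close> off the null set of points of level u, so some translate works for all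
    p.\<close>
  obtain z where z: "\<And>p. gpt z e p \<in> K \<Longrightarrow> g (gpt z e p) \<noteq> u"
  proof -
    have "AE z in lborel. gpt z e p \<in> K \<longrightarrow> g (gpt z e p) \<noteq> u" for p
    proof -
      obtain B where B: "{x. \<not> (x \<in> K \<longrightarrow> g x \<noteq> u)} \<subseteq> B" "B \<in> null_sets lborel"
        using AE_level[of u] by (auto elim!: AE_E simp: null_sets_def)
      have Bb: "B \<in> sets borel" using B(2) by (auto simp: null_sets_def)
      have "(\<integral>\<^sup>+z. indicator B (z + e *\<^sub>R pv p) \<partial>lborel) = 0"
        using emeasure_lborel_translate[OF Bb] B(2) by (simp add: null_sets_def)
      moreover have "(\<lambda>z. indicator B (z + e *\<^sub>R pv p) :: ennreal) \<in> borel_measurable lborel" using Bb by measurable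
      ultimately have "AE z in lborel. indicator B (z + e *\<^sub>R pv p) = (0::ennreal)"
        by (simp add: nn_integral_0_iff_AE)
      then show ?thesis
        by eventually_elim (use B(1) in \<open>auto simp: gpt_def indicator_def split: if_splits\<close>)
    qed
    then have "AE z in lborel. \<forall>p. gpt z e p \<in> K \<longrightarrow> g (gpt z e p) \<noteq> u" by (simp add: AE_all_countable)
    then show ?thesis using AE_lborel_ex that by blast
  qed
  define F where "F = {p. gpt z e p \<in> K}"
  have finF: "finite F" unfolding F_def by (rule finite_grid_bounded[OF compact_imp_bounded[OF cK] e(1)])
  \<comment> \<open>Only finitely many grid points lie in \<open>K\<close>, so their values keep a
    positive distance from u; d keeps the levels regular.\<close>
  define \<delta> where "\<delta> = Min (insert d ((\<lambda>p. \<bar>g (gpt z e p) - u\<bar>) ` F))"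
  have \<delta>: "\<delta> > 0" "\<delta> \<le> d" "\<And>p. p \<in> F \<Longrightarrow> \<delta> \<le> \<bar>g (gpt z e p) - u\<bar>"
    using finF d(1) z by (auto simp: \<delta>_def F_def)
  have "EC u' = EC u" if u': "\<bar>u' - u\<bar> < \<delta>" for u'
  proof -
    have uc: "u' \<in> cball u d" "u \<in> cball u d" using u' \<delta>(2) d(1) by (auto simp: dist_real_def)
    have u0': "u0 < u'" "u0 < u" using subsetD[OF d(2) uc(1)] u(1) by auto
    have "p \<in> gset z e (excursion W g u') \<longleftrightarrow> p \<in> gset z e (excursion W g u)" for p
    proof (cases "p \<in> F")
      case True
      then have "gpt z e p \<in> W" using K_W by (auto simp: F_def)
      then show ?thesis using \<delta>(3)[OF True] u' by (auto simp: gset_def excursion_def)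
    next
      case False
      then show ?thesis using u0' by (auto simp: gset_def excursion_def F_def)
    qed
    then have "gset z e (excursion W g u') = gset z e (excursion W g u)" by blast
    then have "euler_char (excursion W g u') = euler_char (excursion W g u)"
      using e0(2)[OF e uc(1), of z] e0(2)[OF e uc(2), of z] by simp
    then show ?thesis using excursion_compact u0' reg[OF uc(1)] reg[OF uc(2)] by (simp add: excursion_euler_def)
  qed
  then show ?thesis using \<delta>(1) by blast
qed

lemma chi_constant:
  assumes "u0 < a" "a \<le> b" "{a..b} \<inter> crit_values = {}"
  shows "EC a = EC b"
proof -
  have "EC constant_on {a..b}"
  proof (rule locally_constant_imp_constant[OF connected_Icc])
    fix u assume u: "u \<in> {a..b}"
    then have "u0 < u" "u \<notin> crit_values" using assms by auto
    from chi_locally_constant[OF this] obtain \<delta> where \<delta>: "\<delta> > 0" "\<forall>u'. \<bar>u' - u\<bar> < \<delta> \<longrightarrow> EC u' = EC u" by blast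
    then show "\<exists>T. openin (top_of_set {a..b}) T \<and> u \<in> T \<and> (\<forall>x\<in>T. EC x = EC u)"
    proof (intro exI[of _ "{a..b} \<inter> ball u \<delta>"] conjI ballI)
      show "openin (top_of_set {a..b}) ({a..b} \<inter> ball u \<delta>)" by (rule openin_open_Int[OF open_ball])
      show "u \<in> {a..b} \<inter> ball u \<delta>" using u \<delta>(1) by simp
      fix x assume "x \<in> {a..b} \<inter> ball u \<delta>"
      then have "\<bar>x - u\<bar> < \<delta>" by (simp add: dist_real_def abs_minus_commute)
      then show "EC x = EC u" using \<delta>(2) by blast
    qed
  qed
  then show ?thesis using assms(2) by (auto simp: constant_on_def)
qed

text \<open>On regular levels the value depends only on the largest critical value below, or u0 if
  there is none, so only finitely many values occur. This gives a bound up to the critical values,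
  where no common mesh exists.\<close>

lemma chi_bounded: "\<exists>B\<ge>0. \<forall>u>u0. \<bar>EC u\<bar> \<le> B"
proof -
  define V where "V = {u0<..} - crit_values"
  define pred where "pred u = Max (insert u0 {c \<in> crit_values. c < u})" for u
  have fin: "finite {c \<in> crit_values. c < u}" for u using finite_crit_values by simp
  have pred_less: "pred u < u" if "u \<in> V" for u
    using that fin[of u] by (auto simp: pred_def V_def)
  have eq: "EC u = EC v" if uv: "u \<in> V" "v \<in> V" "pred u = pred v" "u \<le> v" for u v
  proof (rule chi_constant)
    show "{u..v} \<inter> crit_values = {}"
    proof (rule ccontr)
      assume "{u..v} \<inter> crit_values \<noteq> {}"
      then obtain c where c: "c \<in> crit_values" "u \<le> c" "c \<le> v" by auto
      then have "c < v" using uv(2) by (auto simp: V_def le_less)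
      then have "c \<le> pred v" using c(1) fin[of v] by (simp add: pred_def)
      then show False using pred_less[OF uv(1)] uv(3) c(2) by simp
    qed
  qed (use uv in \<open>auto simp: V_def\<close>)
  have eq': "EC u = EC v" if "u \<in> V" "v \<in> V" "pred u = pred v" for u v
  proof (cases "u \<le> v")
    case True
    show ?thesis by (rule eq[OF that True])
  next
    case False
    then have "v \<le> u" by simp
    show ?thesis by (rule eq[OF that(2,1) that(3)[symmetric] \<open>v \<le> u\<close>, symmetric])
  qed
  have "pred u \<in> insert u0 {c \<in> crit_values. c < u}" for u
    unfolding pred_def by (rule Max_in) (use fin in auto)
  then have "pred ` V \<subseteq> insert u0 crit_values" by blast
  then have "finite (pred ` V)" using finite_crit_values finite_subset by blast
  moreover have "EC ` V \<subseteq> (\<lambda>d. EC (SOME u. u \<in> V \<and> pred u = d)) ` (pred ` V)"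
  proof
    fix y assume "y \<in> EC ` V"
    then obtain u where u: "u \<in> V" "y = EC u" by blast
    have "(SOME v. v \<in> V \<and> pred v = pred u) \<in> V \<and> pred (SOME v. v \<in> V \<and> pred v = pred u) = pred u"
      by (rule someI[of "\<lambda>v. v \<in> V \<and> pred v = pred u" u]) (simp add: u)
    then have "y = EC (SOME v. v \<in> V \<and> pred v = pred u)" using eq' u by metis
    then show "y \<in> (\<lambda>d. EC (SOME u. u \<in> V \<and> pred u = d)) ` (pred ` V)" using u(1) by blast
  qed
  ultimately have "finite (EC ` V)" using finite_subset by blast
  then have "bounded (EC ` V)" by (rule finite_imp_bounded)
  then obtain B where B: "\<forall>u\<in>V. \<bar>EC u\<bar> \<le> B" by (auto simp: bounded_iff)
  have "\<bar>EC u\<bar> \<le> max B 0" if "u > u0" for u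
  proof (cases "u \<in> V")
    case True then show ?thesis using B by (simp add: le_max_iff_disj)
  next
    case False
    then have "critical_value W g u" using that critical_value_iff[of u] by (simp add: V_def)
    then show ?thesis by (simp add: excursion_euler_def)
  qed
  then show ?thesis by (intro exI[of _ "max B 0"]) auto
qed

lemma chi_vanishes: "\<exists>B. \<forall>u>B. EC u = 0"
proof -
  obtain B where B: "\<And>x. G x \<le> B" using G_bounded by blast
  have "EC u = 0" if u: "u > max B u0" for u
  proof -
    have "excursion W g u = {}" using excursion_eq_G[of u] u B by (auto simp: not_le intro: le_less_trans)
    moreover have "components (UNIV :: (real^2) set) = {UNIV}"
      by (simp add: components_eq_sing_iff)
    moreover have "\<not> bounded (UNIV :: (real^2) set)" by (rule not_bounded_UNIV)
    ultimately show ?thesis by (simp add: excursion_euler_def euler_char_def)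
  qed
  then show ?thesis by blast
qed

text \<open>The identity holds for the cut-off functions \<theta> n * h, and both sides pass to the
  limit: the level integral by dominated convergence, the other side by \<open>I_bound\<close>
  applied to the remainders h - \<theta> n * h.\<close>

theorem chi_eq_I:
  assumes t: "test_fun u0 h h'"
    and diag: "AE x in lborel. x \<in> K \<longrightarrow> \<not> (grad g x $ 1 = grad g x $ 2 \<and> grad g x $ 1 < 0)"
  shows "integrable lborel (\<lambda>u. h u * EC u)" "set_integrable lborel W (\<lambda>x. gamma x g h)"
    "chi W g h = I_functional W g h"
proof -
  obtain \<theta> k :: "nat \<Rightarrow> real \<Rightarrow> real" and S :: "nat \<Rightarrow> real set" where
    *: "\<forall>n. test_fun u0 (\<lambda>u. \<theta> n u * h u) (k n) \<and> continuous_on UNIV (\<theta> n)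
      \<and> closed (S n) \<and> S n \<subseteq> {u0..} \<and> S n \<inter> crit_values = {} \<and> (\<forall>u. 0 \<le> \<theta> n u \<and> \<theta> n u \<le> 1 \<and> (u \<notin> S n \<longrightarrow> \<theta> n u * h u = 0))"
    and **: "\<forall>u. u \<notin> crit_values \<longrightarrow> (\<lambda>n. \<theta> n u) \<longlonglongrightarrow> 1"
    using cutoff_sequence[OF finite_crit_values t] by (elim exE conjE)
  have tn: "test_fun u0 (\<lambda>u. \<theta> n u * h u) (k n)" and \<theta>c: "continuous_on UNIV (\<theta> n)"
    and S: "closed (S n)" "S n \<subseteq> {u0..}" "S n \<inter> crit_values = {}" for n
    using * by simp_all
  have \<theta>: "0 \<le> \<theta> n u" "\<theta> n u \<le> 1" and S0: "u \<notin> S n \<Longrightarrow> \<theta> n u * h u = 0"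
    and \<theta>1: "u \<notin> crit_values \<Longrightarrow> (\<lambda>n. \<theta> n u) \<longlonglongrightarrow> 1" for n u
    using * ** by blast+
  let ?h = "\<lambda>n u. \<theta> n u * h u" and ?r = "\<lambda>n u. h u - \<theta> n u * h u"
  obtain H where ex: "excursion_test W g u0 H h h'" using test_fun_excursion_test[OF t] by blast
  interpret E: excursion_test W g u0 H h h' by (rule ex)
  show si: "set_integrable lborel W (\<lambda>x. gamma x g h)" by (rule E.corner_limit(1)[OF AE_not_critical diag])
  have tr: "test_fun u0 (?r n) (\<lambda>u. h' u - k n u)" for n
    using t tn[of n] by (auto simp: test_fun_def intro!: DERIV_diff continuous_on_diff)
  obtain L where L: "L \<ge> 0" "\<forall>x\<in>K. \<forall>e. 0 \<le> e \<and> e \<le> margin \<longrightarrow> \<bar>Y (x - e *\<^sub>R axis 1 1) - Y x\<bar> \<le> L * e"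
    using Y_lipschitz by blast
  obtain c1 where c1: "\<forall>x\<in>N. \<bar>partial_deriv 1 (partial_deriv 1 g) x\<bar> \<le> c1" using bounded_on_N[OF C1_on_imp(2)[OF C1(2)]] by blast
  obtain c2 where c2: "\<forall>x\<in>N. \<bar>partial_deriv 2 (partial_deriv 2 g) x\<bar> \<le> c2" using bounded_on_N[OF C1_on_imp(2)[OF C1(2)]] by blast
  define c where "c = max c1 c2"
  have c: "\<forall>x\<in>K. \<bar>partial_deriv 1 (partial_deriv 1 g) x\<bar> \<le> c" "\<forall>x\<in>K. \<bar>partial_deriv 2 (partial_deriv 2 g) x\<bar> \<le> c"
    using c1 c2 K_N by (auto simp: c_def le_max_iff_disj)
  have hn: "integrable lborel (\<lambda>u. ?h n u * EC u) \<and> chi W g (?h n) = I_functional W g (?h n) \<and> set_integrable lborel W (\<lambda>x. gamma x g (?h n))" for n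
  proof -
    obtain Hn where "excursion_test W g u0 Hn (?h n) (k n)" using test_fun_excursion_test[OF tn] by blast
    then interpret F: excursion_test W g u0 Hn "?h n" "k n" .
    have reg: "\<not> critical_value W g u" if "u \<in> S n" for u using S(2,3)[of n] that critical_value_iff[of u] by auto
    show ?thesis
      using F.chi_eq_corner(1)[OF S(1,2) reg S0] F.chi_eq_I_regular[OF AE_not_critical diag S(1,2) reg S0]
        F.corner_limit(1)[OF AE_not_critical diag] by blast
  qed
  \<comment> \<open>\<open>I_functional\<close> is linear in the test function, and its value at the
    remainder is bounded by an integral free of derivatives of the cut-off.\<close>
  have Idiff: "I_functional W g h - I_functional W g (?h n) = I_functional W g (?r n)"
    and Ibd: "\<bar>I_functional W g (?r n)\<bar> \<le> (L + c) * (\<integral>x. \<bar>?r n (G x)\<bar> \<partial>lborel)" for n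
  proof -
    obtain Hr where "excursion_test W g u0 Hr (?r n) (\<lambda>u. h' u - k n u)" using test_fun_excursion_test[OF tr] by blast
    then interpret F: excursion_test W g u0 Hr "?r n" "\<lambda>u. h' u - k n u" .
    show "\<bar>I_functional W g (?r n)\<bar> \<le> (L + c) * (\<integral>x. \<bar>?r n (G x)\<bar> \<partial>lborel)"
      by (rule F.I_bound[OF diag L c F.corner_limit(1)[OF AE_not_critical diag]])
    have d: "deriv h u = h' u" "deriv (?h n) u = k n u" "deriv (?r n) u = h' u - k n u" for u
      using DERIV_imp_deriv[OF E.h] DERIV_imp_deriv[OF F.h] tn[of n] by (auto simp: test_fun_def intro!: DERIV_imp_deriv)
    have "gamma x g (?r n) = gamma x g h - gamma x g (?h n)" for x
      unfolding gamma_def gamma_dir_def d by (simp add: algebra_simps)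
    then show "I_functional W g h - I_functional W g (?h n) = I_functional W g (?r n)"
      using set_integral_diff(2)[OF si] hn[of n] by (simp add: I_functional_def)
  qed
  have "(\<lambda>n. \<integral>x. \<bar>?r n (G x)\<bar> \<partial>lborel) \<longlonglongrightarrow> (\<integral>x. 0 \<partial>(lborel :: (real^2) measure))"
  proof (rule integral_dominated_convergence[where w = "\<lambda>x. \<bar>h (G x)\<bar>"])
    have [measurable]: "\<theta> n \<in> borel_measurable borel" for n using \<theta>c by (rule borel_measurable_continuous_onI)
    show "(\<lambda>x. \<bar>?r n (G x)\<bar>) \<in> borel_measurable lborel" for n by measurable
    show "integrable lborel (\<lambda>x. \<bar>h (G x)\<bar>)" by (rule E.w_integrable)
    \<comment> \<open>The cut-offs may fail to converge to 1 only at critical values, and almost no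
      point has such a value.\<close>
    have "AE x in lborel. \<forall>c\<in>crit_values. x \<in> K \<longrightarrow> g x \<noteq> c" by (rule AE_finite_allI[OF finite_crit_values AE_level])
    then show "AE x in lborel. (\<lambda>n. \<bar>?r n (G x)\<bar>) \<longlonglongrightarrow> 0"
    proof eventually_elim
      case (elim x)
      show ?case
      proof (cases "x \<in> K")
        case True
        then have "G x \<notin> crit_values" using elim by (auto simp: G_def)
        then have "(\<lambda>n. \<bar>h (G x) - \<theta> n (G x) * h (G x)\<bar>) \<longlonglongrightarrow> \<bar>h (G x) - 1 * h (G x)\<bar>"
          by (intro tendsto_intros \<theta>1)
        then show ?thesis by simp
      qed (simp add: E.w_outside)
    qed
    show "AE x in lborel. norm \<bar>?r n (G x)\<bar> \<le> \<bar>h (G x)\<bar>" for n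
    proof (rule AE_I2)
      fix x :: "real^2"
      have "\<bar>1 - \<theta> n (G x)\<bar> * \<bar>h (G x)\<bar> \<le> 1 * \<bar>h (G x)\<bar>"
        using \<theta>(1)[of n "G x"] \<theta>(2)[of n "G x"] by (intro mult_right_mono) auto
      then show "norm \<bar>?r n (G x)\<bar> \<le> \<bar>h (G x)\<bar>" by (simp flip: abs_mult add: left_diff_distrib)
    qed
  qed auto
  then have "(\<lambda>n. (L + c) * (\<integral>x. \<bar>?r n (G x)\<bar> \<partial>lborel)) \<longlonglongrightarrow> (L + c) * 0"
    by (intro tendsto_mult tendsto_const) simp
  then have lim0: "(\<lambda>n. (L + c) * (\<integral>x. \<bar>?r n (G x)\<bar> \<partial>lborel)) \<longlonglongrightarrow> 0" by simp
  have "eventually (\<lambda>n. norm (I_functional W g (?r n)) \<le> (L + c) * (\<integral>x. \<bar>?r n (G x)\<bar> \<partial>lborel)) sequentially"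
    unfolding real_norm_def by (rule always_eventually[OF allI[OF Ibd]])
  then have "(\<lambda>n. I_functional W g (?r n)) \<longlonglongrightarrow> 0" using lim0 by (rule Lim_null_comparison)
  then have "(\<lambda>n. I_functional W g h - I_functional W g (?r n)) \<longlonglongrightarrow> I_functional W g h - 0"
    by (intro tendsto_diff tendsto_const)
  moreover have "I_functional W g h - I_functional W g (?r n) = chi W g (?h n)" for n
    using Idiff[of n] hn[of n] by linarith
  ultimately have lim1: "(\<lambda>n. chi W g (?h n)) \<longlonglongrightarrow> I_functional W g h" by simp
  \<comment> \<open>Convergence holds at every level: at critical ones by the convention that the
    Euler characteristic is 0 there.\<close>
  have pt: "(\<lambda>n. ?h n u * EC u) \<longlonglongrightarrow> h u * EC u" for u
  proof (cases "u \<in> crit_values \<or> u \<le> u0")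
    case True
    have "h u * EC u = 0"
    proof (cases "u \<le> u0")
      case True then show ?thesis using E.h_zero by simp
    next
      case False
      then have "critical_value W g u" using True critical_value_iff[of u] by simp
      then show ?thesis by (simp add: excursion_euler_def)
    qed
    then have eq: "?h n u * EC u = h u * EC u" for n by (simp add: mult.assoc)
    show ?thesis unfolding eq by (rule tendsto_const)
  next
    case False
    then have "(\<lambda>n. \<theta> n u * h u * EC u) \<longlonglongrightarrow> 1 * h u * EC u" by (intro tendsto_intros \<theta>1) simp
    then show ?thesis by simp
  qed
  obtain B where B: "B \<ge> 0" "\<forall>u>u0. \<bar>EC u\<bar> \<le> B" using chi_bounded by blast
  obtain T where T: "\<forall>u>T. EC u = 0" using chi_vanishes by blast
  have "compact (h ` {u0..T})" by (intro compact_continuous_image continuous_on_subset[OF E.h_cont]) auto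
  then obtain C where C: "\<forall>u\<in>{u0..T}. \<bar>h u\<bar> \<le> C" by (auto dest!: compact_imp_bounded simp: bounded_iff)
  have dom: "norm (?h n u * EC u) \<le> C * B * indicator {u0..T} u" for n u
  proof (cases "u \<in> {u0..T} \<and> u \<noteq> u0")
    case True
    have "\<bar>\<theta> n u\<bar> * \<bar>h u\<bar> * \<bar>EC u\<bar> \<le> (1 * C) * B"
      using True \<theta>(1,2)[of n u] C B by (intro mult_mono mult_nonneg_nonneg) (auto intro: order_trans[OF abs_ge_zero])
    then show ?thesis using True by (simp add: abs_mult)
  next
    case False
    then have "?h n u * EC u = 0" using E.h_zero[of u] T by (cases "u \<le> u0") auto
    moreover have "C * B * indicator {u0..T} u \<ge> 0"
    proof (cases "u \<in> {u0..T}")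
      case True
      then have "0 \<le> C" using C abs_ge_zero[of "h u"] by force
      then show ?thesis using B(1) by simp
    qed simp
    ultimately show ?thesis by (simp only: norm_zero)
  qed
  have m: "(\<lambda>u. ?h n u * EC u) \<in> borel_measurable lborel" for n using hn[of n] by auto
  have m': "(\<lambda>u. h u * EC u) \<in> borel_measurable lborel" by (rule borel_measurable_LIMSEQ_real[OF pt m])
  have w: "integrable lborel (\<lambda>u. C * B * indicator {u0..T} u)"
    by (intro integrable_mult_right integrable_real_indicator) (auto simp: emeasure_lborel_Icc_eq)
  show "integrable lborel (\<lambda>u. h u * EC u)"
    by (rule integrable_dominated_convergence[OF m' m w AE_I2[OF pt] AE_I2[OF dom]])
  have "(\<lambda>n. chi W g (?h n)) \<longlonglongrightarrow> chi W g h"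
    unfolding chi_def by (rule integral_dominated_convergence[OF m' m w AE_I2[OF pt] AE_I2[OF dom]])
  with lim1 show "chi W g h = I_functional W g h" using LIMSEQ_unique by blast
qed

end


section \<open>Random fields\<close>

text \<open>Rounding x down to a grid point reduces to countably many measurable sections;
  continuity of the paths recovers the field as the mesh shrinks.\<close>

lemma joint_measurable_continuous:
  fixes F :: "'a \<Rightarrow> real^2 \<Rightarrow> real"
  assumes W: "open W" and meas: "\<And>x. x \<in> W \<Longrightarrow> (\<lambda>\<omega>. F \<omega> x) \<in> borel_measurable M"
    and cont: "\<And>\<omega>. \<omega> \<in> space M \<Longrightarrow> continuous_on W (F \<omega>)"
  shows "(\<lambda>(x, \<omega>). indicator W x * F \<omega> x) \<in> borel_measurable (lborel \<Otimes>\<^sub>M M)"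
proof -
  define e where "e n = 1 / real (Suc n)" for n
  define rd :: "nat \<Rightarrow> real^2 \<Rightarrow> real^2" where "rd n x = gpt 0 (e n) (\<lfloor>x$1 / e n\<rfloor>, \<lfloor>x$2 / e n\<rfloor>)" for n x
  define V where "V x \<omega> = indicator W x * F \<omega> x" for x \<omega>
  have Vm: "(\<lambda>\<omega>. V x \<omega>) \<in> borel_measurable M" for x
    using meas[of x] by (cases "x \<in> W") (auto simp: V_def)
  have Wb [measurable]: "W \<in> sets borel" using W by simp
  have [measurable]: "(\<lambda>x::real^2. x $ i) \<in> borel_measurable borel" for i by measurable
  have step: "(\<lambda>(x, \<omega>). indicator W x * V (rd n x) \<omega>) \<in> borel_measurable ((lborel :: (real^2) measure) \<Otimes>\<^sub>M M)" for n
  proof -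
    have "(\<lambda>z. V (gpt 0 (e n) (i, j)) (snd z)) \<in> borel_measurable ((lborel :: (real^2) measure) \<Otimes>\<^sub>M M)" for i j
      using Vm by measurable
    then have "(\<lambda>z. V (gpt 0 (e n) (i, \<lfloor>fst z $ 2 / e n\<rfloor>)) (snd z)) \<in> borel_measurable ((lborel :: (real^2) measure) \<Otimes>\<^sub>M M)" for i
      by (rule measurable_compose_countable) measurable
    then have "(\<lambda>z. V (gpt 0 (e n) (\<lfloor>fst z $ 1 / e n\<rfloor>, \<lfloor>fst z $ 2 / e n\<rfloor>)) (snd z)) \<in> borel_measurable ((lborel :: (real^2) measure) \<Otimes>\<^sub>M M)"
      by (rule measurable_compose_countable) measurable
    then have "(\<lambda>z. indicator W (fst z) * V (rd n (fst z)) (snd z)) \<in> borel_measurable ((lborel :: (real^2) measure) \<Otimes>\<^sub>M M)"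
      unfolding rd_def by measurable
    then show ?thesis by (simp add: case_prod_unfold)
  qed
  have lim: "(\<lambda>n. indicator W x * V (rd n x) \<omega>) \<longlonglongrightarrow> indicator W x * F \<omega> x" if \<omega>: "\<omega> \<in> space M" for x \<omega>
  proof (cases "x \<in> W")
    case True
    have rd: "rd n x \<in> box_at x (e n)" for n
      using gpt_floor_near[of "e n" 0 x] by (simp add: rd_def e_def)
    have e0: "e \<longlonglongrightarrow> 0" unfolding e_def by (rule LIMSEQ_inverse_real_of_nat[unfolded inverse_eq_divide])
    have "(\<lambda>n. dist (rd n x) x) \<longlonglongrightarrow> 0"
    proof (rule tendsto_sandwich[OF _ _ tendsto_const])
      show "(\<lambda>n. 2 * e n) \<longlonglongrightarrow> 0" using tendsto_mult[OF tendsto_const[of 2] e0] by simp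
      show "eventually (\<lambda>n. dist (rd n x) x \<le> 2 * e n) sequentially"
        using subsetD[OF box_at_subset_cball rd] by (simp add: dist_commute)
    qed simp
    then have rx: "(\<lambda>n. rd n x) \<longlonglongrightarrow> x" by (rule tendsto_dist_iff[THEN iffD2])
    have "isCont (F \<omega>) x" using cont[OF \<omega>] W True continuous_on_eq_continuous_at by blast
    then have "(\<lambda>n. F \<omega> (rd n x)) \<longlonglongrightarrow> F \<omega> x" using rx by (rule isCont_tendsto_compose)
    moreover have "eventually (\<lambda>n. rd n x \<in> W) sequentially" using rx W True by (rule topological_tendstoD)
    then have "eventually (\<lambda>n. F \<omega> (rd n x) = indicator W x * V (rd n x) \<omega>) sequentially"
      by eventually_elim (simp add: V_def True)
    ultimately show ?thesis using True by (simp add: Lim_transform_eventually)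
  qed simp
  show ?thesis
    by (rule borel_measurable_LIMSEQ_real[OF _ step]) (auto simp: space_pair_measure intro: lim)
qed

lemma partial_deriv_measurable:
  fixes F :: "'a \<Rightarrow> real^2 \<Rightarrow> real"
  assumes W: "open W" and meas: "\<And>x. x \<in> W \<Longrightarrow> (\<lambda>\<omega>. F \<omega> x) \<in> borel_measurable M"
    and C1: "\<And>\<omega>. \<omega> \<in> space M \<Longrightarrow> C1_on W (F \<omega>)" and x: "x \<in> W"
  shows "(\<lambda>\<omega>. partial_deriv i (F \<omega>) x) \<in> borel_measurable M"
proof -
  define e where "e n = 1 / real (Suc n)" for n
  have "e \<longlonglongrightarrow> 0" unfolding e_def by (rule LIMSEQ_inverse_real_of_nat[unfolded inverse_eq_divide])
  moreover have "e n \<noteq> 0" for n by (simp add: e_def)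
  ultimately have e: "e \<longlonglongrightarrow> 0" "\<And>n. e n \<noteq> 0" by blast+
  let ?y = "\<lambda>n. x + e n *\<^sub>R axis i 1"
  let ?q = "\<lambda>n \<omega>. (if ?y n \<in> W then (F \<omega> (?y n) - F \<omega> x) / e n else 0)"
  show ?thesis
  proof (rule borel_measurable_LIMSEQ_real)
    show "?q n \<in> borel_measurable M" for n
      using meas[OF x] meas[of "?y n"] by (cases "?y n \<in> W") simp_all
    fix \<omega> assume \<omega>: "\<omega> \<in> space M"
    have "((\<lambda>t. F \<omega> (x + t *\<^sub>R axis i 1)) has_real_derivative partial_deriv i (F \<omega>) x) (at 0)"
      using axis_line_has_real_derivative[of "F \<omega>" x 0 i] C1_on_imp(1)[OF C1[OF \<omega>] x] by simp
    then have d: "((\<lambda>t. (F \<omega> (x + t *\<^sub>R axis i 1) - F \<omega> x) / t) \<longlongrightarrow> partial_deriv i (F \<omega>) x) (at 0)"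
      unfolding has_field_derivative_iff by simp
    have "filterlim e (at 0) sequentially" using e by (simp add: filterlim_at)
    from filterlim_compose[OF d this]
    have lim: "(\<lambda>n. (F \<omega> (?y n) - F \<omega> x) / e n) \<longlonglongrightarrow> partial_deriv i (F \<omega>) x" .
    have "?y \<longlonglongrightarrow> x + 0 *\<^sub>R axis i 1" by (intro tendsto_intros e)
    then have "eventually (\<lambda>n. ?y n \<in> W) sequentially" using W x by (intro topological_tendstoD) auto
    then have "eventually (\<lambda>n. (F \<omega> (?y n) - F \<omega> x) / e n = ?q n \<omega>) sequentially" by eventually_elim simp
    with lim show "(\<lambda>n. ?q n \<omega>) \<longlonglongrightarrow> partial_deriv i (F \<omega>) x" by (rule Lim_transform_eventually)
  qed
qed

text \<open>The source of measurability for \<open>chi\<close>, which is known only through its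
  almost sure equality with \<open>I_functional\<close>.\<close>

lemma (in complete_measure) borel_measurable_AE_eq:
  fixes f g :: "'a \<Rightarrow> real"
  assumes f: "f \<in> borel_measurable M" and ae: "AE x in M. g x = f x"
  shows "g \<in> borel_measurable M"
proof (rule borel_measurableI_le)
  fix a
  show "{x \<in> space M. g x \<le> a} \<in> sets M"
  proof (rule in_sets_AE)
    show "{x \<in> space M. f x \<le> a} \<in> sets M" using f by measurable
    show "AE x in M. x \<in> {x \<in> space M. f x \<le> a} \<longleftrightarrow> x \<in> {x \<in> space M. g x \<le> a}"
      using ae by eventually_elim simp
  qed auto
qed

lemma test_fun_deriv:
  assumes "h C1_differentiable_on UNIV" "closure {u. h u \<noteq> 0} \<subseteq> {u0..}"
  shows "test_fun u0 h (deriv h)"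
proof -
  obtain d where d: "\<And>x. (h has_vector_derivative d x) (at x)" "continuous_on UNIV d"
    using assms(1) by (auto simp: C1_differentiable_on_def)
  have D: "(h has_real_derivative d x) (at x)" for x
    using d(1) by (simp add: has_real_derivative_iff_has_vector_derivative)
  have "deriv h = d" using DERIV_imp_deriv[OF D] by (rule ext)
  moreover have z: "h u = 0" if "u < u0" for u
    using that assms(2) closure_subset[of "{u. h u \<noteq> 0}"] by force
  moreover have "h u0 = 0"
  proof -
    have "(h \<longlongrightarrow> h u0) (at_left u0)"
      using DERIV_isCont[OF D] by (auto simp: isCont_def intro: tendsto_mono at_le)
    moreover have "(h \<longlongrightarrow> 0) (at_left u0)"
      by (rule Lim_transform_eventually[OF tendsto_const])
        (use z in \<open>auto simp: eventually_at_left_field intro!: exI[of _ "u0 - 1"]\<close>)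
    ultimately show ?thesis by (rule tendsto_unique[OF trivial_limit_at_left_real])
  qed
  ultimately show ?thesis using D d(2) by (auto simp: test_fun_def le_less)
qed


text \<open>The identity holds path by path, and Fubini for \<open>gamma\<close> does the rest.
  Boundedness of \<open>h\<close> and \<open>deriv h\<close> dominates \<open>gamma\<close> by a
  multiple of the moment integrand. \<open>diagonal_null\<close> keeps almost every path away from
  gradients on the diagonal between the two regions, where \<open>gamma\<close> is 0 but the grid
  limit need not be.\<close>

theorem corollary2p3:
  fixes M :: "'a measure" and W :: "(real^2) set"
    and f :: "'a \<Rightarrow> real^2 \<Rightarrow> real" and u\<^sub>0 :: real and h :: "real \<Rightarrow> real"
  assumes "open W"
    and "random_C2_field M W f"
    and "AE \<omega> in M. compact (excursion W (f \<omega>) u\<^sub>0)"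
    and "AE \<omega> in M. morse_above W (f \<omega>) u\<^sub>0"
    and "(\<integral>\<^sup>+ x\<in>W. (\<integral>\<^sup>+ \<omega>. ennreal (indicator (excursion W (f \<omega>) u\<^sub>0) x *
             ((norm (grad (f \<omega>) x))\<^sup>2
              + \<bar>partial_deriv 1 (partial_deriv 1 (f \<omega>)) x\<bar>
              + \<bar>partial_deriv 2 (partial_deriv 2 (f \<omega>)) x\<bar>)) \<partial>M) \<partial>lborel) < \<infinity>"
    and "h C1_differentiable_on UNIV"
    and "closure {u. h u \<noteq> 0} \<subseteq> {u\<^sub>0..}"
    and h_bounded: "bounded (range h)" "bounded (range (deriv h))"
    and diagonal_null: "AE \<omega> in M. AE x in lborel. x \<in> excursion W (f \<omega>) u\<^sub>0 \<longrightarrow>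
           \<not> (grad (f \<omega>) x $ 1 = grad (f \<omega>) x $ 2 \<and> grad (f \<omega>) x $ 1 < 0)"
  shows "(AE \<omega> in M. integrable lborel (\<lambda>u. h u * excursion_euler W (f \<omega>) u))
    \<and> integrable M (\<lambda>\<omega>. chi W (f \<omega>) h)
    \<and> (AE \<omega> in M. set_integrable lborel W (\<lambda>x. gamma x (f \<omega>) h))
    \<and> integrable M (\<lambda>\<omega>. I_functional W (f \<omega>) h)
    \<and> (AE x in lborel. x \<in> W \<longrightarrow> integrable M (\<lambda>\<omega>. gamma x (f \<omega>) h))
    \<and> set_integrable lborel W (\<lambda>x. LINT \<omega>|M. gamma x (f \<omega>) h)
    \<and> (LINT \<omega>|M. chi W (f \<omega>) h) = (LINT \<omega>|M. I_functional W (f \<omega>) h)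
    \<and> (LINT \<omega>|M. I_functional W (f \<omega>) h) = - (LINT x:W|lborel. LINT \<omega>|M. gamma x (f \<omega>) h)"
proof -
  have rf: "prob_space M" "complete_measure M" "\<And>x. x \<in> W \<Longrightarrow> (\<lambda>\<omega>. f \<omega> x) \<in> borel_measurable M"
    "\<And>\<omega>. \<omega> \<in> space M \<Longrightarrow> C2_on W (f \<omega>)"
    using assms(2) by (auto simp: random_C2_field_def)
  interpret prob_space M by (rule rf)
  interpret C: complete_measure M by (rule rf)
  interpret P: pair_sigma_finite "lborel :: (real^2) measure" M ..
  have t: "test_fun u\<^sub>0 h (deriv h)" using assms(6,7) by (rule test_fun_deriv)
  then have hc: "continuous_on UNIV h" "continuous_on UNIV (deriv h)"
    unfolding test_fun_def by (meson DERIV_isCont continuous_at_imp_continuous_on)+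
  have hm [measurable]: "h \<in> borel_measurable borel" "deriv h \<in> borel_measurable borel"
    using hc by (auto intro: borel_measurable_continuous_onI)
  obtain A B where A: "\<And>u. \<bar>h u\<bar> \<le> A" and B: "\<And>u. \<bar>deriv h u\<bar> \<le> B"
    using h_bounded by (fastforce simp: bounded_iff)
  have AB: "0 \<le> A" "0 \<le> B" using A[of 0] B[of 0] by linarith+
  have h0: "h u = 0" "deriv h u = 0" if "u < u\<^sub>0" for u
  proof -
    show "h u = 0" using t that by (simp add: test_fun_def)
    have "eventually (\<lambda>v. h v = 0) (nhds u)"
      using eventually_nhds_in_open[of "{..<u\<^sub>0}" u] that t by (auto elim!: eventually_mono simp: test_fun_def)
    then have "deriv h u = deriv (\<lambda>_. 0) u" by (rule deriv_cong_ev) simp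
    then show "deriv h u = 0" by simp
  qed
  define \<Gamma> where "\<Gamma> x \<omega> = indicator W x * gamma x (f \<omega>) h" for x \<omega>
  define E where "E x \<omega> = indicator (excursion W (f \<omega>) u\<^sub>0) x * ((norm (grad (f \<omega>) x))\<^sup>2
    + \<bar>partial_deriv 1 (partial_deriv 1 (f \<omega>)) x\<bar> + \<bar>partial_deriv 2 (partial_deriv 2 (f \<omega>)) x\<bar>)" for x \<omega>
  have \<Gamma>m [measurable]: "(\<lambda>(x, \<omega>). \<Gamma> x \<omega>) \<in> borel_measurable (lborel \<Otimes>\<^sub>M M)"
  proof -
    have C1: "C1_on W (f \<omega>)" "C1_on W (partial_deriv i (f \<omega>))" if "\<omega> \<in> space M" for \<omega> i
      using C2_on_imp[OF rf(4)[OF that]] by auto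
    note pm = partial_deriv_measurable[OF assms(1) rf(3) C1(1)]
    have g: "(\<lambda>(x, \<omega>). indicator W x * f \<omega> x) \<in> borel_measurable (lborel \<Otimes>\<^sub>M M)"
      by (rule joint_measurable_continuous[OF assms(1) rf(3) C1_on_imp(3)[OF C1(1)]])
    have p: "(\<lambda>(x, \<omega>). indicator W x * partial_deriv i (f \<omega>) x) \<in> borel_measurable (lborel \<Otimes>\<^sub>M M)" for i
      by (rule joint_measurable_continuous[OF assms(1) pm C1_on_imp(2)[OF C1(1)]])
    have q: "(\<lambda>(x, \<omega>). indicator W x * partial_deriv i (partial_deriv i (f \<omega>)) x) \<in> borel_measurable (lborel \<Otimes>\<^sub>M M)" for i
      by (rule joint_measurable_continuous[OF assms(1) partial_deriv_measurable[OF assms(1) pm C1(2)] C1_on_imp(2)[OF C1(2)]])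
    let ?g = "\<lambda>z. (case z of (x, \<omega>) \<Rightarrow> indicator W x * f \<omega> x)"
      and ?p = "\<lambda>i z. (case z of (x, \<omega>) \<Rightarrow> indicator W x * partial_deriv i (f \<omega>) x)"
      and ?q = "\<lambda>i z. (case z of (x, \<omega>) \<Rightarrow> indicator W x * partial_deriv i (partial_deriv i (f \<omega>)) x)"
    have "(\<lambda>(x, \<omega>). \<Gamma> x \<omega>) = (\<lambda>z.
       (if ?p 2 z < ?p 1 z \<and> ?p 1 z < 0 then (?p 1 z)\<^sup>2 * deriv h (?g z) + ?q 1 z * h (?g z) else 0)
      + (if ?p 1 z < ?p 2 z \<and> ?p 2 z < 0 then (?p 2 z)\<^sup>2 * deriv h (?g z) + ?q 2 z * h (?g z) else 0))"
      by (auto simp: fun_eq_iff \<Gamma>_def gamma_def gamma_dir_def Q_def grad_def indicator_def)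
    moreover have "\<dots> \<in> borel_measurable (lborel \<Otimes>\<^sub>M M)"
      using g p q by measurable
    ultimately show ?thesis by (simp only:)
  qed
  have bound: "\<bar>\<Gamma> x \<omega>\<bar> \<le> (A + B) * E x \<omega> * indicator W x" for x \<omega>
  proof (cases "x \<in> W \<and> u\<^sub>0 \<le> f \<omega> x")
    case False
    then have "\<Gamma> x \<omega> = 0" using h0[of "f \<omega> x"] by (auto simp: \<Gamma>_def gamma_def gamma_dir_def)
    moreover have "E x \<omega> \<ge> 0" by (simp add: E_def)
    ultimately show ?thesis using AB by simp
  next
    case True
    let ?s = "partial_deriv 1 (f \<omega>) x" and ?t = "partial_deriv 2 (f \<omega>) x"
      and ?a = "partial_deriv 1 (partial_deriv 1 (f \<omega>)) x" and ?b = "partial_deriv 2 (partial_deriv 2 (f \<omega>)) x"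
    have nrm: "(norm (grad (f \<omega>) x))\<^sup>2 = ?s\<^sup>2 + ?t\<^sup>2"
      unfolding power2_norm_eq_inner by (simp add: inner_vec_def grad_def sum_2 power2_eq_square)
    have summand: "\<bar>k\<^sup>2 * deriv h v + l * h v\<bar> \<le> (A + B) * (k\<^sup>2 + \<bar>l\<bar>)" for k l v
    proof -
      have "\<bar>k\<^sup>2 * deriv h v + l * h v\<bar> \<le> k\<^sup>2 * \<bar>deriv h v\<bar> + \<bar>l\<bar> * \<bar>h v\<bar>"
        by (rule order_trans[OF abs_triangle_ineq]) (simp add: abs_mult)
      also have "\<dots> \<le> k\<^sup>2 * (A + B) + \<bar>l\<bar> * (A + B)"
        using A[of v] B[of v] AB by (intro add_mono mult_left_mono) auto
      finally show ?thesis by (simp add: algebra_simps)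
    qed
    have dir: "\<bar>indicator S v * y\<bar> \<le> \<bar>y\<bar>" for S :: "(real^2) set" and v and y :: real by (simp add: indicator_def)
    have "\<bar>\<Gamma> x \<omega>\<bar> \<le> \<bar>gamma_dir 1 x (f \<omega>) h\<bar> + \<bar>gamma_dir 2 x (f \<omega>) h\<bar>"
      using True by (simp add: \<Gamma>_def gamma_def)
    also have "\<dots> \<le> (A + B) * (?s\<^sup>2 + \<bar>?a\<bar>) + (A + B) * (?t\<^sup>2 + \<bar>?b\<bar>)"
      unfolding gamma_dir_def by (intro add_mono order_trans[OF dir summand])
    also have "\<dots> = (A + B) * E x \<omega> * indicator W x"
      using True by (simp add: E_def nrm excursion_def algebra_simps)
    finally show ?thesis .
  qed
  have int: "integrable (lborel \<Otimes>\<^sub>M M) (\<lambda>(x, \<omega>). \<Gamma> x \<omega>)"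
  proof -
    \<comment> \<open>Scaling \<Gamma> down, instead of E up, allows a comparison by monotonicity
      alone: no constant is pulled out of an integral of E, whose measurability has not been
      established. The summand 1 avoids division by zero.\<close>
    define k where "k = 1 / (A + B + 1)"
    have k: "k > 0" "k * (A + B) \<le> 1" using AB by (auto simp: k_def)
    have km: "(\<lambda>(x, \<omega>). k * \<Gamma> x \<omega>) \<in> borel_measurable (lborel \<Otimes>\<^sub>M M)"
      using \<Gamma>m by (simp add: case_prod_unfold)
    have kb: "\<bar>k * \<Gamma> x \<omega>\<bar> \<le> E x \<omega>" for x \<omega>
    proof -
      have E0: "0 \<le> E x \<omega>" by (simp add: E_def)
      have "\<bar>k * \<Gamma> x \<omega>\<bar> \<le> k * ((A + B) * E x \<omega> * indicator W x)"
        using bound[of x \<omega>] k(1) by (simp add: abs_mult)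
      also have "\<dots> = (k * (A + B)) * (E x \<omega> * indicator W x)" by simp
      also have "\<dots> \<le> 1 * (E x \<omega> * indicator W x)" using k(2) E0 by (intro mult_right_mono) auto
      also have "\<dots> \<le> E x \<omega>" using E0 by (simp add: indicator_def)
      finally show ?thesis .
    qed
    have "(\<integral>\<^sup>+z. ennreal (norm (case z of (x, \<omega>) \<Rightarrow> k * \<Gamma> x \<omega>)) \<partial>(lborel \<Otimes>\<^sub>M M))
        = (\<integral>\<^sup>+x. (\<integral>\<^sup>+\<omega>. ennreal \<bar>k * \<Gamma> x \<omega>\<bar> \<partial>M) \<partial>lborel)"
      using km by (subst nn_integral_fst[symmetric]) (auto simp: case_prod_unfold)
    also have "\<dots> \<le> (\<integral>\<^sup>+x\<in>W. (\<integral>\<^sup>+\<omega>. ennreal (E x \<omega>) \<partial>M) \<partial>lborel)"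
    proof (rule nn_integral_mono)
      fix x
      show "(\<integral>\<^sup>+\<omega>. ennreal \<bar>k * \<Gamma> x \<omega>\<bar> \<partial>M) \<le> (\<integral>\<^sup>+\<omega>. ennreal (E x \<omega>) \<partial>M) * indicator W x"
      proof (cases "x \<in> W")
        case True
        then show ?thesis using kb by (auto intro!: nn_integral_mono ennreal_leI)
      qed (simp add: \<Gamma>_def)
    qed
    also have "\<dots> < \<infinity>" using assms(5) by (simp add: E_def)
    finally have "integrable (lborel \<Otimes>\<^sub>M M) (\<lambda>(x, \<omega>). k * \<Gamma> x \<omega>)"
      using km by (intro integrableI_bounded) auto
    then have "integrable (lborel \<Otimes>\<^sub>M M) (\<lambda>z. k * (case z of (x, \<omega>) \<Rightarrow> \<Gamma> x \<omega>))"
      by (simp add: case_prod_unfold)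
    then show ?thesis using k(1) by (simp add: integrable_mult_left_iff)
  qed
  have det: "AE \<omega> in M. integrable lborel (\<lambda>u. h u * excursion_euler W (f \<omega>) u) \<and> chi W (f \<omega>) h = I_functional W (f \<omega>) h"
    using assms(3,4) diagonal_null AE_space
  proof eventually_elim
    case (elim \<omega>)
    interpret morse_field W "f \<omega>" u\<^sub>0
      by unfold_locales (use assms(1) rf(4) elim in auto)
    show ?case using chi_eq_I(1,3)[OF t elim(3)] by blast
  qed
  have I: "I_functional W (f \<omega>) h = - (\<integral>x. \<Gamma> x \<omega> \<partial>lborel)" for \<omega>
    by (simp add: I_functional_def set_lebesgue_integral_def \<Gamma>_def)
  have Ii: "integrable M (\<lambda>\<omega>. I_functional W (f \<omega>) h)"
    unfolding I using P.integrable_snd[OF int] by simp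
  have ae: "AE \<omega> in M. chi W (f \<omega>) h = I_functional W (f \<omega>) h" using det by eventually_elim simp
  have cm: "(\<lambda>\<omega>. chi W (f \<omega>) h) \<in> borel_measurable M"
    by (rule C.borel_measurable_AE_eq[OF borel_measurable_integrable[OF Ii] ae])
  have \<Gamma>W: "x \<in> W \<Longrightarrow> \<Gamma> x \<omega> = gamma x (f \<omega>) h" for x \<omega> by (simp add: \<Gamma>_def)
  have inner: "(\<integral>\<omega>. \<Gamma> x \<omega> \<partial>M) = indicator W x *\<^sub>R (LINT \<omega>|M. gamma x (f \<omega>) h)" for x
    by (simp add: \<Gamma>_def)
  show ?thesis
  proof (intro conjI)
    show "AE \<omega> in M. integrable lborel (\<lambda>u. h u * excursion_euler W (f \<omega>) u)" using det by eventually_elim simp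
    show "integrable M (\<lambda>\<omega>. chi W (f \<omega>) h)"
      using Ii cm borel_measurable_integrable[OF Ii] ae by (subst integrable_cong_AE) auto
    show "AE \<omega> in M. set_integrable lborel W (\<lambda>x. gamma x (f \<omega>) h)"
      using P.AE_integrable_snd[OF int] by eventually_elim (simp add: set_integrable_def \<Gamma>_def)
    show "integrable M (\<lambda>\<omega>. I_functional W (f \<omega>) h)" by (rule Ii)
    show "AE x in lborel. x \<in> W \<longrightarrow> integrable M (\<lambda>\<omega>. gamma x (f \<omega>) h)"
      using P.AE_integrable_fst[OF int]
    proof eventually_elim
      case (elim x)
      have "(\<lambda>\<omega>. gamma x (f \<omega>) h) = \<Gamma> x" if "x \<in> W" using \<Gamma>W[OF that] by (simp add: fun_eq_iff)
      then show ?case using elim by simp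
    qed
    show "set_integrable lborel W (\<lambda>x. LINT \<omega>|M. gamma x (f \<omega>) h)"
      using P.integrable_fst[OF int] unfolding inner set_integrable_def .
    show "(LINT \<omega>|M. chi W (f \<omega>) h) = (LINT \<omega>|M. I_functional W (f \<omega>) h)"
      by (rule integral_cong_AE[OF cm borel_measurable_integrable[OF Ii] ae])
    show "(LINT \<omega>|M. I_functional W (f \<omega>) h) = - (LINT x:W|lborel. LINT \<omega>|M. gamma x (f \<omega>) h)"
      using P.Fubini_integral[OF int] unfolding I set_lebesgue_integral_def inner[symmetric] by simp
  qed
qed


end
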